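(* Let $s_{\mathrm{SRT}}$ be a (Gaussian) sparse residual tree prediction of a function $f$ with respect to the data $(X,f_X)$. If $f\in\mathcal{N}_{G_\delta}(\Omega)$ and $r_L=f-s_{\mathrm{SRT}}$ is the residual on an arbitrary leaf node $\Omega_{L-1}$, then for any $1\leqslant q\leqslant\infty$, $\gamma\in\mathbb{N}_0^d$, and $\delta>\delta_{L-1}$, there are constants $C>0$ and $h_0>0$ such that for all $h\leqslant h_0$ it holds that $$\|D^\gamma r_L\|_{L_q(\Omega_{L-1})}\leqslant e^{C\log(h)/\sqrt h}\left(\|f\|_{\mathcal{N}_{G_\delta}(\Omega)}+C_{\mathcal{N}}\tau^{-1}\|f_X\|_2\right)+C'h^{-|\gamma|}\,\big\|r_L|X_{L-1}\big\|_\infty,$$ where $C$ depends only on the geometry of $\Omega_{L-1}$, $h_0$ may depend on $d,q,\gamma$ and the geometry of $\Omega_{L-1}$ but not on $h$ or $f$, $C'$ does not depend on $h$ or $r_L$, and $C_{\mathcal{N}}$ is a constant, depending only on $\delta_{L-1}$ and $d$, for which $\|s_{\mathrm{SRT}}\|_{\mathcal{N}_{G_\delta}(\Omega_{L-1})}\leqslant C_{\mathcal{N}}\tau^{-1}\|f_X\|_2$.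
   Context: Let $d\in\mathbb{N}$, let $\Omega\subset\mathbb{R}^d$ be a convex domain, $f:\Omega\to\mathbb{R}$ or $\mathbb{C}$, $X=\{x_1,\dots,x_N\}\subset\Omega$ a set of pairwise distinct points with fill distance $h=h_{X,\Omega}=\sup_{x\in\Omega}\min_{x_i\in X}\|x-x_i\|_2$, $f_X=(f(x_1),\dots,f(x_N))^{\mathrm T}$, and $G_\delta(x)=e^{-\delta^2\|x\|_2^2}$ for $\delta>0$. A sparse residual tree (SRT) is a binary tree; each node carries a convex subdomain of $\Omega$ and the data points lying in it, and the two children of a node are obtained by cutting its subdomain with a hyperplane. Consider the path from the root to a leaf (lowest-level) node $\Omega_{L-1}$, with $L$ levels: domains $\Omega=\Omega_0\supset\Omega_1\supset\cdots\supset\Omega_{L-1}$, datasets $X=X_0\supset X_1\supset\cdots\supset X_{L-1}$ with $X_i=X\cap\Omega_i$ and sizes $N=N_0>N_1>\cdots>N_{L-1}$, and shape parameters $0<\delta_0<\delta_1<\cdots<\delta_{L-1}$. At each level $0\leqslant i\leqslant L-1$ there are centers $\chi_i=\{\chi_i^{(j)}\}_{j=1}^{N_i'}\subseteq X_i$. Put $r_0=f$ and, recursively, let $s_i(x)=\sum_{j=1}^{N_i'}\alpha_i^{(j)}G_{\delta_i}(x-\chi_i^{(j)})$ be the least squares approximation of $r_i$ on $X_i$ (i.e. $\alpha_i$ minimizes $\|\Phi_i\alpha-r_i(X_i)\|_2$, where $\Phi_i=\big(G_{\delta_i}(x-\chi_i^{(j)})\big)_{x\in X_i,\,1\leqslant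 j\leqslant N_i'}$), and $r_{i+1}=r_i-s_i$. Let $\Phi_i=Q_iR_i$ be the QR decomposition ($Q_i$ with orthonormal columns, $R_i$ upper triangular and invertible), let $\tau_i$ be the smallest singular value of $R_i$, and $\tau=\min_{0\leqslant i\leqslant L-1}\tau_i$. The SRT prediction on the leaf is $s_{\mathrm{SRT}}(x)=\sum_{i=0}^{L-1}s_i(x)$, $x\in\Omega_{L-1}$. Native space of the Gaussian: $\mathcal{N}_{G_\delta}(\mathbb{R}^d)=\{f\in C(\mathbb{R}^d)\cap L_2(\mathbb{R}^d):\|f\|_{\mathcal{N}_{G_\delta}}^2:=\int_{\mathbb{R}^d}|\hat f(\omega)|^2e^{\|\omega\|_2^2/(4\delta^2)}\,d\omega<\infty\}$, with the corresponding inner product $(f,g)=\int\hat f\,\overline{\hat g}\,e^{\|\omega\|_2^2/(4\delta^2)}d\omega$, where $\hat f$ is the (symmetrically normalized) Fourier transform. For a domain $\Omega'\subset\mathbb{R}^d$, $\mathcal{N}_{G_\delta}(\Omega')$ consists of the restrictions $f|_{\Omega'}$ of those $f\in\mathcal{N}_{G_\delta}(\mathbb{R}^d)$ that are orthogonal to all $g\in\mathcal{N}_{G_\delta}(\mathbb{R}^d)$ with $g|_{\Omega'}=0$, normed by $\|f|_{\Omega'}\|_{\mathcal{N}_{G_\delta}(\Omega')}=\|f\|_{\mathcal{N}_{G_\delta}(\mathbb{R}^d)}$ for such $f$. $\|r_L|X_{L-1}\|_\infty$ denotes $\max_{x\in X_{L-1}}|r_L(x)|$.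
   Formalization: The constant C_N is allowed to depend on d, all shape parameters and the numbers of centers on the path (not only on δ_{L-1} and d), and h_0 may also depend on δ; the dependence claimed in the text is false. The estimate is proved for every constant satisfying the norm bound. *)

theory Defs
  imports
    "HOL-Analysis.Analysis"
    "HOL-Probability.Essential_Supremum"
    "Jordan_Normal_Form.Schur_Decomposition"
begin

text \<open>All functions are complex-valued; a real-valued \<open>f\<close> is covered through the embedding of the
  reals. A function on a subset of \<open>real ^ 'n\<close> is represented by a total function whose values
  outside the subset are never used.\<close>

section \<open>Fill distance, Gaussians, derivatives and \<open>L\<^sub>q\<close> norms\<close>

text \<open>The fill distance is extended-real valued, so it is infinite if \<open>S\<close> is unbounded.\<close>

definition fill_distance :: "(real ^ 'n) set \<Rightarrow> (real ^ 'n) set \<Rightarrow> ereal" where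
  "fill_distance X S = (SUP x\<in>S. INF y\<in>X. ereal (dist x y))"

definition gauss :: "real \<Rightarrow> real ^ 'n \<Rightarrow> real" where
  "gauss \<delta> x = exp (- (\<delta>\<^sup>2 * (norm x)\<^sup>2))"

definition partial_deriv :: "'n \<Rightarrow> (real ^ 'n \<Rightarrow> complex) \<Rightarrow> real ^ 'n \<Rightarrow> complex" where
  "partial_deriv i f x = vector_derivative (\<lambda>t. f (x + t *\<^sub>R axis i 1)) (at 0)"

text \<open>The order of the coordinates is immaterial for the smooth functions considered here, so the
  iterated partial derivatives are taken in an arbitrary fixed order.\<close>

definition coord_enum :: "'n::finite list" where
  "coord_enum = (SOME l. distinct l \<and> set l = UNIV)"

definition mderiv :: "('n::finite \<Rightarrow> nat) \<Rightarrow> (real ^ 'n \<Rightarrow> complex) \<Rightarrow> real ^ 'n \<Rightarrow> complex" where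
  "mderiv \<gamma> f = foldr (\<lambda>i. partial_deriv i ^^ \<gamma> i) coord_enum f"

definition Lq_norm :: "ereal \<Rightarrow> (real ^ 'n) set \<Rightarrow> (real ^ 'n \<Rightarrow> complex) \<Rightarrow> ereal" where
  "Lq_norm q S g =
     (if g \<notin> borel_measurable (lebesgue_on S) then \<infinity>
      else if q = \<infinity> then esssup (lebesgue_on S) (\<lambda>x. ereal (cmod (g x)))
      else let I = (\<integral>\<^sup>+ x. ennreal (cmod (g x) powr real_of_ereal q) \<partial>lebesgue_on S)
           in if I = \<infinity> then \<infinity> else ereal (enn2real I powr (1 / real_of_ereal q)))"


section \<open>Native spaces of the Gaussian\<close>

definition square_integrable :: "(real ^ 'n \<Rightarrow> complex) \<Rightarrow> bool" where
  "square_integrable f \<longleftrightarrow>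
     f \<in> borel_measurable lborel \<and> integrable lborel (\<lambda>x. (cmod (f x))\<^sup>2)"

definition truncated_fourier :: "real \<Rightarrow> (real ^ 'n \<Rightarrow> complex) \<Rightarrow> real ^ 'n \<Rightarrow> complex" where
  "truncated_fourier R f \<omega> =
     of_real ((2 * pi) powr (- real CARD('n) / 2)) *
     set_lebesgue_integral lborel (cball 0 R) (\<lambda>x. cis (- (x \<bullet> \<omega>)) * f x)"

text \<open>The Fourier transform on \<open>L\<^sub>2\<close> is the limit in \<open>L\<^sub>2\<close> of the transforms of the truncations
  to growing balls. It is determined almost everywhere only; all uses are under integrals.\<close>

definition is_fourier :: "(real ^ 'n \<Rightarrow> complex) \<Rightarrow> (real ^ 'n \<Rightarrow> complex) \<Rightarrow> bool" where
  "is_fourier f g \<longleftrightarrow>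
     square_integrable g \<and>
     ((\<lambda>R. \<integral>\<^sup>+ \<omega>. ennreal ((cmod (g \<omega> - truncated_fourier R f \<omega>))\<^sup>2) \<partial>lborel) \<longlongrightarrow> 0) at_top"

definition fourier :: "(real ^ 'n \<Rightarrow> complex) \<Rightarrow> real ^ 'n \<Rightarrow> complex" where
  "fourier f = (SOME g. is_fourier f g)"

definition native_weight :: "real \<Rightarrow> real ^ 'n \<Rightarrow> real" where
  "native_weight \<delta> \<omega> = exp ((norm \<omega>)\<^sup>2 / (4 * \<delta>\<^sup>2))"

definition native_space :: "real \<Rightarrow> (real ^ 'n \<Rightarrow> complex) set" where
  "native_space \<delta> = {f. continuous_on UNIV f \<and> square_integrable f \<and>
     is_fourier f (fourier f) \<and>
     integrable lborel (\<lambda>\<omega>. (cmod (fourier f \<omega>))\<^sup>2 * native_weight \<delta> \<omega>)}"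

definition native_inner ::
  "real \<Rightarrow> (real ^ 'n \<Rightarrow> complex) \<Rightarrow> (real ^ 'n \<Rightarrow> complex) \<Rightarrow> complex" where
  "native_inner \<delta> f g =
     (LINT \<omega>|lborel. fourier f \<omega> * cnj (fourier g \<omega>) * of_real (native_weight \<delta> \<omega>))"

definition native_norm :: "real \<Rightarrow> (real ^ 'n \<Rightarrow> complex) \<Rightarrow> real" where
  "native_norm \<delta> f = sqrt (LINT \<omega>|lborel. (cmod (fourier f \<omega>))\<^sup>2 * native_weight \<delta> \<omega>)"

definition native_extension ::
  "real \<Rightarrow> (real ^ 'n) set \<Rightarrow> (real ^ 'n \<Rightarrow> complex) \<Rightarrow> (real ^ 'n \<Rightarrow> complex) \<Rightarrow> bool" where
  "native_extension \<delta> S f F \<longleftrightarrow>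
     F \<in> native_space \<delta> \<and>
     (\<forall>g\<in>native_space \<delta>. (\<forall>x\<in>S. g x = 0) \<longrightarrow> native_inner \<delta> F g = 0) \<and>
     (\<forall>x\<in>S. f x = F x)"

definition native_space_on :: "real \<Rightarrow> (real ^ 'n) set \<Rightarrow> (real ^ 'n \<Rightarrow> complex) set" where
  "native_space_on \<delta> S = {f. \<exists>F. native_extension \<delta> S f F}"

text \<open>The extension is unique: the difference of two of them vanishes on \<open>S\<close> and is orthogonal to
  itself.\<close>

definition native_norm_on :: "real \<Rightarrow> (real ^ 'n) set \<Rightarrow> (real ^ 'n \<Rightarrow> complex) \<Rightarrow> real" where
  "native_norm_on \<delta> S f = native_norm \<delta> (SOME F. native_extension \<delta> S f F)"


section \<open>Least squares, QR decomposition and singular values\<close>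

definition vec_norm2 :: "complex Matrix.vec \<Rightarrow> real" where
  "vec_norm2 v = L2_set (\<lambda>i. cmod (Matrix.vec_index v i)) {..<dim_vec v}"

definition sample :: "(real ^ 'n \<Rightarrow> complex) \<Rightarrow> (real ^ 'n) list \<Rightarrow> complex Matrix.vec" where
  "sample f xs = vec_of_list (map f xs)"

definition gauss_matrix :: "real \<Rightarrow> (real ^ 'n) list \<Rightarrow> (real ^ 'n) list \<Rightarrow> complex Matrix.mat" where
  "gauss_matrix \<delta> xs cs =
     Matrix.mat (length xs) (length cs) (\<lambda>(i, j). of_real (gauss \<delta> (xs ! i - cs ! j)))"

definition least_squares_solution ::
  "complex Matrix.mat \<Rightarrow> complex Matrix.vec \<Rightarrow> complex Matrix.vec \<Rightarrow> bool" where
  "least_squares_solution A y \<alpha> \<longleftrightarrow>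
     \<alpha> \<in> carrier_vec (dim_col A) \<and>
     (\<forall>\<beta> \<in> carrier_vec (dim_col A). vec_norm2 (A *\<^sub>v \<alpha> - y) \<le> vec_norm2 (A *\<^sub>v \<beta> - y))"

definition QR_decomposition ::
  "complex Matrix.mat \<Rightarrow> complex Matrix.mat \<Rightarrow> complex Matrix.mat \<Rightarrow> bool" where
  "QR_decomposition A Q R \<longleftrightarrow>
     Q \<in> carrier_mat (dim_row A) (dim_col A) \<and> R \<in> carrier_mat (dim_col A) (dim_col A) \<and>
     A = Q * R \<and> mat_adjoint Q * Q = 1\<^sub>m (dim_col A) \<and>
     upper_triangular R \<and> invertible_mat R"

definition singular_values :: "complex Matrix.mat \<Rightarrow> real set" where
  "singular_values A = {\<sigma>. 0 \<le> \<sigma> \<and> eigenvalue (mat_adjoint A * A) (of_real (\<sigma>\<^sup>2))}"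


section \<open>Sparse residual trees\<close>

record ('n::finite) srt_node =
  region :: "(real ^ 'n) set"
  shape :: real
  centers :: "(real ^ 'n) list"
  coeffs :: "complex Matrix.vec"
  Q_factor :: "complex Matrix.mat"
  R_factor :: "complex Matrix.mat"

datatype 'a srt = Leaf 'a | Branch 'a "'a srt" "'a srt"

fun root_node :: "'a srt \<Rightarrow> 'a" where
  "root_node (Leaf n) = n"
| "root_node (Branch n l r) = n"

text \<open>The paths from the root to a leaf, as lists of nodes in the order of increasing level.\<close>

fun branches :: "'a srt \<Rightarrow> 'a list set" where
  "branches (Leaf n) = {[n]}"
| "branches (Branch n l r) = (#) n ` (branches l \<union> branches r)"

definition node_data :: "(real ^ 'n) list \<Rightarrow> 'n::finite srt_node \<Rightarrow> (real ^ 'n) list" where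
  "node_data X n = filter (\<lambda>x. x \<in> region n) X"

definition node_matrix :: "(real ^ 'n) list \<Rightarrow> 'n::finite srt_node \<Rightarrow> complex Matrix.mat" where
  "node_matrix X n = gauss_matrix (shape n) (node_data X n) (centers n)"

definition node_approx :: "'n::finite srt_node \<Rightarrow> real ^ 'n \<Rightarrow> complex" where
  "node_approx n x =
     (\<Sum>j<length (centers n). Matrix.vec_index (coeffs n) j * of_real (gauss (shape n) (x - centers n ! j)))"

definition node_tau :: "'n::finite srt_node \<Rightarrow> real" where
  "node_tau n = Min (singular_values (R_factor n))"

text \<open>\<open>srt_node_ok X r n\<close>: the node \<open>n\<close> carries the least squares approximation of the current
  residual \<open>r\<close> on the data in its region.\<close>

definition srt_node_ok ::
  "(real ^ 'n) list \<Rightarrow> (real ^ 'n \<Rightarrow> complex) \<Rightarrow> 'n::finite srt_node \<Rightarrow> bool" where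
  "srt_node_ok X r n \<longleftrightarrow>
     convex (region n) \<and> interior (region n) \<noteq> {} \<and> 0 < shape n \<and>
     centers n \<noteq> [] \<and> distinct (centers n) \<and> set (centers n) \<subseteq> set (node_data X n) \<and>
     least_squares_solution (node_matrix X n) (sample r (node_data X n)) (coeffs n) \<and>
     QR_decomposition (node_matrix X n) (Q_factor n) (R_factor n)"

text \<open>The two parts into which a hyperplane cuts \<open>A\<close>. Points of \<open>A\<close> on the hyperplane may be
  assigned to either part, which covers the open, the closed and the half-open conventions.\<close>

definition hyperplane_cut :: "(real ^ 'n) set \<Rightarrow> (real ^ 'n) set \<Rightarrow> (real ^ 'n) set \<Rightarrow> bool" where
  "hyperplane_cut A B1 B2 \<longleftrightarrow>
     (\<exists>a b. a \<noteq> 0 \<and>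
        A \<inter> {x. a \<bullet> x < b} \<subseteq> B1 \<and> B1 \<subseteq> A \<inter> {x. a \<bullet> x \<le> b} \<and>
        A \<inter> {x. a \<bullet> x > b} \<subseteq> B2 \<and> B2 \<subseteq> A \<inter> {x. a \<bullet> x \<ge> b})"

definition srt_child_ok ::
  "(real ^ 'n) list \<Rightarrow> 'n::finite srt_node \<Rightarrow> 'n srt_node \<Rightarrow> bool" where
  "srt_child_ok X n c \<longleftrightarrow>
     shape n < shape c \<and> length (node_data X c) < length (node_data X n)"

text \<open>The recursion passes the residual \<open>r\<^sub>i\<^sub>+\<^sub>1 = r\<^sub>i - s\<^sub>i\<close> on to both children.\<close>

fun srt_fit ::
  "(real ^ 'n) list \<Rightarrow> (real ^ 'n \<Rightarrow> complex) \<Rightarrow> 'n::finite srt_node srt \<Rightarrow> bool" where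
  "srt_fit X r (Leaf n) \<longleftrightarrow> srt_node_ok X r n"
| "srt_fit X r (Branch n t1 t2) \<longleftrightarrow>
     srt_node_ok X r n \<and>
     hyperplane_cut (region n) (region (root_node t1)) (region (root_node t2)) \<and>
     srt_child_ok X n (root_node t1) \<and> srt_child_ok X n (root_node t2) \<and>
     srt_fit X (\<lambda>x. r x - node_approx n x) t1 \<and>
     srt_fit X (\<lambda>x. r x - node_approx n x) t2"

definition is_srt ::
  "(real ^ 'n) set \<Rightarrow> (real ^ 'n) list \<Rightarrow> (real ^ 'n \<Rightarrow> complex) \<Rightarrow> 'n::finite srt_node srt \<Rightarrow> bool"
  where
  "is_srt S X f T \<longleftrightarrow>
     open S \<and> convex S \<and> S \<noteq> {} \<and> distinct X \<and> set X \<subseteq> S \<and>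
     region (root_node T) = S \<and> srt_fit X f T"

definition srt_prediction :: "'n::finite srt_node list \<Rightarrow> real ^ 'n \<Rightarrow> complex" where
  "srt_prediction p x = (\<Sum>n\<leftarrow>p. node_approx n x)"

definition srt_residual ::
  "(real ^ 'n \<Rightarrow> complex) \<Rightarrow> 'n::finite srt_node list \<Rightarrow> real ^ 'n \<Rightarrow> complex" where
  "srt_residual f p x = f x - srt_prediction p x"

definition srt_tau :: "'n::finite srt_node list \<Rightarrow> real" where
  "srt_tau p = Min (node_tau ` set p)"

end

theory Submission
  imports
    Defs
    "HOL-Probability.Characteristic_Functions"
    "HOL-Real_Asymp.Real_Asymp"
begin

text \<open>
  Both \<open>f\<close> and the prediction \<open>s\<close> have Fourier transforms that are square integrable against
  \<open>exp (|\<omega>|\<^sup>2 / (4 \<delta>\<^sup>2))\<close>, so Fourier inversion represents the residual \<open>f - s\<close> as an absolutely convergent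
  integral of plane waves all of whose moments grow only like \<open>K ^ m * sqrt (fact m)\<close>. Replacing each plane
  wave by its Taylor polynomial of degree below \<open>m\<close> therefore approximates the residual by a polynomial
  up to an error of order \<open>K ^ m / sqrt (fact m)\<close>.

  On a convex set that contains a ball, Markov's inequality bounds the gradient of a polynomial of
  degree \<open>m\<close> by a multiple of \<open>m\<^sup>2\<close> times its supremum (every direction is a difference of two directions
  that point into the ball, so the one-dimensional inequality at the endpoint of an interval
  suffices). Hence data that are dense at scale \<open>m\<^sup>-\<^sup>2\<close> control the supremum of the polynomial, and
  differentiating it costs powers of \<open>m\<^sup>2\<close>. With \<open>m\<close> of order \<open>1 / sqrt h\<close> this yields the factor \<open>h ^ (-|\<gamma>|)\<close> and
  the error term \<open>exp (C * ln h / sqrt h)\<close>.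

  The norm of the prediction is controlled by the coefficients \<open>\<alpha>\<^sub>i\<close> of the least squares problems:
  \<open>|\<alpha>\<^sub>i| \<le> \<tau>\<^sub>i\<^sup>-\<^sup>1 |r\<^sub>i(X\<^sub>i)|\<close>, and the residual norms do not increase along a branch. Since a function in the native
  space is real analytic, it is determined by its values on a set with interior, so the prediction is
  its own minimal extension.
\<close>

hide_const (open) Module.smult
no_notation scalar_prod (infix "\<bullet>" 70)

section \<open>Univariate Markov inequality at an endpoint\<close>

text \<open>Which constant may depend on what is decided by a comparison of exponents. With
  \<open>A = 4 * (R / \<rho> + 1) / \<rho>\<close>, built from an inner and an outer radius of the
  leaf region, the data control degrees with m^2 A h \<le> 1. The logarithm of the Taylor error is
  -(m/2) ln m + O(m), and ln (1/h) is about 2 ln m, so the error behaves like exp (ln h / (4 sqrt (A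
  h))). Half of this rate is kept, C = 1 / (8 sqrt A); the other half absorbs, for small h,
  everything that depends on \<delta>, \<gamma> and q, which therefore enters h0 but not C.

  Two features of the setting shape the analysis. \<open>fourier\<close> is a choice among L2 limits
  that are determined only almost everywhere, so pointwise inversion is obtained by Gaussian
  damping, and concrete functions are tied to \<open>fourier\<close> through equality almost
  everywhere. Multivariate polynomials occur only as integrals of Taylor polynomials of plane waves;
  their polynomial nature is exploited along lines, where they become univariate.\<close>

fun chebyshev :: "nat \<Rightarrow> real poly" where
  "chebyshev 0 = 1"
| "chebyshev (Suc 0) = [:0, 1:]"
| "chebyshev (Suc (Suc n)) = [:0, 2:] * chebyshev (Suc n) - chebyshev n"

lemma poly_chebyshev_cos: "poly (chebyshev n) (cos t) = cos (real n * t)"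
proof (induction n rule: chebyshev.induct)
  case (3 n)
  define a where "a = real (Suc n) * t"
  have "real n * t = a - t" "real (Suc (Suc n)) * t = a + t" by (simp_all add: a_def algebra_simps)
  then have "cos (real (Suc (Suc n)) * t) = 2 * cos t * cos a - cos (real n * t)"
    by (simp only: cos_add cos_diff) simp
  with 3 show ?case by (simp add: a_def)
qed simp_all

lemma degree_chebyshev_le: "degree (chebyshev n) \<le> n"
proof (induction n rule: chebyshev.induct)
  case (3 n)
  have "degree ([:0, 2:] * chebyshev (Suc n)) \<le> 1 + Suc n"
    by (rule order_trans[OF degree_mult_le]) (use 3 in \<open>simp add: add_mono\<close>)
  with 3 show ?case by (auto intro!: degree_diff_le)
qed simp_all

lemma poly_chebyshev_1 [simp]: "poly (chebyshev n) 1 = 1"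
  using poly_chebyshev_cos[of n 0] by simp

lemma poly_pderiv_chebyshev_1: "poly (pderiv (chebyshev n)) 1 = (real n)\<^sup>2"
proof (induction n rule: chebyshev.induct)
  case (3 n)
  then show ?case
    by (simp add: pderiv_mult pderiv_diff pderiv_pCons pderiv_smult algebra_simps power2_eq_square)
qed (simp_all add: pderiv_pCons)

text \<open>Comparison with the Chebyshev polynomial: if \<open>q' 1\<close> were larger than \<open>n\<^sup>2\<close>, then \<open>chebyshev n - q / c\<close> with
  \<open>c = q' 1 / n\<^sup>2 > 1\<close> would alternate in sign at the \<open>n + 1\<close> extremal points of \<open>chebyshev n\<close> and have a critical
  point at \<open>1\<close>. Together with Rolle's theorem this gives its derivative too many zeros.\<close>

lemma markov_endpoint_aux:
  fixes q :: "real poly"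
  assumes deg: "degree q \<le> n" and bound: "\<And>x. -1 \<le> x \<Longrightarrow> x \<le> 1 \<Longrightarrow> \<bar>poly q x\<bar> \<le> 1"
  shows "poly (pderiv q) 1 \<le> (real n)\<^sup>2"
proof (rule ccontr)
  assume "\<not> ?thesis"
  then have gt: "poly (pderiv q) 1 > (real n)\<^sup>2" by simp
  have n: "n > 0"
  proof (rule ccontr)
    assume "\<not> n > 0"
    then have "degree q = 0" using deg by simp
    then have "pderiv q = 0" by (simp add: pderiv_eq_0_iff)
    with gt show False by simp
  qed
  define c where "c = poly (pderiv q) 1 / (real n)\<^sup>2"
  have c: "c > 1" using gt n by (simp add: c_def field_simps)
  define r where "r = chebyshev n - smult (1 / c) q"
  have r1: "poly (pderiv r) 1 = 0"
  proof -
    have "poly (pderiv q) 1 \<noteq> 0" using gt zero_le_power2[of "real n"] by linarith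
    then show ?thesis
      by (simp add: r_def pderiv_diff pderiv_smult poly_pderiv_chebyshev_1 c_def)
  qed
  have degr: "degree r \<le> n"
    unfolding r_def by (intro degree_diff_le degree_chebyshev_le order_trans[OF degree_smult_le] deg)
  define x where "x k = cos (real k * (pi / real n))" for k
  have small: "\<bar>poly q (x k) / c\<bar> < 1" for k
  proof -
    have "\<bar>poly q (x k)\<bar> \<le> 1" by (intro bound) (auto simp: x_def)
    then show ?thesis using c by (simp add: field_simps)
  qed
  have rx: "poly r (x k) = (-1) ^ k - poly q (x k) / c" for k
  proof -
    have "poly (chebyshev n) (x k) = cos (real k * pi)"
      using n by (simp add: x_def poly_chebyshev_cos)
    then show ?thesis by (simp add: r_def)
  qed
  have sgn: "(-1) ^ k * poly r (x k) > 0" for k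
    using small[of k] unfolding rx abs_less_iff by (cases "even k") auto
  have xdec: "x (Suc k) < x k" if "k < n" for k
  proof -
    have "real k * (pi / n) < real (Suc k) * (pi / n)" using n by (intro mult_strict_right_mono) auto
    moreover have "real (Suc k) * (pi / n) \<le> pi"
      using mult_right_mono[of "real (Suc k)" "real n" "pi / n"] that n by simp
    ultimately show ?thesis unfolding x_def by (intro cos_monotone_0_pi) auto
  qed
  have "\<exists>z. x (Suc k) < z \<and> z < x k \<and> poly r z = 0" if "k < n" for k
  proof -
    have "poly r (x (Suc k)) * poly r (x k) < 0"
    proof -
      have "((-1) ^ k * poly r (x k)) * ((-1) ^ Suc k * poly r (x (Suc k))) > 0"
        using sgn[of k] sgn[of "Suc k"] by (rule mult_pos_pos)
      moreover have "((-1) ^ k * poly r (x k)) * ((-1) ^ Suc k * poly r (x (Suc k))) = - (poly r (x (Suc k)) * poly r (x k))"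
        by (cases "even k") auto
      ultimately show ?thesis by linarith
    qed
    from poly_IVT[OF xdec[OF that] this] show ?thesis by blast
  qed
  then obtain \<xi> where \<xi>: "\<And>k. k < n \<Longrightarrow> x (Suc k) < \<xi> k \<and> \<xi> k < x k \<and> poly r (\<xi> k) = 0" by metis
  have \<xi>dec: "\<xi> (Suc k) < \<xi> k" if "Suc k < n" for k
    using \<xi>[of k] \<xi>[of "Suc k"] that by auto
  have "\<exists>z. \<xi> (Suc k) < z \<and> z < \<xi> k \<and> poly (pderiv r) z = 0" if "Suc k < n" for k
    using poly_MVT[OF \<xi>dec[OF that], of r] \<xi>[of k] \<xi>[of "Suc k"] that \<xi>dec[OF that] by auto
  then obtain \<eta> where \<eta>: "\<And>k. Suc k < n \<Longrightarrow> \<xi> (Suc k) < \<eta> k \<and> \<eta> k < \<xi> k \<and> poly (pderiv r) (\<eta> k) = 0"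
    by metis
  have \<xi>mono: "\<xi> l \<le> \<xi> k" if "k \<le> l" "l < n" for k l
    using that by (induction l rule: dec_induct) (use \<xi>dec in \<open>force+\<close>)
  have \<eta>dec: "\<eta> l < \<eta> k" if "k < l" "Suc l < n" for k l
    using \<eta>[of l] \<eta>[of k] \<xi>mono[of "Suc k" l] that by auto
  have inj: "inj_on \<eta> {..<n - 1}"
    by (rule linorder_inj_onI) (use \<eta>dec in fastforce)+
  have lt1: "\<eta> k < 1" if "Suc k < n" for k
  proof -
    have "\<xi> k < x k" using \<xi>[of k] that by auto
    moreover have "x k \<le> 1" by (simp add: x_def)
    ultimately show ?thesis using \<eta>[OF that] by auto
  qed
  have "pderiv r = 0"
  proof (rule ccontr)
    assume nz: "pderiv r \<noteq> 0"
    have sub: "insert 1 (\<eta> ` {..<n - 1}) \<subseteq> {z. poly (pderiv r) z = 0}"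
      using r1 \<eta> by auto
    have "card (insert 1 (\<eta> ` {..<n - 1})) = Suc (card (\<eta> ` {..<n - 1}))"
      using lt1 by (intro card_insert_disjoint) (fastforce simp: less_diff_conv)+
    then have "n = card (insert 1 (\<eta> ` {..<n - 1}))" using inj n by (simp add: card_image)
    also have "\<dots> \<le> card {z. poly (pderiv r) z = 0}"
      by (intro card_mono poly_roots_finite nz sub)
    also have "\<dots> \<le> degree (pderiv r)" by (intro card_poly_roots_bound nz)
    also have "\<dots> < n" using degr n by (simp add: degree_pderiv)
    finally show False by simp
  qed
  \<comment> \<open>A constant polynomial with the zero \<open>\<xi> 0\<close> is 0, but
    \<open>sgn\<close> makes it strictly positive at \<open>x 0\<close>.\<close>
  then obtain a where "r = [:a:]" by (metis degree_eq_zeroE pderiv_eq_0_iff)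
  with \<xi>[of 0] sgn[of 0] n show False by auto
qed

lemma poly_sum_le:
  fixes p :: "'a::comm_ring_1 poly"
  assumes "degree p \<le> n"
  shows "poly p x = (\<Sum>i\<le>n. coeff p i * x ^ i)"
  unfolding poly_altdef
  by (rule sum.mono_neutral_left) (use assms in \<open>auto simp: coeff_eq_0\<close>)

text \<open>A rotation \<open>u\<close> turns the derivative at 0 into its modulus, so the real
  polynomial Re (u q) carries the whole derivative and is bounded by the same \<open>M\<close>. The
  factor 2 is the scaling from [0, 1] to [-1, 1].\<close>

lemma markov_endpoint:
  fixes q :: "complex poly"
  assumes deg: "degree q \<le> n"
    and bound: "\<And>t. 0 \<le> t \<Longrightarrow> t \<le> 1 \<Longrightarrow> cmod (poly q (of_real t)) \<le> M"
  shows "cmod (poly (pderiv q) 0) \<le> 2 * (real n)\<^sup>2 * M"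
proof -
  have M0: "0 \<le> M" using order_trans[OF norm_ge_zero bound[of 0]] by simp
  show ?thesis
  proof (cases "poly (pderiv q) 0 = 0")
    case False
    define u where "u = cnj (poly (pderiv q) 0) / of_real (cmod (poly (pderiv q) 0))"
    have u: "cmod u = 1" using False by (simp add: u_def norm_divide)
    have u': "Re (u * poly (pderiv q) 0) = cmod (poly (pderiv q) 0)"
    proof -
      define z where "z = poly (pderiv q) 0"
      have "u * z = of_real ((cmod z)\<^sup>2) / of_real (cmod z)"
        by (simp add: u_def z_def complex_norm_square mult.commute del: of_real_power)
      then show ?thesis using False by (simp add: z_def power2_eq_square)
    qed
    define r where "r = map_poly Re (smult u q)"
    have coeff_r: "coeff r i = Re (u * coeff q i)" for i by (simp add: r_def coeff_map_poly)
    have degr: "degree r \<le> n"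
      by (intro degree_le) (use deg in \<open>auto simp: coeff_r coeff_eq_0\<close>)
    have poly_r: "poly r t = Re (u * poly q (of_real t))" for t
    proof -
      have "poly r t = (\<Sum>i\<le>n. Re (u * coeff q i) * t ^ i)"
        by (subst poly_sum_le[OF degr]) (simp add: coeff_r)
      also have "\<dots> = Re (\<Sum>i\<le>n. u * (coeff q i * of_real t ^ i))"
        unfolding Re_sum by (intro sum.cong refl) (simp flip: of_real_power mult.assoc)
      also have "\<dots> = Re (u * poly q (of_real t))"
        by (subst poly_sum_le[OF deg]) (simp add: sum_distrib_left)
      finally show ?thesis .
    qed
    have dr: "poly (pderiv r) 0 = cmod (poly (pderiv q) 0)"
    proof -
      have "poly (pderiv r) 0 = coeff r 1" by (simp add: poly_0_coeff_0 coeff_pderiv)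
      also have "\<dots> = Re (u * poly (pderiv q) 0)" by (simp add: poly_0_coeff_0 coeff_pderiv coeff_r)
      finally show ?thesis using u' by simp
    qed
    have rb: "\<bar>poly r t\<bar> \<le> M" if "0 \<le> t" "t \<le> 1" for t
    proof -
      have "\<bar>poly r t\<bar> \<le> cmod (u * poly q (of_real t))" unfolding poly_r by (rule abs_Re_le_cmod)
      also have "\<dots> \<le> M" using bound[OF that] u by (simp add: norm_mult)
      finally show ?thesis .
    qed
    \<comment> \<open>A strictly larger bound \<open>N\<close> can be divided by even if
      \<open>M\<close> is 0; letting \<open>N\<close> decrease to \<open>M\<close> recovers the
      estimate. The affine substitution sends 1 to 0, and the minus sign compensates its reversal of
      orientation.\<close>
    have main: "poly (pderiv r) 0 \<le> 2 * (real n)\<^sup>2 * N" if N: "N > M" for N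
    proof -
      define s where "s = smult (- 1 / N) (pcompose r [:1/2, -1/2:])"
      have Npos: "N > 0" using N M0 by simp
      have "degree s \<le> n"
        using degr Npos by (auto simp: s_def degree_pcompose)
      moreover have "\<bar>poly s x\<bar> \<le> 1" if "-1 \<le> x" "x \<le> 1" for x
      proof -
        have "\<bar>poly r (1/2 - x/2)\<bar> \<le> M" using that by (intro rb) auto
        then show ?thesis using Npos N by (simp add: s_def poly_pcompose abs_mult field_simps)
      qed
      ultimately have "poly (pderiv s) 1 \<le> (real n)\<^sup>2" by (rule markov_endpoint_aux)
      moreover have "poly (pderiv s) 1 = poly (pderiv r) 0 / (2 * N)"
        by (simp add: s_def pderiv_smult pderiv_pcompose poly_pcompose pderiv_pCons pderiv_minus)
      ultimately show ?thesis using Npos by (simp add: field_simps)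
    qed
    have "((\<lambda>N. 2 * (real n)\<^sup>2 * N) \<longlongrightarrow> 2 * (real n)\<^sup>2 * M) (at_right M)"
      by (intro tendsto_intros)
    then have "poly (pderiv r) 0 \<le> 2 * (real n)\<^sup>2 * M"
      by (rule tendsto_lowerbound)
        (use main in \<open>auto simp: eventually_at_filter intro!: always_eventually\<close>)
    then show ?thesis using dr by simp
  qed (use M0 in auto)
qed

section \<open>Gaussian integrals and the heat kernel\<close>

text \<open>Lebesgue measure is the image of a product of one-dimensional Lebesgue measures under
  the coordinate isomorphism, so product integrands reduce to one variable.\<close>

lemma lborel_prod_integral:
  fixes g :: "'a::euclidean_space \<Rightarrow> real \<Rightarrow> complex"
  assumes "\<And>b. b \<in> Basis \<Longrightarrow> integrable lborel (g b)"
  shows "integrable lborel (\<lambda>x::'a. \<Prod>b\<in>Basis. g b (x \<bullet> b))"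
    and "(LINT x|lborel. (\<Prod>b\<in>Basis. g b (x \<bullet> b))) = (\<Prod>b\<in>Basis. LINT y|lborel. g b y)"
proof -
  interpret product_sigma_finite "\<lambda>_::'a. lborel :: real measure" ..
  have m [measurable]: "g b \<in> borel_measurable borel" if "b \<in> Basis" for b
    using assms[OF that] borel_measurable_integrable by fastforce
  have meas: "(\<lambda>x::'a. \<Prod>b\<in>Basis. g b (x \<bullet> b)) \<in> borel_measurable borel"
    by measurable
  have map: "(\<lambda>f. \<Sum>b\<in>Basis. f b *\<^sub>R b) \<in> (\<Pi>\<^sub>M b\<in>Basis. lborel) \<rightarrow>\<^sub>M (borel :: 'a measure)"
    by measurable
  have eq: "(\<lambda>f. \<Prod>b\<in>Basis. g b ((\<Sum>b\<in>Basis. f b *\<^sub>R b) \<bullet> b)) = (\<lambda>f. \<Prod>b\<in>Basis. g b (f b))"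
    by (auto simp: fun_eq_iff intro!: prod.cong)
  show "integrable lborel (\<lambda>x::'a. \<Prod>b\<in>Basis. g b (x \<bullet> b))"
    unfolding lborel_eq[where 'a='a] integrable_distr_eq[OF map meas] eq
    by (rule product_integrable_prod) (use assms in auto)
  show "(LINT x|lborel. (\<Prod>b\<in>Basis. g b (x \<bullet> b))) = (\<Prod>b\<in>Basis. LINT y|lborel. g b y)"
    unfolding lborel_eq[where 'a='a] integral_distr[OF map meas] eq
    by (rule product_integral_prod) (use assms in auto)
qed

text \<open>A rescaled characteristic function of the standard normal distribution: with
  \<open>c = sqrt (2 * a)\<close> the exponent a y^2 equals (c y)^2 / 2.\<close>

lemma gaussian_fourier_real:
  fixes a t :: real
  assumes a: "0 < a"
  shows "integrable lborel (\<lambda>y. cis (t * y) * of_real (exp (- (a * y\<^sup>2))))"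
    and "(LINT y|lborel. cis (t * y) * of_real (exp (- (a * y\<^sup>2)))) = of_real (sqrt (pi / a) * exp (- (t\<^sup>2 / (4 * a))))"
proof -
  define c where "c = sqrt (2 * a)"
  have c: "c > 0" "c\<^sup>2 = 2 * a" using a by (auto simp: c_def)
  define F where "F x = std_normal_density x *\<^sub>R iexp (t / c * x)" for x
  have intF: "integrable lborel F"
  proof -
    interpret real_distribution std_normal_distribution by (rule real_dist_normal_dist)
    have "integrable std_normal_distribution (\<lambda>x. iexp (t / c * x))"
      by (rule integrable_const_bound[where B=1]) auto
    then show ?thesis unfolding F_def by (subst (asm) integrable_density) auto
  qed
  have "char std_normal_distribution (t / c) = (LINT x|lborel. F x)"
    unfolding char_def F_def by (subst integral_density) auto
  then have valF: "(LINT x|lborel. F x) = of_real (exp (- ((t / c)\<^sup>2) / 2))"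
    by (simp add: char_std_normal_distribution)
  have scaled: "F (0 + c * y) = of_real (1 / sqrt (2 * pi)) * (cis (t * y) * of_real (exp (- (a * y\<^sup>2))))" for y
    using c by (simp add: F_def std_normal_density_def power_mult_distrib cis_conv_exp scaleR_conv_of_real mult_ac)
  have "integrable lborel (\<lambda>y. F (0 + c * y))"
    using lborel_integrable_real_affine[OF intF, of c 0] c by simp
  then have "integrable lborel (\<lambda>y. of_real (sqrt (2 * pi)) * F (0 + c * y))"
    by (rule integrable_mult_right)
  moreover have "of_real (sqrt (2 * pi)) * F (0 + c * y) = cis (t * y) * of_real (exp (- (a * y\<^sup>2)))" for y
    unfolding scaled by simp
  ultimately show "integrable lborel (\<lambda>y. cis (t * y) * of_real (exp (- (a * y\<^sup>2))))" by simp
  have "(LINT x|lborel. F x) = \<bar>c\<bar> *\<^sub>R (LINT y|lborel. F (0 + c * y))"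
    using c by (intro lborel_integral_real_affine) simp
  also have "\<dots> = of_real (c / sqrt (2 * pi)) * (LINT y|lborel. cis (t * y) * of_real (exp (- (a * y\<^sup>2))))"
    unfolding scaled using c by (simp add: scaleR_conv_of_real)
  finally have "(LINT y|lborel. cis (t * y) * of_real (exp (- (a * y\<^sup>2)))) = of_real (sqrt (2 * pi) / c) * (LINT x|lborel. F x)"
    using c by (simp add: field_simps)
  also have "sqrt (2 * pi) / c = sqrt (pi / a)" by (simp add: c_def real_sqrt_divide real_sqrt_mult)
  finally show "(LINT y|lborel. cis (t * y) * of_real (exp (- (a * y\<^sup>2)))) = of_real (sqrt (pi / a) * exp (- (t\<^sup>2 / (4 * a))))"
    unfolding valF using c by (simp add: power_divide)
qed

lemma cis_sum: "finite A \<Longrightarrow> cis (sum f A) = (\<Prod>x\<in>A. cis (f x))"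
  by (induction A rule: finite_induct) (auto simp flip: cis_mult)

lemma norm_sq_Basis: "(norm x)\<^sup>2 = (\<Sum>b\<in>Basis. (x \<bullet> b)\<^sup>2)" for x :: "'a::euclidean_space"
  by (subst power2_norm_eq_inner, subst euclidean_inner) (simp add: power2_eq_square)

text \<open>Both the plane wave and the Gaussian factor over the coordinates.\<close>

lemma gaussian_fourier:
  fixes x :: "'a::euclidean_space"
  assumes a: "0 < a"
  shows "integrable lborel (\<lambda>\<omega>. cis (x \<bullet> \<omega>) * of_real (exp (- (a * (norm \<omega>)\<^sup>2))))"
    and "(LINT \<omega>|lborel. cis (x \<bullet> \<omega>) * of_real (exp (- (a * (norm \<omega>)\<^sup>2)))) =
      of_real ((pi / a) powr (DIM('a) / 2) * exp (- ((norm x)\<^sup>2 / (4 * a))))"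
proof -
  let ?g = "\<lambda>b y. cis ((x \<bullet> b) * y) * of_real (exp (- (a * y\<^sup>2)))"
  have eq: "(\<lambda>\<omega>. cis (x \<bullet> \<omega>) * of_real (exp (- (a * (norm \<omega>)\<^sup>2)))) = (\<lambda>\<omega>. \<Prod>b\<in>Basis. ?g b (\<omega> \<bullet> b))"
  proof
    fix \<omega> :: 'a
    have "cis (x \<bullet> \<omega>) = (\<Prod>b\<in>Basis. cis ((x \<bullet> b) * (\<omega> \<bullet> b)))"
      by (subst euclidean_inner) (simp add: cis_sum)
    moreover have "exp (- (a * (norm \<omega>)\<^sup>2)) = (\<Prod>b\<in>Basis. exp (- (a * (\<omega> \<bullet> b)\<^sup>2)))"
      by (simp add: norm_sq_Basis sum_distrib_left exp_sum flip: sum_negf)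
    ultimately show "cis (x \<bullet> \<omega>) * of_real (exp (- (a * (norm \<omega>)\<^sup>2))) = (\<Prod>b\<in>Basis. ?g b (\<omega> \<bullet> b))"
      by (simp add: prod.distrib)
  qed
  show "integrable lborel (\<lambda>\<omega>. cis (x \<bullet> \<omega>) * of_real (exp (- (a * (norm \<omega>)\<^sup>2))))"
    unfolding eq by (intro lborel_prod_integral gaussian_fourier_real a)
  have "(LINT \<omega>|lborel. cis (x \<bullet> \<omega>) * of_real (exp (- (a * (norm \<omega>)\<^sup>2)))) = (\<Prod>b\<in>Basis. LINT y|lborel. ?g b y)"
    unfolding eq by (intro lborel_prod_integral gaussian_fourier_real a)
  also have "\<dots> = (\<Prod>b\<in>Basis. of_real (sqrt (pi / a) * exp (- ((x \<bullet> b)\<^sup>2 / (4 * a)))))"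
    by (simp only: gaussian_fourier_real(2)[OF a])
  also have "\<dots> = of_real (sqrt (pi / a) ^ DIM('a) * exp (- ((norm x)\<^sup>2 / (4 * a))))"
    by (simp add: prod.distrib norm_sq_Basis exp_sum sum_divide_distrib flip: sum_negf of_real_prod)
  also have "sqrt (pi / a) ^ DIM('a) = (pi / a) powr (DIM('a) / 2)"
    using a by (simp add: powr_half_sqrt[symmetric] powr_powr flip: powr_realpow)
  finally show "(LINT \<omega>|lborel. cis (x \<bullet> \<omega>) * of_real (exp (- (a * (norm \<omega>)\<^sup>2)))) =
      of_real ((pi / a) powr (DIM('a) / 2) * exp (- ((norm x)\<^sup>2 / (4 * a))))" .
qed

lemma gaussian_integral:
  assumes a: "0 < a"
  shows "integrable lborel (\<lambda>\<omega>::'a::euclidean_space. exp (- (a * (norm \<omega>)\<^sup>2)))"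
    and "(LINT \<omega>::'a|lborel. exp (- (a * (norm \<omega>)\<^sup>2))) = (pi / a) powr (DIM('a) / 2)"
proof -
  note g = gaussian_fourier[OF a, of "0::'a"]
  show i: "integrable lborel (\<lambda>\<omega>::'a::euclidean_space. exp (- (a * (norm \<omega>)\<^sup>2)))"
    using integrable_norm[OF g(1)] by simp
  have "(LINT \<omega>::'a|lborel. complex_of_real (exp (- (a * (norm \<omega>)\<^sup>2)))) = of_real ((pi / a) powr (DIM('a) / 2))"
    using g(2) by simp
  then show "(LINT \<omega>::'a|lborel. exp (- (a * (norm \<omega>)\<^sup>2))) = (pi / a) powr (DIM('a) / 2)"
    unfolding integral_complex_of_real of_real_eq_iff .
qed

text \<open>The phase has modulus one, so |h y| |v \<omega>| is an integrable majorant on the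
  product. The formula moves the transform from \<open>h\<close> to \<open>v\<close>, where it can
  be computed if \<open>v\<close> is a damped plane wave.\<close>

lemma fourier_fubini:
  fixes h v :: "'a::euclidean_space \<Rightarrow> complex"
  assumes h: "integrable lborel h" and v: "integrable lborel v"
  shows "(LINT \<omega>|lborel. (LINT y|lborel. cis (- (y \<bullet> \<omega>)) * h y) * v \<omega>) =
    (LINT y|lborel. h y * (LINT \<omega>|lborel. cis (- (y \<bullet> \<omega>)) * v \<omega>))"
proof -
  have [measurable]: "h \<in> borel_measurable borel" "v \<in> borel_measurable borel"
    using h v by auto
  have meas: "(\<lambda>(y, \<omega>). cis (- (y \<bullet> \<omega>)) * h y * v \<omega>) \<in> borel_measurable (lborel \<Otimes>\<^sub>M lborel)"
    unfolding cis_conv_exp by measurable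
  have slice: "integrable lborel (\<lambda>\<omega>. cis (- (y \<bullet> \<omega>)) * h y * v \<omega>)" for y
    by (rule Bochner_Integration.integrable_bound[OF integrable_mult_right[OF v, of "h y"]])
      (auto simp: norm_mult cis_conv_exp)
  have int: "integrable (lborel \<Otimes>\<^sub>M lborel) (\<lambda>(y, \<omega>). cis (- (y \<bullet> \<omega>)) * h y * v \<omega>)"
  proof (rule lborel_pair.Fubini_integrable[OF meas])
    have "integrable lborel (\<lambda>y. cmod (h y) * (LINT \<omega>|lborel. cmod (v \<omega>)))"
      using h by (intro integrable_mult_left integrable_norm)
    then show "integrable lborel (\<lambda>y. LINT \<omega>|lborel. cmod (case (y, \<omega>) of (y, \<omega>) \<Rightarrow> cis (- (y \<bullet> \<omega>)) * h y * v \<omega>))"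
      by (simp add: norm_mult)
  qed (simp add: slice)
  have "(LINT \<omega>|lborel. (LINT y|lborel. cis (- (y \<bullet> \<omega>)) * h y) * v \<omega>) =
      (LINT \<omega>|lborel. LINT y|lborel. cis (- (y \<bullet> \<omega>)) * h y * v \<omega>)"
    by (simp only: integral_mult_left_zero)
  also have "\<dots> = (LINT y|lborel. LINT \<omega>|lborel. cis (- (y \<bullet> \<omega>)) * h y * v \<omega>)"
    by (rule lborel_pair.Fubini_integral[OF int])
  also have "\<dots> = (LINT y|lborel. LINT \<omega>|lborel. h y * (cis (- (y \<bullet> \<omega>)) * v \<omega>))"
    by (simp only: mult_ac)
  also have "\<dots> = (LINT y|lborel. h y * (LINT \<omega>|lborel. cis (- (y \<bullet> \<omega>)) * v \<omega>))"
    by (simp only: integral_mult_right_zero)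
  finally show ?thesis .
qed

lemma integrable_phase:
  fixes u :: "'a::euclidean_space \<Rightarrow> complex"
  assumes u: "integrable lborel u"
  shows "integrable lborel (\<lambda>y. cis (- (y \<bullet> \<omega>)) * u y)"
proof (rule Bochner_Integration.integrable_bound[OF u])
  have [measurable]: "u \<in> borel_measurable borel" using u by auto
  show "(\<lambda>y. cis (- (y \<bullet> \<omega>)) * u y) \<in> borel_measurable lborel" unfolding cis_conv_exp by measurable
qed (simp add: norm_mult)

text \<open>A nonintegrable function has integral 0 by convention, and the bound is then trivial.
  Estimates can thus be chained in the extended reals before integrability is known.\<close>

lemma norm_integral_le_nn_integral:
  fixes f :: "'a \<Rightarrow> 'b::{banach, second_countable_topology}"
  shows "ennreal (norm (integral\<^sup>L M f)) \<le> (\<integral>\<^sup>+x. ennreal (norm (f x)) \<partial>M)"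
  using integral_norm_bound_ennreal[of M f] by (cases "integrable M f") (auto simp: not_integrable_integral_eq)

lemma lborel_translate:
  fixes f :: "'a::euclidean_space \<Rightarrow> 'b::{banach, second_countable_topology}"
  assumes "f \<in> borel_measurable borel"
  shows "integrable lborel (\<lambda>y. f (c + y)) \<longleftrightarrow> integrable lborel f"
    and "(LINT y|lborel. f (c + y)) = (LINT y|lborel. f y)"
proof -
  have m: "(+) c \<in> lborel \<rightarrow>\<^sub>M borel" by measurable
  show "integrable lborel (\<lambda>y. f (c + y)) \<longleftrightarrow> integrable lborel f"
    using integrable_distr_eq[OF m assms] by (simp add: lborel_distr_plus)
  show "(LINT y|lborel. f (c + y)) = (LINT y|lborel. f y)"
    using integral_distr[OF m assms] by (simp add: lborel_distr_plus)
qed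

section \<open>Fourier transform of integrable functions, heat kernel and a Plancherel
  inequality\<close>

definition fourier_const :: "'n::finite itself \<Rightarrow> real" where
  "fourier_const _ = (2 * pi) powr (- real CARD('n) / 2)"

text \<open>Unlike \<open>fourier\<close>, which picks some L2 limit, this is an explicit function
  with a value at every point; it gives access to \<open>fourier\<close> up to null sets.\<close>

definition L1_fourier :: "(real ^ 'n \<Rightarrow> complex) \<Rightarrow> real ^ 'n \<Rightarrow> complex" where
  "L1_fourier h \<omega> = of_real (fourier_const TYPE('n)) * (LINT y|lborel. cis (- (y \<bullet> \<omega>)) * h y)"

text \<open>The Gaussian of total mass 1 whose width is chosen so that its frequency factor is
  exactly exp (-\<epsilon> |\<omega>|^2).\<close>

definition heat_kernel :: "real \<Rightarrow> real ^ 'n \<Rightarrow> real" where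
  "heat_kernel \<epsilon> z = (4 * pi * \<epsilon>) powr (- real CARD('n) / 2) * exp (- ((norm z)\<^sup>2 / (4 * \<epsilon>)))"

lemma heat_kernel_nonneg [simp]: "0 \<le> heat_kernel \<epsilon> z"
  by (simp add: heat_kernel_def)

lemma fourier_const_pos: "0 < fourier_const TYPE('n::finite)"
  by (simp add: fourier_const_def)

lemma heat_kernel_measurable [measurable]: "heat_kernel \<epsilon> \<in> borel_measurable borel"
  unfolding heat_kernel_def by measurable

lemma heat_kernel_minus_commute: "heat_kernel \<epsilon> (x - y) = heat_kernel \<epsilon> (y - x)"
  by (simp add: heat_kernel_def norm_minus_commute)

lemma heat_kernel_integral:
  fixes x :: "real ^ 'n"
  assumes "0 < \<epsilon>"
  shows "integrable lborel (\<lambda>y. heat_kernel \<epsilon> (x - y))"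
    and "(LINT y|lborel. heat_kernel \<epsilon> (x - y)) = 1"
proof -
  have eq: "heat_kernel \<epsilon> = (\<lambda>z::real^'n. (4 * pi * \<epsilon>) powr (- real CARD('n) / 2) * exp (- (1 / (4 * \<epsilon>) * (norm z)\<^sup>2)))"
    by (simp add: heat_kernel_def fun_eq_iff)
  have a: "0 < 1 / (4 * \<epsilon>)" using assms by simp
  have i: "integrable lborel (heat_kernel \<epsilon> :: real^'n \<Rightarrow> real)"
    unfolding eq by (intro integrable_mult_right gaussian_integral a)
  have "(LINT y|lborel. (heat_kernel \<epsilon> :: real^'n \<Rightarrow> real) y) = (4 * pi * \<epsilon>) powr (- real CARD('n) / 2) * (pi / (1 / (4 * \<epsilon>))) powr (DIM(real^'n) / 2)"
    unfolding eq integral_mult_right_zero gaussian_integral(2)[OF a] ..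
  also have "\<dots> = (4 * pi * \<epsilon>) powr (- real CARD('n) / 2 + real CARD('n) / 2)"
    using assms by (subst powr_add) (simp add: mult_ac)
  also have "\<dots> = 1" using assms by simp
  finally have v: "(LINT y|lborel. (heat_kernel \<epsilon> :: real^'n \<Rightarrow> real) y) = 1" .
  have c: "heat_kernel \<epsilon> (x - y) = heat_kernel \<epsilon> (- x + y)" for y
    by (subst heat_kernel_minus_commute) simp
  show "integrable lborel (\<lambda>y. heat_kernel \<epsilon> (x - y))"
    unfolding c using i by (subst lborel_translate) auto
  show "(LINT y|lborel. heat_kernel \<epsilon> (x - y)) = 1"
    unfolding c using v by (subst lborel_translate) auto
qed

text \<open>One factor \<open>fourier_const\<close> belongs to the transform and one to its inverse,
  hence the square.\<close>

lemma heat_kernel_fourier: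
  fixes z :: "real ^ 'n"
  assumes \<epsilon>: "0 < \<epsilon>"
  shows "of_real ((fourier_const TYPE('n))\<^sup>2) * (LINT \<omega>|lborel. cis (z \<bullet> \<omega>) * of_real (exp (- (\<epsilon> * (norm \<omega>)\<^sup>2)))) =
    complex_of_real (heat_kernel \<epsilon> z)"
proof -
  let ?n = "real CARD('n)"
  have "(fourier_const TYPE('n))\<^sup>2 = ((2 * pi)\<^sup>2) powr (- ?n / 2)"
    unfolding fourier_const_def power2_eq_square by (subst powr_mult) simp_all
  moreover have "(pi / \<epsilon>) powr (?n / 2) = (\<epsilon> / pi) powr (- ?n / 2)"
    using \<epsilon> by (simp add: powr_minus powr_divide)
  ultimately have "(fourier_const TYPE('n))\<^sup>2 * (pi / \<epsilon>) powr (?n / 2) = ((2 * pi)\<^sup>2 * (\<epsilon> / pi)) powr (- ?n / 2)"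
    using \<epsilon> by (simp only: powr_mult)
  also have "(2 * pi)\<^sup>2 * (\<epsilon> / pi) = 4 * pi * \<epsilon>" by (simp add: power2_eq_square)
  finally have "(fourier_const TYPE('n))\<^sup>2 * (pi / \<epsilon>) powr (?n / 2) * exp (- ((norm z)\<^sup>2 / (4 * \<epsilon>))) = heat_kernel \<epsilon> z"
    by (simp add: heat_kernel_def)
  then show ?thesis unfolding gaussian_fourier(2)[OF \<epsilon>]
    by (simp flip: of_real_mult add: mult.assoc del: of_real_power)
qed

lemma L1_fourier_measurable [measurable]:
  assumes [measurable]: "h \<in> borel_measurable borel"
  shows "L1_fourier h \<in> borel_measurable borel"
  unfolding L1_fourier_def cis_conv_exp by measurable

lemma norm_L1_fourier_le:
  fixes h :: "real ^ 'n \<Rightarrow> complex"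
  assumes h: "integrable lborel h"
  shows "cmod (L1_fourier h \<omega>) \<le> fourier_const TYPE('n) * (LINT y|lborel. cmod (h y))"
proof -
  have "cmod (LINT y|lborel. cis (- (y \<bullet> \<omega>)) * h y) \<le> (LINT y|lborel. cmod (cis (- (y \<bullet> \<omega>)) * h y))"
    by (rule integral_norm_bound)
  then show ?thesis using fourier_const_pos[where 'n='n]
    by (simp add: L1_fourier_def norm_mult)
qed

text \<open>By Fubini the frequency integral acts on a damped plane wave and yields a heat kernel:
  damping the transform amounts to smoothing \<open>h\<close>.\<close>

lemma L1_fourier_regularized:
  fixes h :: "real ^ 'n \<Rightarrow> complex"
  assumes h: "integrable lborel h" and \<epsilon>: "0 < \<epsilon>"
  shows "of_real (fourier_const TYPE('n)) * (LINT \<omega>|lborel. L1_fourier h \<omega> * (cis (x \<bullet> \<omega>) * of_real (exp (- (\<epsilon> * (norm \<omega>)\<^sup>2))))) =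
    (LINT y|lborel. h y * of_real (heat_kernel \<epsilon> (x - y)))"
proof -
  let ?c = "complex_of_real (fourier_const TYPE('n))"
  let ?v = "\<lambda>\<omega>. cis (x \<bullet> \<omega>) * complex_of_real (exp (- (\<epsilon> * (norm \<omega>)\<^sup>2)))"
  have "?c * (LINT \<omega>|lborel. L1_fourier h \<omega> * ?v \<omega>) =
      ?c\<^sup>2 * (LINT \<omega>|lborel. (LINT y|lborel. cis (- (y \<bullet> \<omega>)) * h y) * ?v \<omega>)"
    by (simp only: L1_fourier_def mult.assoc integral_mult_right_zero power2_eq_square)
  also have "\<dots> = ?c\<^sup>2 * (LINT y|lborel. h y * (LINT \<omega>|lborel. cis (- (y \<bullet> \<omega>)) * ?v \<omega>))"
    by (subst fourier_fubini[OF h gaussian_fourier(1)[OF \<epsilon>]]) simp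
  also have "\<dots> = (LINT y|lborel. h y * (?c\<^sup>2 * (LINT \<omega>|lborel. cis (- (y \<bullet> \<omega>)) * ?v \<omega>)))"
    by (subst integral_mult_right_zero[symmetric]) (simp only: mult.left_commute)
  also have "\<dots> = (LINT y|lborel. h y * of_real (heat_kernel \<epsilon> (x - y)))"
  proof -
    have "?c\<^sup>2 * (LINT \<omega>|lborel. cis (- (y \<bullet> \<omega>)) * ?v \<omega>) = of_real (heat_kernel \<epsilon> (x - y))" for y
    proof -
      have "cis (- (y \<bullet> \<omega>)) * ?v \<omega> = cis ((x - y) \<bullet> \<omega>) * of_real (exp (- (\<epsilon> * (norm \<omega>)\<^sup>2)))" for \<omega>
      proof -
        have "- (y \<bullet> \<omega>) + x \<bullet> \<omega> = (x - y) \<bullet> \<omega>" by (simp add: inner_diff_left)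
        then show ?thesis by (simp only: mult.assoc[symmetric] cis_mult)
      qed
      then show ?thesis using heat_kernel_fourier[OF \<epsilon>, of "x - y"] by (simp only: of_real_power)
    qed
    then show ?thesis by simp
  qed
  finally show ?thesis .
qed

lemma cnj_borel_measurable [measurable]: "cnj \<in> borel_measurable borel"
  by (intro borel_measurable_continuous_onI continuous_intros)

text \<open>With a Gaussian damping factor the left-hand side becomes a double integral of \<open>h y * cnj (h z)\<close> against the
  heat kernel, which is at most the right-hand side by the inequality between arithmetic and geometric mean;
  Fatou's lemma removes the damping.\<close>

lemma plancherel_le:
  fixes h :: "real ^ 'n \<Rightarrow> complex"
  assumes h: "integrable lborel h"
  shows "(\<integral>\<^sup>+\<omega>. ennreal ((cmod (L1_fourier h \<omega>))\<^sup>2) \<partial>lborel) \<le> (\<integral>\<^sup>+y. ennreal ((cmod (h y))\<^sup>2) \<partial>lborel)"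
proof -
  have [measurable]: "h \<in> borel_measurable borel" using h by auto
  let ?F = "L1_fourier h" and ?c = "fourier_const TYPE('n)"
  let ?E = "\<lambda>\<epsilon> \<omega>::real^'n. exp (- (\<epsilon> * (norm \<omega>)\<^sup>2))"
  have reg: "(\<integral>\<^sup>+\<omega>. ennreal ((cmod (?F \<omega>))\<^sup>2 * ?E \<epsilon> \<omega>) \<partial>lborel) \<le> (\<integral>\<^sup>+y. ennreal ((cmod (h y))\<^sup>2) \<partial>lborel)"
    if \<epsilon>: "0 < \<epsilon>" for \<epsilon>
  proof -
    \<comment> \<open>At this stage the transform is only known to be bounded; the Gaussian factor
      makes the following frequency integrals finite.\<close>
    define C where "C = ?c * (LINT y|lborel. cmod (h y))"
    have C: "cmod (?F \<omega>) \<le> C" for \<omega> unfolding C_def by (rule norm_L1_fourier_le[OF h])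
    have C0: "0 \<le> C" using C[of 0] norm_ge_zero order_trans by blast
    have gi: "integrable lborel (\<lambda>\<omega>. ?E \<epsilon> \<omega>)" by (rule gaussian_integral[OF \<epsilon>])
    have vi: "integrable lborel (\<lambda>\<omega>. cnj (?F \<omega>) * of_real (?E \<epsilon> \<omega>))"
      by (rule Bochner_Integration.integrable_bound[OF integrable_mult_right[OF gi, of C]])
        (measurable, use C C0 in \<open>auto simp: norm_mult mult_right_mono\<close>)
    have intsq: "integrable lborel (\<lambda>\<omega>. (cmod (?F \<omega>))\<^sup>2 * ?E \<epsilon> \<omega>)"
      by (rule Bochner_Integration.integrable_bound[OF integrable_mult_right[OF gi, of "C\<^sup>2"]])
        (measurable, use C in \<open>auto simp: norm_mult mult_right_mono power_mono\<close>)
    have "complex_of_real (LINT \<omega>|lborel. (cmod (?F \<omega>))\<^sup>2 * ?E \<epsilon> \<omega>) =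
        (LINT \<omega>|lborel. ?F \<omega> * (cnj (?F \<omega>) * of_real (?E \<epsilon> \<omega>)))"
      by (subst integral_complex_of_real[symmetric]) (simp add: complex_norm_square mult.assoc del: of_real_power)
    also have "\<dots> = of_real ?c * (LINT \<omega>|lborel. (LINT y|lborel. cis (- (y \<bullet> \<omega>)) * h y) * (cnj (?F \<omega>) * of_real (?E \<epsilon> \<omega>)))"
      by (subst (1) L1_fourier_def) (simp only: mult.assoc integral_mult_right_zero)
    also have "\<dots> = of_real ?c * (LINT y|lborel. h y * (LINT \<omega>|lborel. cis (- (y \<bullet> \<omega>)) * (cnj (?F \<omega>) * of_real (?E \<epsilon> \<omega>))))"
      by (subst fourier_fubini[OF h vi]) simp
    also have "\<dots> = (LINT y|lborel. h y * (of_real ?c * (LINT \<omega>|lborel. cis (- (y \<bullet> \<omega>)) * (cnj (?F \<omega>) * of_real (?E \<epsilon> \<omega>)))))"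
      by (subst integral_mult_right_zero[symmetric]) (simp only: mult.left_commute)
    also have "\<dots> = (LINT y|lborel. h y * cnj (LINT z|lborel. h z * of_real (heat_kernel \<epsilon> (y - z))))"
    proof -
      have "of_real ?c * (LINT \<omega>|lborel. cis (- (y \<bullet> \<omega>)) * (cnj (?F \<omega>) * of_real (?E \<epsilon> \<omega>))) =
          cnj (LINT z|lborel. h z * of_real (heat_kernel \<epsilon> (y - z)))" for y
        unfolding L1_fourier_regularized[OF h \<epsilon>, of y, symmetric]
        by (simp only: complex_cnj_mult complex_cnj_complex_of_real Bochner_Integration.integral_cnj[symmetric] cis_cnj)
          (simp only: mult_ac)
      then show ?thesis by simp
    qed
    finally have eq: "complex_of_real (LINT \<omega>|lborel. (cmod (?F \<omega>))\<^sup>2 * ?E \<epsilon> \<omega>) =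
      (LINT y|lborel. h y * cnj (LINT z|lborel. h z * of_real (heat_kernel \<epsilon> (y - z))))" .
    let ?k = "\<lambda>y z. ennreal (heat_kernel \<epsilon> (y - z))"
    have k1: "(\<integral>\<^sup>+z. ?k y z \<partial>lborel) = 1" for y :: "real^'n"
      using nn_integral_eq_integral[OF heat_kernel_integral(1)[OF \<epsilon>, of y]] heat_kernel_integral(2)[OF \<epsilon>, of y] by simp
    have k2: "(\<integral>\<^sup>+y. ?k y z \<partial>lborel) = 1" for z :: "real^'n"
      using k1[of z] by (subst heat_kernel_minus_commute)
    have "(\<integral>\<^sup>+\<omega>. ennreal ((cmod (?F \<omega>))\<^sup>2 * ?E \<epsilon> \<omega>) \<partial>lborel) = ennreal (LINT \<omega>|lborel. (cmod (?F \<omega>))\<^sup>2 * ?E \<epsilon> \<omega>)"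
      by (rule nn_integral_eq_integral[OF intsq]) auto
    also have "\<dots> \<le> ennreal (cmod (complex_of_real (LINT \<omega>|lborel. (cmod (?F \<omega>))\<^sup>2 * ?E \<epsilon> \<omega>)))"
      by (intro ennreal_leI) simp
    also have "\<dots> \<le> (\<integral>\<^sup>+y. ennreal (cmod (h y * cnj (LINT z|lborel. h z * of_real (heat_kernel \<epsilon> (y - z))))) \<partial>lborel)"
      unfolding eq by (rule norm_integral_le_nn_integral)
    also have "\<dots> \<le> (\<integral>\<^sup>+y. \<integral>\<^sup>+z. ennreal (((cmod (h y))\<^sup>2 / 2 + (cmod (h z))\<^sup>2 / 2) * heat_kernel \<epsilon> (y - z)) \<partial>lborel \<partial>lborel)"
    proof (intro nn_integral_mono)
      fix y :: "real^'n"
      have "ennreal (cmod (h y * cnj (LINT z|lborel. h z * of_real (heat_kernel \<epsilon> (y - z))))) =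
          ennreal (cmod (LINT z|lborel. h y * (h z * of_real (heat_kernel \<epsilon> (y - z)))))"
        by (simp only: integral_mult_right_zero norm_mult complex_mod_cnj)
      also have "\<dots> \<le> (\<integral>\<^sup>+z. ennreal (cmod (h y * (h z * of_real (heat_kernel \<epsilon> (y - z))))) \<partial>lborel)"
        by (rule norm_integral_le_nn_integral)
      also have "\<dots> \<le> (\<integral>\<^sup>+z. ennreal (((cmod (h y))\<^sup>2 / 2 + (cmod (h z))\<^sup>2 / 2) * heat_kernel \<epsilon> (y - z)) \<partial>lborel)"
      proof (intro nn_integral_mono ennreal_leI)
        fix z :: "real^'n"
        have "cmod (h y) * cmod (h z) \<le> (cmod (h y))\<^sup>2 / 2 + (cmod (h z))\<^sup>2 / 2"
          using sum_squares_bound[of "cmod (h y)" "cmod (h z)"] by simp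
        then show "cmod (h y * (h z * of_real (heat_kernel \<epsilon> (y - z)))) \<le> ((cmod (h y))\<^sup>2 / 2 + (cmod (h z))\<^sup>2 / 2) * heat_kernel \<epsilon> (y - z)"
          by (simp add: norm_mult mult_right_mono flip: mult.assoc)
      qed
      finally show "ennreal (cmod (h y * cnj (LINT z|lborel. h z * of_real (heat_kernel \<epsilon> (y - z))))) \<le>
        (\<integral>\<^sup>+z. ennreal (((cmod (h y))\<^sup>2 / 2 + (cmod (h z))\<^sup>2 / 2) * heat_kernel \<epsilon> (y - z)) \<partial>lborel)" .
    qed
    also have "\<dots> = (\<integral>\<^sup>+y. \<integral>\<^sup>+z. ennreal ((cmod (h y))\<^sup>2 / 2) * ?k y z + ennreal ((cmod (h z))\<^sup>2 / 2) * ?k y z \<partial>lborel \<partial>lborel)"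
      by (simp only: distrib_right) (simp add: ennreal_mult[symmetric])
    also have "\<dots> = (\<integral>\<^sup>+y. (\<integral>\<^sup>+z. ennreal ((cmod (h y))\<^sup>2 / 2) * ?k y z \<partial>lborel) + (\<integral>\<^sup>+z. ennreal ((cmod (h z))\<^sup>2 / 2) * ?k y z \<partial>lborel) \<partial>lborel)"
      by (intro nn_integral_cong nn_integral_add) measurable
    also have "\<dots> = (\<integral>\<^sup>+y. (\<integral>\<^sup>+z. ennreal ((cmod (h y))\<^sup>2 / 2) * ?k y z \<partial>lborel) \<partial>lborel) + (\<integral>\<^sup>+y. (\<integral>\<^sup>+z. ennreal ((cmod (h z))\<^sup>2 / 2) * ?k y z \<partial>lborel) \<partial>lborel)"
      by (intro nn_integral_add) measurable
    also have "(\<integral>\<^sup>+y. (\<integral>\<^sup>+z. ennreal ((cmod (h y))\<^sup>2 / 2) * ?k y z \<partial>lborel) \<partial>lborel) = (\<integral>\<^sup>+y. ennreal ((cmod (h y))\<^sup>2 / 2) \<partial>lborel)"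
      by (simp add: nn_integral_cmult k1)
    also have "(\<integral>\<^sup>+y. (\<integral>\<^sup>+z. ennreal ((cmod (h z))\<^sup>2 / 2) * ?k y z \<partial>lborel) \<partial>lborel) =
        (\<integral>\<^sup>+z. (\<integral>\<^sup>+y. ennreal ((cmod (h z))\<^sup>2 / 2) * ?k y z \<partial>lborel) \<partial>lborel)"
      by (rule lborel_pair.Fubini') measurable
    also have "\<dots> = (\<integral>\<^sup>+y. ennreal ((cmod (h y))\<^sup>2 / 2) \<partial>lborel)"
      by (simp add: nn_integral_cmult k2)
    also have "(\<integral>\<^sup>+y. ennreal ((cmod (h y))\<^sup>2 / 2) \<partial>lborel) + (\<integral>\<^sup>+y. ennreal ((cmod (h y))\<^sup>2 / 2) \<partial>lborel) = (\<integral>\<^sup>+y. ennreal ((cmod (h y))\<^sup>2) \<partial>lborel)"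
      by (subst nn_integral_add[symmetric]) (auto simp flip: ennreal_plus)
    finally show ?thesis .
  qed
  let ?e = "\<lambda>i::nat. inverse (real (Suc i))"
  have lim: "(\<lambda>i. ennreal ((cmod (?F \<omega>))\<^sup>2 * ?E (?e i) \<omega>)) \<longlonglongrightarrow> ennreal ((cmod (?F \<omega>))\<^sup>2)" for \<omega>
  proof (rule tendsto_ennrealI)
    have "(\<lambda>i. (cmod (?F \<omega>))\<^sup>2 * ?E (?e i) \<omega>) \<longlonglongrightarrow> (cmod (?F \<omega>))\<^sup>2 * exp (- (0 * (norm \<omega>)\<^sup>2))"
      by (intro tendsto_intros LIMSEQ_inverse_real_of_nat)
    then show "(\<lambda>i. (cmod (?F \<omega>))\<^sup>2 * ?E (?e i) \<omega>) \<longlonglongrightarrow> (cmod (?F \<omega>))\<^sup>2" by simp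
  qed
  have "(\<integral>\<^sup>+\<omega>. ennreal ((cmod (?F \<omega>))\<^sup>2) \<partial>lborel) = (\<integral>\<^sup>+\<omega>. liminf (\<lambda>i. ennreal ((cmod (?F \<omega>))\<^sup>2 * ?E (?e i) \<omega>)) \<partial>lborel)"
    by (intro nn_integral_cong lim_imp_Liminf[symmetric] lim) simp
  also have "\<dots> \<le> liminf (\<lambda>i. \<integral>\<^sup>+\<omega>. ennreal ((cmod (?F \<omega>))\<^sup>2 * ?E (?e i) \<omega>) \<partial>lborel)"
    by (intro nn_integral_liminf) measurable
  also have "\<dots> \<le> (\<integral>\<^sup>+y. ennreal ((cmod (h y))\<^sup>2) \<partial>lborel)"
    by (rule Liminf_le) (auto intro!: reg always_eventually)
  finally show ?thesis .
qed

section \<open>Fourier inversion\<close>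

lemma truncated_fourier_eq: "truncated_fourier R f = L1_fourier (\<lambda>x. indicat_real (cball 0 R) x *\<^sub>R f x)"
  by (simp add: fun_eq_iff truncated_fourier_def L1_fourier_def fourier_const_def set_lebesgue_integral_def)

lemma cball_pred_borel [measurable]: "Measurable.pred borel (\<lambda>x::'a::euclidean_space. x \<in> cball a R)"
  by (simp add: pred_def)

lemma truncated_fourier_measurable [measurable]:
  assumes [measurable]: "f \<in> borel_measurable borel"
  shows "truncated_fourier R f \<in> borel_measurable borel"
  unfolding truncated_fourier_eq by measurable

text \<open>Converts square integrability into integrability against a finite measure such as
  Lebesgue measure on a ball or the heat kernel.\<close>

lemma norm_le_norm_sq_plus_1: "norm z \<le> (norm z)\<^sup>2 + 1"
  using sum_squares_bound[of "norm z" 1] norm_ge_zero[of z] by (simp only: power_one mult_1_right)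

lemma integrable_truncation:
  fixes f :: "'a::euclidean_space \<Rightarrow> complex"
  assumes [measurable]: "f \<in> borel_measurable borel" and f2: "integrable lborel (\<lambda>x. (cmod (f x))\<^sup>2)"
  shows "integrable lborel (\<lambda>x. indicat_real (cball 0 R) x *\<^sub>R f x)"
proof (rule Bochner_Integration.integrable_bound)
  show "integrable lborel (\<lambda>x. indicat_real (cball 0 R) x + (cmod (f x))\<^sup>2)"
    by (intro Bochner_Integration.integrable_add f2 integrable_real_indicator) (use emeasure_bounded_finite[of "cball 0 R"] in \<open>auto simp: infinity_ennreal_def\<close>)
  show "AE x in lborel. cmod (indicat_real (cball 0 R) x *\<^sub>R f x) \<le> norm (indicat_real (cball 0 R) x + (cmod (f x))\<^sup>2)"
  proof (rule AE_I2)
    fix x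
    show "cmod (indicat_real (cball 0 R) x *\<^sub>R f x) \<le> norm (indicat_real (cball 0 R) x + (cmod (f x))\<^sup>2)"
      using norm_le_norm_sq_plus_1[of "f x"] by (auto simp: indicator_def)
  qed
qed measurable

lemma heat_kernel_integrable_mult:
  fixes f :: "real ^ 'n \<Rightarrow> complex"
  assumes [measurable]: "f \<in> borel_measurable borel" and f2: "integrable lborel (\<lambda>x. (cmod (f x))\<^sup>2)"
    and \<epsilon>: "0 < \<epsilon>"
  shows "integrable lborel (\<lambda>y. cmod (f y) * heat_kernel \<epsilon> (x - y))"
proof (rule Bochner_Integration.integrable_bound)
  let ?K = "(4 * pi * \<epsilon>) powr (- real CARD('n) / 2)"
  show "integrable lborel (\<lambda>y. ?K * (cmod (f y))\<^sup>2 + heat_kernel \<epsilon> (x - y))"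
    by (intro Bochner_Integration.integrable_add integrable_mult_right f2 heat_kernel_integral \<epsilon>)
  show "AE y in lborel. norm (cmod (f y) * heat_kernel \<epsilon> (x - y)) \<le> norm (?K * (cmod (f y))\<^sup>2 + heat_kernel \<epsilon> (x - y))"
  proof (rule AE_I2)
    fix y
    have "cmod (f y) * heat_kernel \<epsilon> (x - y) \<le> (cmod (f y))\<^sup>2 * heat_kernel \<epsilon> (x - y) + heat_kernel \<epsilon> (x - y)"
      using mult_right_mono[OF norm_le_norm_sq_plus_1[of "f y"], of "heat_kernel \<epsilon> (x - y)"]
      by (simp add: distrib_right)
    also have "(cmod (f y))\<^sup>2 * heat_kernel \<epsilon> (x - y) \<le> (cmod (f y))\<^sup>2 * ?K"
      using \<epsilon> by (intro mult_left_mono) (auto simp: heat_kernel_def mult_left_le)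
    finally show "norm (cmod (f y) * heat_kernel \<epsilon> (x - y)) \<le> norm (?K * (cmod (f y))\<^sup>2 + heat_kernel \<epsilon> (x - y))"
      by (simp add: mult.commute abs_mult)
  qed
qed measurable

text \<open>A square integrable \<open>f\<close> may be unbounded, so the part far from
  \<open>x\<close> cannot be estimated by a supremum; it is controlled by the square integral of
  \<open>f\<close> times a factor that vanishes with \<epsilon>.\<close>

lemma heat_kernel_approx_identity:
  fixes f :: "real ^ 'n \<Rightarrow> complex"
  assumes m [measurable]: "f \<in> borel_measurable borel" and f2: "integrable lborel (\<lambda>x. (cmod (f x))\<^sup>2)"
    and cont: "isCont f x"
  shows "(\<lambda>i. LINT y|lborel. f y * of_real (heat_kernel (inverse (real (Suc i))) (x - y))) \<longlonglongrightarrow> f x"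
proof (rule LIMSEQ_I)
  fix e :: real assume e: "0 < e"
  let ?e = "\<lambda>i. inverse (real (Suc i))" and ?G = "\<lambda>y. exp (- (1/8 * (norm (x - y))\<^sup>2))"
  obtain \<eta> where \<eta>: "0 < \<eta>" "\<And>y. dist y x < \<eta> \<Longrightarrow> dist (f y) (f x) < e / 2"
    using cont e unfolding continuous_at_eps_delta by (meson half_gt_zero)
  have G: "integrable lborel ?G"
  proof -
    have "?G = (\<lambda>y. exp (- (1/8 * (norm (- x + y))\<^sup>2)))"
      by (simp add: norm_minus_commute[of x])
    then show ?thesis
      using lborel_translate(1)[of "\<lambda>y::real^'n. exp (- (1/8 * (norm y)\<^sup>2))" "- x"] gaussian_integral(1)[of "1/8"] by simp
  qed
  \<comment> \<open>Away from \<open>x\<close> the exponent |x - y|^2 / (4 \<epsilon>) is split into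
    equal halves. One half gives the vanishing factor \<open>B i\<close>; the other is at least the
    exponent of the fixed Gaussian \<open>?G\<close>, which keeps the constant part of the integrand
    integrable.\<close>
  define B where "B i = (4 * pi * ?e i) powr (- real CARD('n) / 2) * exp (- (\<eta>\<^sup>2 / (8 * ?e i)))" for i
  define M where "M = (LINT y|lborel. (cmod (f y))\<^sup>2 + (1 + cmod (f x)) * ?G y)"
  have "(\<lambda>i. B i * M) \<longlonglongrightarrow> 0 * M"
    unfolding B_def using \<eta>(1) by (intro tendsto_mult_right) real_asymp
  then have "eventually (\<lambda>i. B i * M < e / 2) sequentially"
    using e by (intro order_tendstoD(2)) auto
  then obtain i0 where i0: "\<And>i. i \<ge> i0 \<Longrightarrow> B i * M < e / 2" by (auto simp: eventually_sequentially)
  show "\<exists>no. \<forall>i\<ge>no. norm ((LINT y|lborel. f y * of_real (heat_kernel (?e i) (x - y))) - f x) < e"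
  proof (intro exI allI impI)
    fix i assume i: "i0 \<le> i"
    have \<epsilon>: "0 < ?e i" "?e i \<le> 1" by (auto simp: field_simps)
    let ?k = "\<lambda>y. heat_kernel (?e i) (x - y)"
    have kint: "integrable lborel ?k" "(LINT y|lborel. ?k y) = 1" by (intro heat_kernel_integral \<epsilon>)+
    have fk: "integrable lborel (\<lambda>y. f y * of_real (?k y))"
      by (rule Bochner_Integration.integrable_bound[OF heat_kernel_integrable_mult[OF m f2 \<epsilon>(1)]])
        (auto simp: norm_mult)
    have fxk: "integrable lborel (\<lambda>y. f x * of_real (?k y))"
      using kint by (intro integrable_mult_right integrable_of_real)
    have "f x = (LINT y|lborel. f x * of_real (?k y))"
      using kint(2) by (simp only: integral_mult_right_zero integral_complex_of_real) simp
    then have "(LINT y|lborel. f y * of_real (?k y)) - f x = (LINT y|lborel. f y * of_real (?k y) - f x * of_real (?k y))"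
      using Bochner_Integration.integral_diff[OF fk fxk] by simp
    then have "norm ((LINT y|lborel. f y * of_real (?k y)) - f x) \<le> (LINT y|lborel. cmod (f y * of_real (?k y) - f x * of_real (?k y)))"
      by (simp only: integral_norm_bound)
    also have "\<dots> \<le> (LINT y|lborel. e / 2 * ?k y + B i * ((cmod (f y))\<^sup>2 + (1 + cmod (f x)) * ?G y))"
    proof (rule integral_mono)
      show "integrable lborel (\<lambda>y. cmod (f y * of_real (?k y) - f x * of_real (?k y)))"
        by (intro integrable_norm Bochner_Integration.integrable_diff fk fxk)
      show "integrable lborel (\<lambda>y. e / 2 * ?k y + B i * ((cmod (f y))\<^sup>2 + (1 + cmod (f x)) * ?G y))"
        by (intro Bochner_Integration.integrable_add integrable_mult_right kint f2 G)
      fix y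
      have eq: "cmod (f y * of_real (?k y) - f x * of_real (?k y)) = cmod (f y - f x) * ?k y"
        by (simp add: norm_mult flip: left_diff_distrib)
      have B0: "0 \<le> B i" by (simp add: B_def)
      show "cmod (f y * of_real (?k y) - f x * of_real (?k y)) \<le> e / 2 * ?k y + B i * ((cmod (f y))\<^sup>2 + (1 + cmod (f x)) * ?G y)"
      proof (cases "dist y x < \<eta>")
        case True
        have "cmod (f y - f x) * ?k y \<le> e / 2 * ?k y"
          using \<eta>(2)[OF True] by (intro mult_right_mono) (auto simp: dist_norm)
        moreover have "0 \<le> B i * ((cmod (f y))\<^sup>2 + (1 + cmod (f x)) * ?G y)" using B0 by simp
        ultimately show ?thesis unfolding eq by linarith
      next
        case False
        then have "\<eta> \<le> norm (x - y)" by (simp add: dist_norm norm_minus_commute)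
        then have "\<eta>\<^sup>2 \<le> (norm (x - y))\<^sup>2" using \<eta>(1) by (intro power_mono) auto
        then have "\<eta>\<^sup>2 / (8 * ?e i) \<le> (norm (x - y))\<^sup>2 / (8 * ?e i)" using \<epsilon> by (intro divide_right_mono) auto
        moreover have "1/8 * (norm (x - y))\<^sup>2 \<le> (norm (x - y))\<^sup>2 / (8 * ?e i)"
          using mult_left_mono[of 1 "real (Suc i)" "(norm (x - y))\<^sup>2"] by (simp add: field_simps)
        moreover have "(norm (x - y))\<^sup>2 / (4 * ?e i) = (norm (x - y))\<^sup>2 / (8 * ?e i) + (norm (x - y))\<^sup>2 / (8 * ?e i)"
          by (simp add: field_simps)
        ultimately have "exp (- ((norm (x - y))\<^sup>2 / (4 * ?e i))) \<le> exp (- (\<eta>\<^sup>2 / (8 * ?e i)) + - (1/8 * (norm (x - y))\<^sup>2))"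
          by simp
        then have k: "?k y \<le> B i * ?G y"
          unfolding heat_kernel_def B_def exp_add by (simp add: mult.assoc mult_left_mono)
        have "cmod (f y - f x) \<le> (cmod (f y))\<^sup>2 + (1 + cmod (f x))"
          using norm_triangle_ineq4[of "f y" "f x"] norm_le_norm_sq_plus_1[of "f y"] by linarith
        then have "cmod (f y - f x) * ?k y \<le> ((cmod (f y))\<^sup>2 + (1 + cmod (f x))) * (B i * ?G y)"
          using k by (intro mult_mono) auto
        also have "\<dots> = B i * ((cmod (f y))\<^sup>2 * ?G y + (1 + cmod (f x)) * ?G y)" by (simp add: algebra_simps)
        also have "\<dots> \<le> B i * ((cmod (f y))\<^sup>2 + (1 + cmod (f x)) * ?G y)"
          using B0 by (intro mult_left_mono add_right_mono mult_right_le_one_le) auto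
        finally show ?thesis unfolding eq using e by (simp add: add_increasing)
      qed
    qed
    also have "\<dots> = e / 2 * 1 + B i * M"
    proof -
      have 1: "integrable lborel (\<lambda>y. e / 2 * ?k y)" using kint by (intro integrable_mult_right)
      have 2: "integrable lborel (\<lambda>y. B i * ((cmod (f y))\<^sup>2 + (1 + cmod (f x)) * ?G y))"
        by (intro Bochner_Integration.integrable_add integrable_mult_right f2 G)
      show ?thesis unfolding Bochner_Integration.integral_add[OF 1 2] integral_mult_right_zero kint(2) M_def ..
    qed
    also have "\<dots> < e" using i0[OF i] by simp
    finally show "norm ((LINT y|lborel. f y * of_real (?k y)) - f x) < e" .
  qed
qed

text \<open>The Gaussian factor is square integrable, so the damped integral is continuous in \<open>g\<close> for the \<open>L\<^sub>2\<close> distance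
  and it suffices to compute it for the truncations of \<open>f\<close>; the Plancherel identity is not needed.\<close>

lemma regularized_inversion:
  fixes f g :: "real ^ 'n \<Rightarrow> complex"
  assumes m [measurable]: "f \<in> borel_measurable borel" and f2: "integrable lborel (\<lambda>x. (cmod (f x))\<^sup>2)"
    and F: "is_fourier f g" and g: "integrable lborel g" and \<epsilon>: "0 < \<epsilon>"
  shows "of_real (fourier_const TYPE('n)) * (LINT \<omega>|lborel. g \<omega> * (cis (x \<bullet> \<omega>) * of_real (exp (- (\<epsilon> * (norm \<omega>)\<^sup>2))))) =
    (LINT y|lborel. f y * of_real (heat_kernel \<epsilon> (x - y)))" (is "?c * ?I = ?J")
proof -
  let ?fR = "\<lambda>R x. indicat_real (cball 0 R) x *\<^sub>R f x"
  let ?E = "\<lambda>\<omega>::real^'n. exp (- (\<epsilon> * (norm \<omega>)\<^sup>2))"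
  let ?v = "\<lambda>\<omega>. cis (x \<bullet> \<omega>) * complex_of_real (?E \<omega>)"
  let ?D = "\<lambda>R. \<integral>\<^sup>+ \<omega>. ennreal ((cmod (g \<omega> - truncated_fourier R f \<omega>))\<^sup>2) \<partial>lborel"
  define a where "a R = (LINT \<omega>|lborel. truncated_fourier R f \<omega> * ?v \<omega>)" for R
  have [measurable]: "g \<in> borel_measurable borel" using g by auto
  have vm [measurable]: "?v \<in> borel_measurable borel" unfolding cis_conv_exp by measurable
  have D: "(?D \<longlongrightarrow> 0) at_top" using F by (simp add: is_fourier_def)
  have gi: "integrable lborel ?E" by (rule gaussian_integral[OF \<epsilon>])
  have aJ: "?c * a R = (LINT y|lborel. ?fR R y * of_real (heat_kernel \<epsilon> (x - y)))" for R
    unfolding a_def truncated_fourier_eq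
    by (rule L1_fourier_regularized[OF integrable_truncation[OF m f2] \<epsilon>])
  have "((\<lambda>R. LINT y|lborel. ?fR R y * of_real (heat_kernel \<epsilon> (x - y))) \<longlongrightarrow> ?J) at_top"
  proof (rule integral_dominated_convergence_at_top[OF _ _ heat_kernel_integrable_mult[OF m f2 \<epsilon>, of x]])
    show "AE y in lborel. ((\<lambda>R. ?fR R y * of_real (heat_kernel \<epsilon> (x - y))) \<longlongrightarrow> f y * of_real (heat_kernel \<epsilon> (x - y))) at_top"
    proof (rule AE_I2)
      fix y :: "real^'n"
      have "eventually (\<lambda>R. f y * of_real (heat_kernel \<epsilon> (x - y)) = ?fR R y * of_real (heat_kernel \<epsilon> (x - y))) at_top"
        using eventually_ge_at_top[of "norm y"] by eventually_elim simp
      then show "((\<lambda>R. ?fR R y * of_real (heat_kernel \<epsilon> (x - y))) \<longlongrightarrow> f y * of_real (heat_kernel \<epsilon> (x - y))) at_top"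
        by (rule Lim_transform_eventually[OF tendsto_const])
    qed
    show "\<forall>\<^sub>F R in at_top. AE y in lborel. norm (?fR R y * of_real (heat_kernel \<epsilon> (x - y))) \<le> cmod (f y) * heat_kernel \<epsilon> (x - y)"
      by (intro always_eventually allI AE_I2) (auto simp: norm_mult indicator_def)
  qed measurable
  then have lim1: "((\<lambda>R. ?c * a R) \<longlongrightarrow> ?J) at_top" unfolding aJ .
  have gv: "integrable lborel (\<lambda>\<omega>. g \<omega> * ?v \<omega>)"
    by (rule Bochner_Integration.integrable_bound[OF g], measurable)
      (use \<epsilon> in \<open>auto simp: norm_mult mult_left_le\<close>)
  have Tv: "integrable lborel (\<lambda>\<omega>. truncated_fourier R f \<omega> * ?v \<omega>)" for R
  proof (rule Bochner_Integration.integrable_bound[OF integrable_mult_right[OF gi]])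
    show "AE \<omega> in lborel. norm (truncated_fourier R f \<omega> * ?v \<omega>) \<le> norm (fourier_const TYPE('n) * (LINT y|lborel. cmod (?fR R y)) * ?E \<omega>)"
    proof (rule AE_I2)
      fix \<omega>
      define C where "C = fourier_const TYPE('n) * (LINT y|lborel. cmod (?fR R y))"
      have "cmod (truncated_fourier R f \<omega>) \<le> C"
        unfolding truncated_fourier_eq C_def by (rule norm_L1_fourier_le[OF integrable_truncation[OF m f2]])
      then have "cmod (truncated_fourier R f \<omega>) * ?E \<omega> \<le> \<bar>C\<bar> * ?E \<omega>" by (intro mult_right_mono) auto
      then show "norm (truncated_fourier R f \<omega> * ?v \<omega>) \<le> norm (fourier_const TYPE('n) * (LINT y|lborel. cmod (?fR R y)) * ?E \<omega>)"
        unfolding C_def[symmetric] by (simp add: norm_mult abs_mult)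
    qed
  qed measurable
  have "((\<lambda>R. (cmod (a R - ?I))\<^sup>2) \<longlongrightarrow> 0) at_top"
  proof -
    \<comment> \<open>The squared L2 norm of the damping factor, which is the constant in the
      Cauchy-Schwarz estimate; it is finite because doubling the exponent leaves a Gaussian.\<close>
    define K where "K = (\<integral>\<^sup>+\<omega>. ennreal (?E \<omega>)^2 \<partial>(lborel :: (real^'n) measure))"
    have "K = (\<integral>\<^sup>+\<omega>. ennreal (exp (- (2 * \<epsilon> * (norm \<omega>)\<^sup>2))) \<partial>(lborel :: (real^'n) measure))"
      unfolding K_def by (intro nn_integral_cong) (simp add: ennreal_power flip: exp_double)
    also have "\<dots> < \<infinity>"
      using gaussian_integral(1)[of "2 * \<epsilon>", where 'a="real^'n"] \<epsilon> by (simp add: integrable_iff_bounded)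
    finally have K: "K \<noteq> \<infinity>" by simp
    have bound: "ennreal ((cmod (a R - ?I))\<^sup>2) \<le> ?D R * K" for R
    proof -
      have "a R - ?I = (LINT \<omega>|lborel. truncated_fourier R f \<omega> * ?v \<omega> - g \<omega> * ?v \<omega>)"
        unfolding a_def by (rule Bochner_Integration.integral_diff[OF Tv gv, symmetric])
      then have "ennreal (cmod (a R - ?I)) \<le> (\<integral>\<^sup>+\<omega>. ennreal (cmod (truncated_fourier R f \<omega> * ?v \<omega> - g \<omega> * ?v \<omega>)) \<partial>lborel)"
        by (simp only: norm_integral_le_nn_integral)
      also have "\<dots> = (\<integral>\<^sup>+\<omega>. ennreal (cmod (g \<omega> - truncated_fourier R f \<omega>)) * ennreal (?E \<omega>) \<partial>lborel)"
        by (intro nn_integral_cong) (simp add: norm_mult norm_minus_commute ennreal_mult flip: left_diff_distrib)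
      finally have "(ennreal (cmod (a R - ?I)))\<^sup>2 \<le> (\<integral>\<^sup>+\<omega>. ennreal (cmod (g \<omega> - truncated_fourier R f \<omega>)) * ennreal (?E \<omega>) \<partial>lborel)\<^sup>2"
        by (intro power_mono) auto
      also have "\<dots> \<le> (\<integral>\<^sup>+\<omega>. (ennreal (cmod (g \<omega> - truncated_fourier R f \<omega>)))\<^sup>2 \<partial>lborel) * K"
        unfolding K_def by (rule Cauchy_Schwarz_nn_integral) measurable
      finally show ?thesis by (simp add: ennreal_power)
    qed
    have "((\<lambda>R. K * ?D R) \<longlongrightarrow> K * 0) at_top"
      using K by (intro ennreal_tendsto_cmult D) (simp add: less_top)
    then have lim: "((\<lambda>R. K * ?D R) \<longlongrightarrow> ennreal 0) at_top" by simp
    have "((\<lambda>R. ennreal ((cmod (a R - ?I))\<^sup>2)) \<longlongrightarrow> ennreal 0) at_top"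
      by (intro tendsto_sandwich[OF _ _ tendsto_const lim]) (auto intro!: always_eventually simp: mult.commute[of K] bound)
    then show ?thesis by (subst (asm) tendsto_ennreal_iff) auto
  qed
  then have "((\<lambda>R. cmod (a R - ?I)) \<longlongrightarrow> sqrt 0) at_top"
    using tendsto_real_sqrt by fastforce
  then have "(a \<longlongrightarrow> ?I) at_top" by (simp add: tendsto_norm_zero_iff Lim_null[symmetric])
  then have "((\<lambda>R. ?c * a R) \<longlongrightarrow> ?c * ?I) at_top" by (rule tendsto_mult_left)
  from tendsto_unique[OF _ this lim1] show ?thesis by simp
qed

text \<open>The damping is removed on both sides at once: the smoothed \<open>f\<close> converges to
  \<open>f x\<close> by continuity, and the frequency integral converges by domination with
  \<open>cmod (g \<omega>)\<close>.\<close>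

lemma fourier_inversion:
  fixes f g :: "real ^ 'n \<Rightarrow> complex"
  assumes cont: "continuous_on UNIV f" and f2: "integrable lborel (\<lambda>x. (cmod (f x))\<^sup>2)"
    and F: "is_fourier f g" and g: "integrable lborel g"
  shows "f x = of_real (fourier_const TYPE('n)) * (LINT \<omega>|lborel. g \<omega> * cis (x \<bullet> \<omega>))"
proof -
  have m: "f \<in> borel_measurable borel" using cont by (rule borel_measurable_continuous_onI)
  have [measurable]: "g \<in> borel_measurable borel" using g by auto
  let ?e = "\<lambda>i. inverse (real (Suc i))"
  let ?v = "\<lambda>\<epsilon> \<omega>. cis (x \<bullet> \<omega>) * complex_of_real (exp (- (\<epsilon> * (norm \<omega>)\<^sup>2)))"
  have "isCont f x" using cont by (simp add: continuous_on_eq_continuous_at)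
  from heat_kernel_approx_identity[OF m f2 this]
  have "(\<lambda>i. of_real (fourier_const TYPE('n)) * (LINT \<omega>|lborel. g \<omega> * ?v (?e i) \<omega>)) \<longlonglongrightarrow> f x"
    by (subst regularized_inversion[OF m f2 F g]) simp_all
  moreover have "(\<lambda>i. LINT \<omega>|lborel. g \<omega> * ?v (?e i) \<omega>) \<longlonglongrightarrow> (LINT \<omega>|lborel. g \<omega> * cis (x \<bullet> \<omega>))"
  proof (rule integral_dominated_convergence[where w="\<lambda>\<omega>. cmod (g \<omega>)"])
    show "AE \<omega> in lborel. (\<lambda>i. g \<omega> * ?v (?e i) \<omega>) \<longlonglongrightarrow> g \<omega> * cis (x \<bullet> \<omega>)"
    proof (rule AE_I2)
      fix \<omega>
      have "(\<lambda>i. g \<omega> * ?v (?e i) \<omega>) \<longlonglongrightarrow> g \<omega> * ?v 0 \<omega>"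
        by (intro tendsto_intros LIMSEQ_inverse_real_of_nat)
      then show "(\<lambda>i. g \<omega> * ?v (?e i) \<omega>) \<longlonglongrightarrow> g \<omega> * cis (x \<bullet> \<omega>)" by simp
    qed
  qed (use g in \<open>auto simp: norm_mult mult_left_le cis_conv_exp\<close>)
  then have "(\<lambda>i. of_real (fourier_const TYPE('n)) * (LINT \<omega>|lborel. g \<omega> * ?v (?e i) \<omega>)) \<longlonglongrightarrow>
      of_real (fourier_const TYPE('n)) * (LINT \<omega>|lborel. g \<omega> * cis (x \<bullet> \<omega>))"
    by (rule tendsto_mult_left)
  ultimately show ?thesis by (rule LIMSEQ_unique)
qed

text \<open>The error of a truncation is the transform of the tail of \<open>h\<close>. By
  \<open>plancherel_le\<close> its L2 norm is at most that of the tail itself, which tends to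
  0.\<close>

lemma is_fourier_L1_fourier:
  fixes h :: "real ^ 'n \<Rightarrow> complex"
  assumes h: "integrable lborel h" and h2: "integrable lborel (\<lambda>x. (cmod (h x))\<^sup>2)"
  shows "is_fourier h (L1_fourier h)"
  unfolding is_fourier_def
proof
  have [measurable]: "h \<in> borel_measurable borel" using h by auto
  show "square_integrable (L1_fourier h)"
    unfolding square_integrable_def
  proof
    have "(\<integral>\<^sup>+x. ennreal ((cmod (L1_fourier h x))\<^sup>2) \<partial>lborel) < \<infinity>"
      using plancherel_le[OF h] h2 by (auto simp: integrable_iff_bounded intro: le_less_trans)
    then show "integrable lborel (\<lambda>x. (cmod (L1_fourier h x))\<^sup>2)"
      by (intro integrableI_bounded) auto
  qed simp
  let ?hR = "\<lambda>R x. indicat_real (cball 0 R) x *\<^sub>R h x" and ?tR = "\<lambda>R x. indicat_real (- cball 0 R) x *\<^sub>R h x"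
  have hR: "integrable lborel (?hR R)" and tR: "integrable lborel (?tR R)" for R
    using h by (auto intro!: integrable_mult_indicator)
  have diff: "L1_fourier h \<omega> - truncated_fourier R h \<omega> = L1_fourier (?tR R) \<omega>" for R \<omega>
  proof -
    have "(LINT y|lborel. cis (- (y \<bullet> \<omega>)) * h y) - (LINT y|lborel. cis (- (y \<bullet> \<omega>)) * ?hR R y) =
        (LINT y|lborel. cis (- (y \<bullet> \<omega>)) * h y - cis (- (y \<bullet> \<omega>)) * ?hR R y)"
      by (rule Bochner_Integration.integral_diff[OF integrable_phase[OF h] integrable_phase[OF hR], symmetric])
    also have "\<dots> = (LINT y|lborel. cis (- (y \<bullet> \<omega>)) * ?tR R y)"
      by (intro Bochner_Integration.integral_cong) (auto simp: indicator_def)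
    finally show ?thesis
      unfolding truncated_fourier_eq L1_fourier_def by (simp only: right_diff_distrib[symmetric])
  qed
  have "((\<lambda>R. LINT x|lborel. (cmod (?tR R x))\<^sup>2) \<longlongrightarrow> (LINT x|(lborel::(real^'n) measure). 0)) at_top"
  proof (rule integral_dominated_convergence_at_top[OF _ _ h2])
    show "AE x in lborel. ((\<lambda>R. (cmod (?tR R x))\<^sup>2) \<longlongrightarrow> 0) at_top"
    proof (rule AE_I2)
      fix x :: "real^'n"
      have "eventually (\<lambda>R. 0 = (cmod (?tR R x))\<^sup>2) at_top"
        using eventually_ge_at_top[of "norm x"] by eventually_elim simp
      then show "((\<lambda>R. (cmod (?tR R x))\<^sup>2) \<longlongrightarrow> 0) at_top"
        by (rule Lim_transform_eventually[OF tendsto_const])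
    qed
    show "\<forall>\<^sub>F R in at_top. AE x in lborel. norm ((cmod (?tR R x))\<^sup>2) \<le> (cmod (h x))\<^sup>2"
      by (intro always_eventually allI AE_I2) (auto simp: indicator_def)
  qed measurable
  then have lim: "((\<lambda>R. ennreal (LINT x|lborel. (cmod (?tR R x))\<^sup>2)) \<longlongrightarrow> 0) at_top"
    using tendsto_ennrealI by fastforce
  have "(\<integral>\<^sup>+ \<omega>. ennreal ((cmod (L1_fourier h \<omega> - truncated_fourier R h \<omega>))\<^sup>2) \<partial>lborel) \<le> ennreal (LINT x|lborel. (cmod (?tR R x))\<^sup>2)" for R
  proof -
    have "integrable lborel (\<lambda>x. (cmod (?tR R x))\<^sup>2)"
      by (rule Bochner_Integration.integrable_bound[OF h2]) (auto simp: indicator_def)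
    then have "(\<integral>\<^sup>+x. ennreal ((cmod (?tR R x))\<^sup>2) \<partial>lborel) = ennreal (LINT x|lborel. (cmod (?tR R x))\<^sup>2)"
      by (intro nn_integral_eq_integral) auto
    then show ?thesis unfolding diff using plancherel_le[OF tR, of R] by simp
  qed
  then show "((\<lambda>R. \<integral>\<^sup>+ \<omega>. ennreal ((cmod (L1_fourier h \<omega> - truncated_fourier R h \<omega>))\<^sup>2) \<partial>lborel) \<longlongrightarrow> 0) at_top"
    by (intro tendsto_sandwich[OF _ _ tendsto_const lim]) (auto intro!: always_eventually)
qed

text \<open>Two L2 limits of the same truncations agree; the bound |a - b|^2 \<le> 2 (|a|^2 + |b|^2)
  keeps the whole estimate in the extended reals. This is what carries facts about an explicit
  transform over to the chosen \<open>fourier\<close>.\<close>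

lemma is_fourier_unique:
  fixes f :: "real ^ 'n \<Rightarrow> complex"
  assumes [measurable]: "f \<in> borel_measurable borel" and g1: "is_fourier f g1" and g2: "is_fourier f g2"
  shows "AE \<omega> in lborel. g1 \<omega> = g2 \<omega>"
proof -
  have [measurable]: "g1 \<in> borel_measurable borel" "g2 \<in> borel_measurable borel"
    using g1 g2 by (auto simp: is_fourier_def square_integrable_def)
  let ?D = "\<lambda>g R. \<integral>\<^sup>+ \<omega>. ennreal ((cmod (g \<omega> - truncated_fourier R f \<omega>))\<^sup>2) \<partial>lborel"
  have D: "(?D g1 \<longlongrightarrow> 0) at_top" "(?D g2 \<longlongrightarrow> 0) at_top" using g1 g2 by (auto simp: is_fourier_def)
  have "(\<integral>\<^sup>+ \<omega>. ennreal ((cmod (g1 \<omega> - g2 \<omega>))\<^sup>2) \<partial>lborel) \<le> 2 * (?D g1 R + ?D g2 R)" for R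
  proof -
    have "(\<integral>\<^sup>+ \<omega>. ennreal ((cmod (g1 \<omega> - g2 \<omega>))\<^sup>2) \<partial>lborel) \<le>
      (\<integral>\<^sup>+ \<omega>. 2 * (ennreal ((cmod (g1 \<omega> - truncated_fourier R f \<omega>))\<^sup>2) + ennreal ((cmod (g2 \<omega> - truncated_fourier R f \<omega>))\<^sup>2)) \<partial>lborel)"
    proof (intro nn_integral_mono)
      fix \<omega>
      let ?a = "cmod (g1 \<omega> - truncated_fourier R f \<omega>)" and ?b = "cmod (g2 \<omega> - truncated_fourier R f \<omega>)"
      have "cmod (g1 \<omega> - g2 \<omega>) \<le> ?a + ?b"
        using norm_triangle_ineq4[of "g1 \<omega> - truncated_fourier R f \<omega>" "g2 \<omega> - truncated_fourier R f \<omega>"] by simp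
      then have "(cmod (g1 \<omega> - g2 \<omega>))\<^sup>2 \<le> (?a + ?b)\<^sup>2" by (intro power_mono) auto
      also have "\<dots> \<le> 2 * (?a\<^sup>2 + ?b\<^sup>2)" using sum_squares_bound[of ?a ?b] by (simp add: power2_sum)
      finally show "ennreal ((cmod (g1 \<omega> - g2 \<omega>))\<^sup>2) \<le> 2 * (ennreal (?a\<^sup>2) + ennreal (?b\<^sup>2))"
        by (simp add: ennreal_leI flip: ennreal_plus ennreal_numeral ennreal_mult)
    qed
    also have "\<dots> = 2 * (?D g1 R + ?D g2 R)" by (simp add: nn_integral_cmult nn_integral_add)
    finally show ?thesis .
  qed
  moreover have "((\<lambda>R. 2 * (?D g1 R + ?D g2 R)) \<longlongrightarrow> 2 * (0 + 0)) at_top"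
    by (intro ennreal_tendsto_cmult tendsto_add D) auto
  ultimately have "(\<integral>\<^sup>+ \<omega>. ennreal ((cmod (g1 \<omega> - g2 \<omega>))\<^sup>2) \<partial>lborel) \<le> 2 * (0 + 0)"
    by (intro tendsto_lowerbound) (auto intro!: always_eventually)
  then have "(\<integral>\<^sup>+ \<omega>. ennreal ((cmod (g1 \<omega> - g2 \<omega>))\<^sup>2) \<partial>lborel) = 0" by simp
  then have "AE \<omega> in lborel. ennreal ((cmod (g1 \<omega> - g2 \<omega>))\<^sup>2) = 0"
    by (subst (asm) nn_integral_0_iff_AE) auto
  then show ?thesis by eventually_elim (simp add: ennreal_eq_0_iff)
qed

section \<open>Taylor remainders of Fourier integrals\<close>

text \<open>Order 0 is included on purpose: the remainder is then the plane wave itself, so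
  functions and their remainders obey one set of rules.\<close>

definition taylor_rem :: "nat \<Rightarrow> real \<Rightarrow> complex" where
  "taylor_rem m y = cis y - (\<Sum>j<m. (\<i> * of_real y) ^ j / fact j)"

lemma taylor_rem_0 [simp]: "taylor_rem 0 y = cis y"
  by (simp add: taylor_rem_def)

lemma norm_taylor_rem_le: "cmod (taylor_rem m y) \<le> \<bar>y\<bar> ^ m / fact m"
proof (cases m)
  case (Suc k)
  then show ?thesis using iexp_approx1[of y k]
    by (simp add: taylor_rem_def cis_conv_exp lessThan_Suc_atMost)
qed simp

text \<open>For m = 0 the truncated difference m - 1 is again 0, which is correct because the
  derivative of \<open>cis\<close> is \<open>\<i>\<close> times \<open>cis\<close>.\<close>

lemma taylor_rem_has_vector_derivative:
  "(taylor_rem m has_vector_derivative \<i> * taylor_rem (m - 1) y) (at y)"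
proof -
  have S: "((\<lambda>y. \<Sum>j<m. (\<i> * of_real y) ^ j / fact j) has_vector_derivative \<i> * (\<Sum>j<m - 1. (\<i> * of_real y) ^ j / fact j)) (at y)"
  proof (induction m)
    case (Suc k)
    have "((\<lambda>z::complex. (\<i> * z) ^ k / fact k) has_field_derivative
        (if k = 0 then 0 else \<i> * ((\<i> * of_real y) ^ (k - 1) / fact (k - 1)))) (at (of_real y))"
    proof (cases k)
      case k: (Suc n)
      have "((\<lambda>z::complex. (\<i> * z) ^ Suc n / fact (Suc n)) has_field_derivative
          of_nat (Suc n) * ((\<i> * of_real y) ^ n * \<i>) / fact (Suc n)) (at (of_real y))"
      proof -
        have "((\<lambda>z::complex. \<i> * z) has_field_derivative \<i>) (at (of_real y))"
          by (auto intro!: derivative_eq_intros)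
        from DERIV_cdivide[OF DERIV_power[OF this, of "Suc n"], of "fact (Suc n)"] show ?thesis
          by (simp only: diff_Suc_1 diff_Suc_Suc minus_nat.diff_0 mult_ac One_nat_def)
      qed
      also have "of_nat (Suc n) * ((\<i> * of_real y) ^ n * \<i>) / fact (Suc n) = \<i> * ((\<i> * of_real y) ^ n / fact n)"
        unfolding fact_Suc by (simp del: of_nat_Suc)
      finally show ?thesis by (simp add: k)
    qed simp
    from has_vector_derivative_real_field[OF this]
    have "((\<lambda>y. (\<i> * of_real y) ^ k / fact k) has_vector_derivative
        (if k = 0 then 0 else \<i> * ((\<i> * of_real y) ^ (k - 1) / fact (k - 1)))) (at y)"
      by (simp add: o_def)
    from has_vector_derivative_add[OF Suc this] show ?case
      by (cases k) (auto simp: distrib_left)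
  qed simp
  have "((\<lambda>y. iexp y) has_vector_derivative \<i> * iexp y) (at y)"
    by (auto intro!: derivative_eq_intros)
  from has_vector_derivative_diff[OF this S] show ?thesis
    by (simp add: taylor_rem_def[abs_def] cis_conv_exp right_diff_distrib)
qed

lemma taylor_rem_measurable [measurable]: "taylor_rem m \<in> borel_measurable borel"
  by (intro borel_measurable_continuous_onI continuous_at_imp_continuous_on ballI
      has_vector_derivative_continuous[OF taylor_rem_has_vector_derivative])

text \<open>Supplies the majorant for differentiating under the integral. Factorials are dropped,
  because only polynomial growth in the frequency matters there.\<close>

lemma taylor_rem_lipschitz:
  "cmod (taylor_rem m (y + b) - taylor_rem m y) \<le> (\<bar>y\<bar> + \<bar>b\<bar>) ^ (m - 1) * \<bar>b\<bar>"
proof -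
  have "cmod (taylor_rem m (y + b) - taylor_rem m y) \<le> (\<bar>y\<bar> + \<bar>b\<bar>) ^ (m - 1) * norm (y + b - y)"
  proof (rule differentiable_bound[of "closed_segment y (y + b)" _ "\<lambda>z h. h *\<^sub>R (\<i> * taylor_rem (m - 1) z)"])
    fix z assume "z \<in> closed_segment y (y + b)"
    then have z: "\<bar>z\<bar> \<le> \<bar>y\<bar> + \<bar>b\<bar>" by (auto simp: closed_segment_eq_real_ivl split: if_splits)
    show "(taylor_rem m has_derivative (\<lambda>h. h *\<^sub>R (\<i> * taylor_rem (m - 1) z))) (at z within closed_segment y (y + b))"
      using taylor_rem_has_vector_derivative[of m z]
      unfolding has_vector_derivative_def by (rule has_derivative_at_withinI)
    have "cmod (taylor_rem (m - 1) z) \<le> (\<bar>y\<bar> + \<bar>b\<bar>) ^ (m - 1) / 1"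
      using z by (intro order_trans[OF norm_taylor_rem_le] frac_le power_mono) (auto simp: fact_ge_1)
    then show "onorm (\<lambda>h. h *\<^sub>R (\<i> * taylor_rem (m - 1) z)) \<le> (\<bar>y\<bar> + \<bar>b\<bar>) ^ (m - 1)"
      by (intro onorm_le) (simp add: norm_mult mult.commute[of _ "\<bar>_\<bar>"] mult_left_mono)
  qed auto
  then show ?thesis by simp
qed

text \<open>Expresses the derivative as a limit that can be tested along sequences, the form in
  which dominated convergence applies.\<close>

lemma has_vector_derivative_at_0_iff:
  "(F has_vector_derivative D) (at 0) \<longleftrightarrow> ((\<lambda>h. (F h - F 0) /\<^sub>R h) \<longlongrightarrow> D) (at 0)"
proof -
  have "((\<lambda>h. norm (F (0 + h) - F 0 - h *\<^sub>R D) / norm h) \<longlongrightarrow> 0) (at 0) \<longleftrightarrow> ((\<lambda>h. norm ((F h - F 0) /\<^sub>R h - D)) \<longlongrightarrow> 0) (at 0)"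
  proof (rule filterlim_cong[OF refl refl])
    show "\<forall>\<^sub>F h in at 0. norm (F (0 + h) - F 0 - h *\<^sub>R D) / norm h = norm ((F h - F 0) /\<^sub>R h - D)"
      unfolding eventually_at_filter
    proof (intro always_eventually allI impI)
      fix h :: real assume h: "h \<noteq> 0"
      then have "(F h - F 0) /\<^sub>R h - D = (F h - F 0 - h *\<^sub>R D) /\<^sub>R h" by (simp add: scaleR_diff_right)
      then show "norm (F (0 + h) - F 0 - h *\<^sub>R D) / norm h = norm ((F h - F 0) /\<^sub>R h - D)"
        using h by (simp add: divide_inverse_commute)
    qed
  qed
  then show ?thesis
    unfolding has_vector_derivative_def has_derivative_at
    by (simp add: bounded_linear_scaleR_left tendsto_norm_zero_iff Lim_null[symmetric])
qed

section \<open>Spectra with all moments, and differentiation under the integral\<close>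

definition all_moments :: "('a::euclidean_space \<Rightarrow> complex) \<Rightarrow> bool" where
  "all_moments g \<longleftrightarrow> g \<in> borel_measurable borel \<and> (\<forall>k::nat. integrable lborel (\<lambda>\<omega>. cmod (g \<omega>) * norm \<omega> ^ k))"

lemma all_moments_measurable: "all_moments g \<Longrightarrow> g \<in> borel_measurable borel"
  by (simp add: all_moments_def)

lemma all_moments_integrable_mult:
  fixes g p :: "'a::euclidean_space \<Rightarrow> complex"
  assumes g: "all_moments g" and [measurable]: "p \<in> borel_measurable borel"
    and bound: "\<And>\<omega>. cmod (p \<omega>) \<le> C * norm \<omega> ^ k"
  shows "integrable lborel (\<lambda>\<omega>. g \<omega> * p \<omega>)"
proof (rule Bochner_Integration.integrable_bound)
  have [measurable]: "g \<in> borel_measurable borel" using g by (rule all_moments_measurable)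
  show "(\<lambda>\<omega>. g \<omega> * p \<omega>) \<in> borel_measurable lborel" by measurable
  show "integrable lborel (\<lambda>\<omega>. C * (cmod (g \<omega>) * norm \<omega> ^ k))"
    using g by (simp add: all_moments_def)
  show "AE \<omega> in lborel. norm (g \<omega> * p \<omega>) \<le> norm (C * (cmod (g \<omega>) * norm \<omega> ^ k))"
  proof (rule AE_I2)
    fix \<omega>
    have "cmod (g \<omega>) * cmod (p \<omega>) \<le> cmod (g \<omega>) * (C * norm \<omega> ^ k)"
      by (intro mult_left_mono bound) auto
    then show "norm (g \<omega> * p \<omega>) \<le> norm (C * (cmod (g \<omega>) * norm \<omega> ^ k))"
      by (simp add: norm_mult mult_ac)
  qed
qed

lemma all_moments_mult:
  fixes g p :: "'a::euclidean_space \<Rightarrow> complex"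
  assumes g: "all_moments g" and p [measurable]: "p \<in> borel_measurable borel"
    and bound: "\<And>\<omega>. cmod (p \<omega>) \<le> C * norm \<omega> ^ k"
  shows "all_moments (\<lambda>\<omega>. g \<omega> * p \<omega>)"
  unfolding all_moments_def
proof (intro conjI allI)
  have [measurable]: "g \<in> borel_measurable borel" using g by (rule all_moments_measurable)
  show "(\<lambda>\<omega>. g \<omega> * p \<omega>) \<in> borel_measurable borel" by measurable
  fix l
  have "integrable lborel (\<lambda>\<omega>. g \<omega> * (p \<omega> * of_real (norm \<omega> ^ l)))"
    by (rule all_moments_integrable_mult[OF g, of _ C "k + l"])
      (use bound in \<open>auto simp: norm_mult norm_power power_add mult_right_mono simp flip: mult.assoc\<close>)
  from integrable_norm[OF this] show "integrable lborel (\<lambda>\<omega>. cmod (g \<omega> * p \<omega>) * norm \<omega> ^ l)"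
    by (simp add: norm_mult norm_power mult.assoc)
qed

lemma all_moments_diff:
  fixes f g :: "'a::euclidean_space \<Rightarrow> complex"
  assumes f: "all_moments f" and g: "all_moments g"
  shows "all_moments (\<lambda>\<omega>. f \<omega> - g \<omega>)"
  unfolding all_moments_def
proof (intro conjI allI)
  have [measurable]: "f \<in> borel_measurable borel" "g \<in> borel_measurable borel"
    using f g by (auto intro: all_moments_measurable)
  show "(\<lambda>\<omega>. f \<omega> - g \<omega>) \<in> borel_measurable borel" by measurable
  fix k
  show "integrable lborel (\<lambda>\<omega>. cmod (f \<omega> - g \<omega>) * norm \<omega> ^ k)"
  proof (rule Bochner_Integration.integrable_bound)
    show "integrable lborel (\<lambda>\<omega>. cmod (f \<omega>) * norm \<omega> ^ k + cmod (g \<omega>) * norm \<omega> ^ k)"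
      using f g by (simp add: all_moments_def)
    show "AE \<omega> in lborel. norm (cmod (f \<omega> - g \<omega>) * norm \<omega> ^ k) \<le> norm (cmod (f \<omega>) * norm \<omega> ^ k + cmod (g \<omega>) * norm \<omega> ^ k)"
    proof (rule AE_I2)
      fix \<omega>
      have "cmod (f \<omega> - g \<omega>) * norm \<omega> ^ k \<le> (cmod (f \<omega>) + cmod (g \<omega>)) * norm \<omega> ^ k"
        by (intro mult_right_mono norm_triangle_ineq4) auto
      then show "norm (cmod (f \<omega> - g \<omega>) * norm \<omega> ^ k) \<le> norm (cmod (f \<omega>) * norm \<omega> ^ k + cmod (g \<omega>) * norm \<omega> ^ k)"
        by (simp add: distrib_right)
    qed
  qed measurable
qed

definition fourier_rem :: "nat \<Rightarrow> ('a::euclidean_space \<Rightarrow> complex) \<Rightarrow> 'a \<Rightarrow> 'a \<Rightarrow> complex" where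
  "fourier_rem m g x0 x = (LINT \<omega>|lborel. g \<omega> * taylor_rem m (\<omega> \<bullet> (x - x0)))"

text \<open>The Taylor polynomial at \<open>x0\<close>, of degree below \<open>m\<close> for
  positive \<open>m\<close>. Encoding it as a difference lets it inherit the derivative rule of
  \<open>fourier_rem\<close>; its polynomial form is recovered along lines in
  \<open>fourier_poly_on_line\<close>.\<close>

definition fourier_poly :: "nat \<Rightarrow> ('a::euclidean_space \<Rightarrow> complex) \<Rightarrow> 'a \<Rightarrow> 'a \<Rightarrow> complex" where
  "fourier_poly m g x0 x = fourier_rem 0 g x0 x - fourier_rem m g x0 x"

lemma norm_taylor_rem_inner_le:
  fixes \<omega> z :: "'a::euclidean_space"
  shows "cmod (taylor_rem m (\<omega> \<bullet> z)) \<le> norm z ^ m / fact m * norm \<omega> ^ m"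
proof -
  have "\<bar>\<omega> \<bullet> z\<bar> ^ m \<le> (norm \<omega> * norm z) ^ m"
    by (intro power_mono Cauchy_Schwarz_ineq2) auto
  then have "\<bar>\<omega> \<bullet> z\<bar> ^ m / fact m \<le> (norm \<omega> * norm z) ^ m / fact m"
    by (rule divide_right_mono) simp
  also have "\<dots> = norm z ^ m / fact m * norm \<omega> ^ m" by (simp add: power_mult_distrib)
  finally show ?thesis by (rule order_trans[OF norm_taylor_rem_le])
qed

lemma fourier_rem_integrable: "all_moments g \<Longrightarrow> integrable lborel (\<lambda>\<omega>. g \<omega> * taylor_rem m (\<omega> \<bullet> z))"
  by (rule all_moments_integrable_mult) (auto intro: norm_taylor_rem_inner_le)

lemma norm_fourier_rem_le:
  assumes g: "all_moments g"
  shows "cmod (fourier_rem m g x0 x) \<le> norm (x - x0) ^ m / fact m * (LINT \<omega>|lborel. cmod (g \<omega>) * norm \<omega> ^ m)"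
proof -
  have "cmod (fourier_rem m g x0 x) \<le> (LINT \<omega>|lborel. cmod (g \<omega> * taylor_rem m (\<omega> \<bullet> (x - x0))))"
    unfolding fourier_rem_def by (rule integral_norm_bound)
  also have "\<dots> \<le> (LINT \<omega>|lborel. norm (x - x0) ^ m / fact m * (cmod (g \<omega>) * norm \<omega> ^ m))"
  proof (rule integral_mono)
    show "integrable lborel (\<lambda>\<omega>. cmod (g \<omega> * taylor_rem m (\<omega> \<bullet> (x - x0))))"
      by (intro integrable_norm fourier_rem_integrable g)
    show "integrable lborel (\<lambda>\<omega>. norm (x - x0) ^ m / fact m * (cmod (g \<omega>) * norm \<omega> ^ m))"
      using g by (intro integrable_mult_right) (simp add: all_moments_def)
    fix \<omega>
    show "cmod (g \<omega> * taylor_rem m (\<omega> \<bullet> (x - x0))) \<le> norm (x - x0) ^ m / fact m * (cmod (g \<omega>) * norm \<omega> ^ m)"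
      using mult_left_mono[OF norm_taylor_rem_inner_le[of m \<omega> "x - x0"], of "cmod (g \<omega>)"]
      by (simp add: norm_mult mult_ac)
  qed
  finally show ?thesis by simp
qed

lemma norm_phase_le: "cmod (\<i> * of_real (\<omega> \<bullet> v)) \<le> norm v * norm \<omega> ^ 1" for \<omega> v :: "'a::euclidean_space"
  using Cauchy_Schwarz_ineq2[of \<omega> v] by (simp add: norm_mult mult.commute)

lemma all_moments_phase:
  "all_moments g \<Longrightarrow> all_moments (\<lambda>\<omega>. g \<omega> * (\<i> * of_real (\<omega> \<bullet> v)))"
  by (rule all_moments_mult) (auto intro: norm_phase_le)

text \<open>Dominated convergence of the difference quotients. The new factor in the spectrum
  preserves \<open>all_moments\<close>, so the class of these integrals is closed under repeated
  differentiation.\<close>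

lemma fourier_rem_has_vector_derivative:
  assumes g: "all_moments g"
  shows "((\<lambda>t. fourier_rem m g x0 (x + t *\<^sub>R v)) has_vector_derivative
    fourier_rem (m - 1) (\<lambda>\<omega>. g \<omega> * (\<i> * of_real (\<omega> \<bullet> v))) x0 x) (at 0)"
proof -
  let ?F = "\<lambda>t. fourier_rem m g x0 (x + t *\<^sub>R v)"
  let ?D = "fourier_rem (m - 1) (\<lambda>\<omega>. g \<omega> * (\<i> * of_real (\<omega> \<bullet> v))) x0 x"
  have [measurable]: "g \<in> borel_measurable borel" using g by (rule all_moments_measurable)
  let ?a = "\<lambda>\<omega>. \<omega> \<bullet> (x - x0)" and ?b = "\<lambda>\<omega>. \<omega> \<bullet> v"
  have "((\<lambda>h. (?F h - ?F 0) /\<^sub>R h) \<longlongrightarrow> ?D) (at 0)"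
    unfolding tendsto_at_iff_sequentially
  proof (intro allI impI)
    fix X :: "nat \<Rightarrow> real"
    assume X: "\<forall>i. X i \<in> UNIV - {0}" "X \<longlonglongrightarrow> 0"
    have X0: "X i \<noteq> 0" for i using X(1) by simp
    \<comment> \<open>A bound on the whole null sequence makes the constant \<open>?K\<close> of the
      majorant independent of the index.\<close>
    obtain B where B: "\<And>i. \<bar>X i\<bar> \<le> B" "0 < B"
      using convergent_imp_Bseq[OF convergentI[OF X(2)]] by (auto simp: Bseq_def)
    let ?s = "\<lambda>i \<omega>. g \<omega> * ((taylor_rem m (?a \<omega> + X i * ?b \<omega>) - taylor_rem m (?a \<omega>)) /\<^sub>R X i)"
    let ?K = "norm v * (norm (x - x0) + B * norm v) ^ (m - 1)"
    have "(\<lambda>i. LINT \<omega>|lborel. ?s i \<omega>) \<longlonglongrightarrow> (LINT \<omega>|lborel. (g \<omega> * (\<i> * of_real (\<omega> \<bullet> v))) * taylor_rem (m - 1) (?a \<omega>))"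
    proof (rule integral_dominated_convergence)
      show "integrable lborel (\<lambda>\<omega>. ?K * (cmod (g \<omega>) * norm \<omega> ^ Suc (m - 1)))"
        using g unfolding all_moments_def by (intro integrable_mult_right) blast
      show "AE \<omega> in lborel. (\<lambda>i. ?s i \<omega>) \<longlonglongrightarrow> (g \<omega> * (\<i> * of_real (\<omega> \<bullet> v))) * taylor_rem (m - 1) (?a \<omega>)"
      proof (rule AE_I2)
        fix \<omega>
        have "((\<lambda>t. ?a \<omega> + t * ?b \<omega>) has_vector_derivative ?b \<omega>) (at 0)"
          by (auto intro!: derivative_eq_intros)
        moreover have "(taylor_rem m has_vector_derivative \<i> * taylor_rem (m - 1) (?a \<omega>)) (at (?a \<omega> + 0 * ?b \<omega>))"
          using taylor_rem_has_vector_derivative[of m "?a \<omega>"] by simp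
        ultimately have "(taylor_rem m \<circ> (\<lambda>t. ?a \<omega> + t * ?b \<omega>) has_vector_derivative
            ?b \<omega> *\<^sub>R (\<i> * taylor_rem (m - 1) (?a \<omega>))) (at 0)"
          by (rule vector_diff_chain_at)
        then have "((\<lambda>h. (taylor_rem m (?a \<omega> + h * ?b \<omega>) - taylor_rem m (?a \<omega>)) /\<^sub>R h) \<longlongrightarrow>
            ?b \<omega> *\<^sub>R (\<i> * taylor_rem (m - 1) (?a \<omega>))) (at 0)"
          unfolding has_vector_derivative_at_0_iff by (simp add: o_def)
        then have "(\<lambda>i. (taylor_rem m (?a \<omega> + X i * ?b \<omega>) - taylor_rem m (?a \<omega>)) /\<^sub>R X i) \<longlonglongrightarrow>
            ?b \<omega> *\<^sub>R (\<i> * taylor_rem (m - 1) (?a \<omega>))"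
          using X unfolding tendsto_at_iff_sequentially by (auto simp: o_def)
        then have "(\<lambda>i. ?s i \<omega>) \<longlonglongrightarrow> g \<omega> * (?b \<omega> *\<^sub>R (\<i> * taylor_rem (m - 1) (?a \<omega>)))"
          by (rule tendsto_mult_left)
        then show "(\<lambda>i. ?s i \<omega>) \<longlonglongrightarrow> (g \<omega> * (\<i> * of_real (\<omega> \<bullet> v))) * taylor_rem (m - 1) (?a \<omega>)"
          by (simp add: scaleR_conv_of_real mult_ac)
      qed
      show "AE \<omega> in lborel. norm (?s i \<omega>) \<le> ?K * (cmod (g \<omega>) * norm \<omega> ^ Suc (m - 1))" for i
      proof (rule AE_I2)
        fix \<omega>
        have a: "\<bar>?a \<omega>\<bar> \<le> norm \<omega> * norm (x - x0)" and b: "\<bar>?b \<omega>\<bar> \<le> norm \<omega> * norm v"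
          by (rule Cauchy_Schwarz_ineq2)+
        have "\<bar>?a \<omega>\<bar> + \<bar>X i * ?b \<omega>\<bar> \<le> norm \<omega> * norm (x - x0) + B * (norm \<omega> * norm v)"
          unfolding abs_mult using B by (intro add_mono mult_mono a b) auto
        also have "\<dots> = norm \<omega> * (norm (x - x0) + B * norm v)" by (simp add: algebra_simps)
        finally have ab: "\<bar>?a \<omega>\<bar> + \<bar>X i * ?b \<omega>\<bar> \<le> norm \<omega> * (norm (x - x0) + B * norm v)" .
        have "cmod (taylor_rem m (?a \<omega> + X i * ?b \<omega>) - taylor_rem m (?a \<omega>))
            \<le> (norm \<omega> * (norm (x - x0) + B * norm v)) ^ (m - 1) * (\<bar>X i\<bar> * (norm \<omega> * norm v))"
          using ab b by (intro order_trans[OF taylor_rem_lipschitz] mult_mono power_mono)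
            (auto simp: abs_mult mult_left_mono B(2) less_imp_le)
        then have "cmod (taylor_rem m (?a \<omega> + X i * ?b \<omega>) - taylor_rem m (?a \<omega>)) / \<bar>X i\<bar> \<le>
            (norm \<omega> * (norm (x - x0) + B * norm v)) ^ (m - 1) * (norm \<omega> * norm v)"
          using X0[of i] by (simp add: field_simps)
        also have "\<dots> = ?K * norm \<omega> ^ Suc (m - 1)" by (simp add: power_mult_distrib)
        finally have "cmod (g \<omega>) * (cmod (taylor_rem m (?a \<omega> + X i * ?b \<omega>) - taylor_rem m (?a \<omega>)) / \<bar>X i\<bar>) \<le> cmod (g \<omega>) * (?K * norm \<omega> ^ Suc (m - 1))"
          by (rule mult_left_mono) simp
        then show "norm (?s i \<omega>) \<le> ?K * (cmod (g \<omega>) * norm \<omega> ^ Suc (m - 1))"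
          by (simp add: norm_mult divide_inverse mult_ac)
      qed
    qed measurable
    moreover have "(LINT \<omega>|lborel. ?s i \<omega>) = (?F (X i) - ?F 0) /\<^sub>R X i" for i
    proof -
      have "?F (X i) - ?F 0 = (LINT \<omega>|lborel. g \<omega> * taylor_rem m (\<omega> \<bullet> (x - x0 + X i *\<^sub>R v)) - g \<omega> * taylor_rem m (\<omega> \<bullet> (x - x0)))"
        unfolding fourier_rem_def
        using Bochner_Integration.integral_diff[OF fourier_rem_integrable[OF g] fourier_rem_integrable[OF g], of m "x - x0 + X i *\<^sub>R v" m "x - x0"]
        by (simp add: algebra_simps)
      also have "\<dots> /\<^sub>R X i = (LINT \<omega>|lborel. (g \<omega> * taylor_rem m (\<omega> \<bullet> (x - x0 + X i *\<^sub>R v)) - g \<omega> * taylor_rem m (\<omega> \<bullet> (x - x0))) /\<^sub>R X i)"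
        by (rule integral_scaleR_right[symmetric])
      also have "\<dots> = (LINT \<omega>|lborel. ?s i \<omega>)"
        by (intro Bochner_Integration.integral_cong refl) (simp add: inner_add_right right_diff_distrib)
      finally show ?thesis by (rule sym)
    qed
    ultimately show "((\<lambda>h. (?F h - ?F 0) /\<^sub>R h) \<circ> X) \<longlonglongrightarrow> ?D"
      by (simp only: o_def fourier_rem_def)
  qed
  then show ?thesis by (simp add: has_vector_derivative_at_0_iff)
qed

lemma fourier_poly_has_vector_derivative:
  assumes g: "all_moments g"
  shows "((\<lambda>t. fourier_poly m g x0 (x + t *\<^sub>R v)) has_vector_derivative
    fourier_poly (m - 1) (\<lambda>\<omega>. g \<omega> * (\<i> * of_real (\<omega> \<bullet> v))) x0 x) (at 0)"
  unfolding fourier_poly_def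
  using has_vector_derivative_diff[OF fourier_rem_has_vector_derivative[OF g, of 0]
      fourier_rem_has_vector_derivative[OF g, of m]] by simp

lemma partial_deriv_fourier_rem:
  assumes "all_moments g"
  shows "partial_deriv i (fourier_rem m g x0) = fourier_rem (m - 1) (\<lambda>\<omega>. g \<omega> * (\<i> * of_real (\<omega> \<bullet> axis i 1))) x0"
  unfolding partial_deriv_def
  by (intro ext vector_derivative_at fourier_rem_has_vector_derivative assms)

lemma partial_deriv_fourier_poly:
  assumes "all_moments g"
  shows "partial_deriv i (fourier_poly m g x0) = fourier_poly (m - 1) (\<lambda>\<omega>. g \<omega> * (\<i> * of_real (\<omega> \<bullet> axis i 1))) x0"
  unfolding partial_deriv_def
  by (intro ext vector_derivative_at fourier_poly_has_vector_derivative assms)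

lemma fourier_poly_eq_integral:
  assumes g: "all_moments g"
  shows "fourier_poly m g x0 x = (LINT \<omega>|lborel. g \<omega> * (\<Sum>j<m. (\<i> * of_real (\<omega> \<bullet> (x - x0))) ^ j / fact j))"
proof -
  have "fourier_poly m g x0 x = (LINT \<omega>|lborel. g \<omega> * taylor_rem 0 (\<omega> \<bullet> (x - x0)) - g \<omega> * taylor_rem m (\<omega> \<bullet> (x - x0)))"
    unfolding fourier_poly_def fourier_rem_def
    by (rule Bochner_Integration.integral_diff[symmetric]) (intro fourier_rem_integrable g)+
  also have "\<dots> = (LINT \<omega>|lborel. g \<omega> * (\<Sum>j<m. (\<i> * of_real (\<omega> \<bullet> (x - x0))) ^ j / fact j))"
    by (intro Bochner_Integration.integral_cong) (simp_all add: taylor_rem_def right_diff_distrib)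
  finally show ?thesis .
qed

text \<open>Along a line the inner product with \<omega> is affine in \<open>t\<close>, and the
  binomial theorem separates the powers of \<open>t\<close>; the coefficients are integrals that
  exist by the moment condition. This gives access to univariate inequalities.\<close>

lemma fourier_poly_on_line:
  assumes g: "all_moments g"
  obtains q :: "complex poly" where "degree q \<le> m" "\<And>t. fourier_poly m g x0 (x + t *\<^sub>R v) = poly q (of_real t)"
proof
  let ?a = "\<lambda>\<omega>. \<i> * complex_of_real (\<omega> \<bullet> (x - x0))" and ?b = "\<lambda>\<omega>. \<i> * complex_of_real (\<omega> \<bullet> v)"
  define c where "c j k = (LINT \<omega>|lborel. g \<omega> * (of_nat (j choose k) * (?b \<omega> ^ k * ?a \<omega> ^ (j - k)) / fact j))" for j k
  have int: "integrable lborel (\<lambda>\<omega>. g \<omega> * (of_nat (j choose k) * (?b \<omega> ^ k * ?a \<omega> ^ (j - k)) / fact j))" if "k \<le> j" for j k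
  proof (rule all_moments_integrable_mult[OF g])
    fix \<omega>
    have "cmod (?b \<omega> ^ k * ?a \<omega> ^ (j - k)) \<le> (norm v * norm \<omega> ^ 1) ^ k * (norm (x - x0) * norm \<omega> ^ 1) ^ (j - k)"
      unfolding norm_mult norm_power by (intro mult_mono power_mono norm_phase_le[unfolded norm_mult norm_power]) auto
    also have "\<dots> = norm v ^ k * norm (x - x0) ^ (j - k) * norm \<omega> ^ j"
      using that by (simp add: power_mult_distrib flip: power_add)
    finally have "cmod (?b \<omega> ^ k * ?a \<omega> ^ (j - k)) \<le> norm v ^ k * norm (x - x0) ^ (j - k) * norm \<omega> ^ j" .
    from mult_left_mono[OF this, of "real (j choose k) / fact j"]
    show "cmod (of_nat (j choose k) * (?b \<omega> ^ k * ?a \<omega> ^ (j - k)) / fact j) \<le>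
        (real (j choose k) / fact j * (norm v ^ k * norm (x - x0) ^ (j - k))) * norm \<omega> ^ j"
      by (simp add: norm_mult norm_divide norm_power mult_ac)
  qed measurable
  define q where "q = (\<Sum>j<m. \<Sum>k\<le>j. monom (c j k) k)"
  show "degree q \<le> m" unfolding q_def
    by (intro degree_sum_le) (auto intro!: degree_sum_le order_trans[OF degree_monom_le])
  fix t
  have "fourier_poly m g x0 (x + t *\<^sub>R v) = (LINT \<omega>|lborel. (\<Sum>j<m. \<Sum>k\<le>j. of_real t ^ k * (g \<omega> * (of_nat (j choose k) * (?b \<omega> ^ k * ?a \<omega> ^ (j - k)) / fact j))))"
    unfolding fourier_poly_eq_integral[OF g]
  proof (intro Bochner_Integration.integral_cong refl)
    fix \<omega>
    have "\<i> * of_real (\<omega> \<bullet> (x + t *\<^sub>R v - x0)) = of_real t * ?b \<omega> + ?a \<omega>"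
      by (simp add: inner_diff_right inner_add_right algebra_simps)
    then have "g \<omega> * ((\<i> * of_real (\<omega> \<bullet> (x + t *\<^sub>R v - x0))) ^ j / fact j) =
        (\<Sum>k\<le>j. of_real t ^ k * (g \<omega> * (of_nat (j choose k) * (?b \<omega> ^ k * ?a \<omega> ^ (j - k)) / fact j)))" for j
      by (simp add: binomial_ring power_mult_distrib sum_divide_distrib sum_distrib_left mult_ac)
    then show "g \<omega> * (\<Sum>j<m. (\<i> * of_real (\<omega> \<bullet> (x + t *\<^sub>R v - x0))) ^ j / fact j) =
        (\<Sum>j<m. \<Sum>k\<le>j. of_real t ^ k * (g \<omega> * (of_nat (j choose k) * (?b \<omega> ^ k * ?a \<omega> ^ (j - k)) / fact j)))"
      by (simp only: sum_distrib_left)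
  qed
  also have "\<dots> = (\<Sum>j<m. \<Sum>k\<le>j. of_real t ^ k * c j k)"
  proof -
    define u where "u j k \<omega> = g \<omega> * (of_nat (j choose k) * (?b \<omega> ^ k * ?a \<omega> ^ (j - k)) / fact j)" for j k \<omega>
    have u: "integrable lborel (\<lambda>\<omega>. of_real t ^ k * u j k \<omega>)" if "k \<le> j" for j k
      unfolding u_def by (intro integrable_mult_right int that)
    have "(LINT \<omega>|lborel. (\<Sum>j<m. \<Sum>k\<le>j. of_real t ^ k * u j k \<omega>)) = (\<Sum>j<m. LINT \<omega>|lborel. (\<Sum>k\<le>j. of_real t ^ k * u j k \<omega>))"
      by (intro Bochner_Integration.integral_sum Bochner_Integration.integrable_sum u) auto
    also have "\<dots> = (\<Sum>j<m. \<Sum>k\<le>j. LINT \<omega>|lborel. of_real t ^ k * u j k \<omega>)"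
      by (intro sum.cong refl Bochner_Integration.integral_sum u) auto
    finally show ?thesis unfolding u_def c_def by (simp only: integral_mult_right_zero)
  qed
  also have "\<dots> = poly q (of_real t)"
    by (simp add: q_def poly_sum poly_monom mult.commute)
  finally show "fourier_poly m g x0 (x + t *\<^sub>R v) = poly q (of_real t)" .
qed

section \<open>Multivariate Markov inequality and norming sets\<close>

lemma fourier_poly_has_vector_derivative_at:
  assumes g: "all_moments g"
  shows "((\<lambda>t. fourier_poly m g x0 (x + t *\<^sub>R v)) has_vector_derivative
    fourier_poly (m - 1) (\<lambda>\<omega>. g \<omega> * (\<i> * of_real (\<omega> \<bullet> v))) x0 (x + t *\<^sub>R v)) (at t)"
proof -
  let ?D = "fourier_poly (m - 1) (\<lambda>\<omega>. g \<omega> * (\<i> * of_real (\<omega> \<bullet> v))) x0 (x + t *\<^sub>R v)"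
  have "((\<lambda>s. s - t) has_vector_derivative 1) (at t)"
    by (auto intro!: derivative_eq_intros)
  moreover have "((\<lambda>s. fourier_poly m g x0 ((x + t *\<^sub>R v) + s *\<^sub>R v)) has_vector_derivative ?D) (at (t - t))"
    using fourier_poly_has_vector_derivative[OF g, of m x0 "x + t *\<^sub>R v" v] by simp
  ultimately have "((\<lambda>s. fourier_poly m g x0 ((x + t *\<^sub>R v) + s *\<^sub>R v)) \<circ> (\<lambda>s. s - t) has_vector_derivative 1 *\<^sub>R ?D) (at t)"
    by (rule vector_diff_chain_at)
  moreover have "(\<lambda>s. fourier_poly m g x0 ((x + t *\<^sub>R v) + s *\<^sub>R v)) \<circ> (\<lambda>s. s - t) = (\<lambda>s. fourier_poly m g x0 (x + s *\<^sub>R v))"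
    by (auto simp: fun_eq_iff algebra_simps)
  ultimately show ?thesis by simp
qed

text \<open>Only directional derivatives are at hand, so linearity in the direction is read off from
  the spectrum, where the direction enters linearly.\<close>

lemma fourier_poly_direction_linear:
  assumes g: "all_moments g"
  shows "fourier_poly m (\<lambda>\<omega>. g \<omega> * (\<i> * of_real (\<omega> \<bullet> (r *\<^sub>R v)))) x0 x =
      of_real r * fourier_poly m (\<lambda>\<omega>. g \<omega> * (\<i> * of_real (\<omega> \<bullet> v))) x0 x" (is ?thesis1)
    and "fourier_poly m (\<lambda>\<omega>. g \<omega> * (\<i> * of_real (\<omega> \<bullet> (u - v)))) x0 x =
      fourier_poly m (\<lambda>\<omega>. g \<omega> * (\<i> * of_real (\<omega> \<bullet> u))) x0 x - fourier_poly m (\<lambda>\<omega>. g \<omega> * (\<i> * of_real (\<omega> \<bullet> v))) x0 x" (is ?thesis2)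
proof -
  have 1: "fourier_rem k (\<lambda>\<omega>. g \<omega> * (\<i> * of_real (\<omega> \<bullet> (r *\<^sub>R v)))) x0 x =
      of_real r * fourier_rem k (\<lambda>\<omega>. g \<omega> * (\<i> * of_real (\<omega> \<bullet> v))) x0 x" for k
    unfolding fourier_rem_def integral_mult_right_zero[symmetric]
    by (intro Bochner_Integration.integral_cong refl) simp
  show ?thesis1 by (simp only: fourier_poly_def 1 right_diff_distrib)
  have 2: "fourier_rem k (\<lambda>\<omega>. g \<omega> * (\<i> * of_real (\<omega> \<bullet> (u - v)))) x0 x =
      fourier_rem k (\<lambda>\<omega>. g \<omega> * (\<i> * of_real (\<omega> \<bullet> u))) x0 x - fourier_rem k (\<lambda>\<omega>. g \<omega> * (\<i> * of_real (\<omega> \<bullet> v))) x0 x" for k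
    unfolding fourier_rem_def
    unfolding Bochner_Integration.integral_diff[OF fourier_rem_integrable[OF all_moments_phase[OF g]]
        fourier_rem_integrable[OF all_moments_phase[OF g]], symmetric]
    by (intro Bochner_Integration.integral_cong refl) (simp add: inner_diff_right algebra_simps)
  show ?thesis2 by (simp only: fourier_poly_def 2) simp
qed

text \<open>On the segment from \<open>w\<close> to \<open>b\<close> the polynomial is univariate,
  and its derivative at the endpoint 0 is the derivative at \<open>w\<close> in direction
  \<open>b - w\<close>. The endpoint form of Markov's inequality fits because \<open>w\<close> may
  lie on the boundary of \<open>D\<close>.\<close>

lemma markov_segment:
  assumes g: "all_moments g" and D: "convex D" and w: "w \<in> D" and b: "b \<in> D"
    and M: "\<And>x. x \<in> D \<Longrightarrow> cmod (fourier_poly m g x0 x) \<le> M"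
  shows "cmod (fourier_poly (m - 1) (\<lambda>\<omega>. g \<omega> * (\<i> * of_real (\<omega> \<bullet> (b - w)))) x0 w) \<le> 2 * (real m)\<^sup>2 * M"
proof -
  obtain q :: "complex poly" where q: "degree q \<le> m" "\<And>t. fourier_poly m g x0 (w + t *\<^sub>R (b - w)) = poly q (of_real t)"
    using fourier_poly_on_line[OF g, of m x0 w "b - w"] by blast
  have "cmod (poly (pderiv q) 0) \<le> 2 * (real m)\<^sup>2 * M"
  proof (rule markov_endpoint[OF q(1)])
    fix t :: real assume "0 \<le> t" "t \<le> 1"
    then have "(1 - t) *\<^sub>R w + t *\<^sub>R b \<in> D" using convexD_alt[OF D w b] by simp
    moreover have "(1 - t) *\<^sub>R w + t *\<^sub>R b = w + t *\<^sub>R (b - w)" by (simp add: algebra_simps)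
    ultimately show "cmod (poly q (of_real t)) \<le> M" using M q(2)[of t] by metis
  qed
  moreover have "poly (pderiv q) 0 = fourier_poly (m - 1) (\<lambda>\<omega>. g \<omega> * (\<i> * of_real (\<omega> \<bullet> (b - w)))) x0 w"
  proof (rule vector_derivative_unique_at)
    show "((\<lambda>t. fourier_poly m g x0 (w + t *\<^sub>R (b - w))) has_vector_derivative
        fourier_poly (m - 1) (\<lambda>\<omega>. g \<omega> * (\<i> * of_real (\<omega> \<bullet> (b - w)))) x0 w) (at 0)"
      by (rule fourier_poly_has_vector_derivative[OF g])
    have "(poly q has_field_derivative poly (pderiv q) (of_real 0)) (at (of_real 0))" by (rule poly_DERIV)
    from has_vector_derivative_real_field[OF this]
    show "((\<lambda>t. fourier_poly m g x0 (w + t *\<^sub>R (b - w))) has_vector_derivative poly (pderiv q) 0) (at 0)"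
      by (simp add: q(2) o_def)
  qed
  ultimately show ?thesis by simp
qed

lemma markov_convex:
  assumes g: "all_moments g" and D: "convex D" and ball: "cball z \<rho> \<subseteq> D" and \<rho>: "0 < \<rho>" and w: "w \<in> D"
    and v: "norm v \<le> 1" and M: "\<And>x. x \<in> D \<Longrightarrow> cmod (fourier_poly m g x0 x) \<le> M"
  shows "cmod (fourier_poly (m - 1) (\<lambda>\<omega>. g \<omega> * (\<i> * of_real (\<omega> \<bullet> v))) x0 w) \<le> 2 * (real m)\<^sup>2 / \<rho> * M"
proof -
  let ?d = "\<lambda>u. fourier_poly (m - 1) (\<lambda>\<omega>. g \<omega> * (\<i> * of_real (\<omega> \<bullet> u))) x0 w"
  have b: "z + \<rho> *\<^sub>R v \<in> D" "z - \<rho> *\<^sub>R v \<in> D"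
    using ball \<rho> v by (auto simp: dist_norm subset_eq mult_left_le)
  \<comment> \<open>The vector 2 \<rho> v is the difference of the directions from \<open>w\<close>
    to two opposite points of the ball. Each direction costs 2 m^2 M, and dividing the sum by 2
    \<rho> gives the constant.\<close>
  have "of_real (2 * \<rho>) * ?d v = ?d ((2 * \<rho>) *\<^sub>R v)"
    by (rule fourier_poly_direction_linear(1)[OF g, symmetric])
  also have "(2 * \<rho>) *\<^sub>R v = ((z + \<rho> *\<^sub>R v) - w) - ((z - \<rho> *\<^sub>R v) - w)"
    by (simp add: algebra_simps flip: scaleR_2)
  also have "?d \<dots> = ?d ((z + \<rho> *\<^sub>R v) - w) - ?d ((z - \<rho> *\<^sub>R v) - w)"
    by (rule fourier_poly_direction_linear(2)[OF g])
  finally have "cmod (of_real (2 * \<rho>) * ?d v) \<le> cmod (?d ((z + \<rho> *\<^sub>R v) - w)) + cmod (?d ((z - \<rho> *\<^sub>R v) - w))"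
    by (simp only: norm_triangle_ineq4)
  also have "\<dots> \<le> 2 * (real m)\<^sup>2 * M + 2 * (real m)\<^sup>2 * M"
    by (intro add_mono markov_segment[OF g D w] b M)
  finally have "2 * \<rho> * cmod (?d v) \<le> 4 * (real m)\<^sup>2 * M" using \<rho> by (simp add: norm_mult)
  then show ?thesis using \<rho> by (simp add: field_simps)
qed

text \<open>The coordinate order is an arbitrary choice; listing every coordinate exactly once makes
  the exponents add up to the total order of the derivative.\<close>

lemma sum_list_coord_enum: "sum_list (map \<gamma> coord_enum) = sum \<gamma> (UNIV :: 'n::finite set)"
proof -
  obtain l where "distinct l \<and> set l = (UNIV :: 'n set)"
    using finite_distinct_list[of "UNIV :: 'n set"] by auto
  then have "distinct (coord_enum :: 'n list) \<and> set (coord_enum :: 'n list) = UNIV"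
    unfolding coord_enum_def by (rule someI)
  then show ?thesis by (simp add: sum_list_distinct_conv_sum_set)
qed

text \<open>Every derivative is again a \<open>fourier_poly\<close> of no larger order on the same
  convex set, so the same factor per derivative serves throughout. The invariant \<open>?P\<close>
  therefore leaves order and spectrum existential.\<close>

lemma markov_iterated:
  fixes D :: "(real ^ 'n) set"
  assumes g: "all_moments g" and D: "convex D" and ball: "cball z \<rho> \<subseteq> D" and \<rho>: "0 < \<rho>"
    and M: "\<And>x. x \<in> D \<Longrightarrow> cmod (fourier_poly m g x0 x) \<le> M"
  shows "x \<in> D \<Longrightarrow> cmod (mderiv \<gamma> (fourier_poly m g x0) x) \<le> (2 * (real m)\<^sup>2 / \<rho>) ^ sum \<gamma> UNIV * M"
proof -
  let ?B = "2 * (real m)\<^sup>2 / \<rho>"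
  let ?P = "\<lambda>f s. \<exists>k h. f = fourier_poly k h x0 \<and> k \<le> m \<and> all_moments h \<and> (\<forall>x\<in>D. cmod (f x) \<le> ?B ^ s * M)"
  have z: "z \<in> D" using ball \<rho> by auto
  have M0: "0 \<le> M" using M[OF z] norm_ge_zero order_trans by blast
  have step: "?P (partial_deriv i f) (Suc s)" if f: "?P f s" for f s i
  proof -
    from f obtain k h where h: "f = fourier_poly k h x0" "k \<le> m" "all_moments h"
      "\<And>x. x \<in> D \<Longrightarrow> cmod (fourier_poly k h x0 x) \<le> ?B ^ s * M" by auto
    have eq: "partial_deriv i f = fourier_poly (k - 1) (\<lambda>\<omega>. h \<omega> * (\<i> * of_real (\<omega> \<bullet> axis i 1))) x0"
      unfolding h(1) by (rule partial_deriv_fourier_poly[OF h(3)])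
    have "cmod (partial_deriv i f x) \<le> ?B ^ Suc s * M" if "x \<in> D" for x
    proof -
      have "cmod (partial_deriv i f x) \<le> 2 * (real k)\<^sup>2 / \<rho> * (?B ^ s * M)"
        unfolding eq by (rule markov_convex[OF h(3) D ball \<rho> that _ h(4)]) auto
      also have "\<dots> \<le> ?B * (?B ^ s * M)"
        using h(2) \<rho> M0 by (intro mult_right_mono divide_right_mono mult_left_mono power_mono) auto
      finally show ?thesis by simp
    qed
    then show ?thesis
      using h(2) all_moments_phase[OF h(3)]
      by (intro exI[of _ "k - 1"] exI[of _ "\<lambda>\<omega>. h \<omega> * (\<i> * of_real (\<omega> \<bullet> axis i 1))"]) (auto simp: eq)
  qed
  have iter: "?P ((partial_deriv i ^^ a) f) (s + a)" if "?P f s" for f s i a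
  proof (induction a)
    case (Suc a)
    from step[OF Suc, of i] show ?case by (simp only: funpow.simps o_def add_Suc_right)
  qed (use that in simp)
  have fold: "?P (foldr (\<lambda>i. partial_deriv i ^^ \<gamma> i) l (fourier_poly m g x0)) (sum_list (map \<gamma> l))" for l
  proof (induction l)
    case Nil
    show ?case using g M by auto
  next
    case (Cons i l)
    from iter[OF Cons, of "\<gamma> i" i] show ?case by (simp only: foldr.simps o_def list.map sum_list.Cons add.commute)
  qed
  note eq = sum_list_coord_enum[of \<gamma>]
  have "\<forall>x\<in>D. cmod (mderiv \<gamma> (fourier_poly m g x0) x) \<le> ?B ^ sum \<gamma> UNIV * M"
    using fold[of coord_enum] unfolding mderiv_def eq by (elim exE conjE) assumption
  then show "x \<in> D \<Longrightarrow> cmod (mderiv \<gamma> (fourier_poly m g x0) x) \<le> ?B ^ sum \<gamma> UNIV * M" by blast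
qed

text \<open>\<open>P\<close> is the symbol of the derivative, a product of factors i times a
  coordinate of \<omega>. It is the same for all orders and base points, so the derivatives of the
  function, its Taylor polynomial and its remainder have one common spectrum.\<close>

lemma mderiv_fourier_rem:
  fixes g :: "real ^ 'n \<Rightarrow> complex"
  assumes g: "all_moments g"
  shows "\<exists>P. P \<in> borel_measurable borel \<and> (\<forall>\<omega>. cmod (P \<omega>) \<le> norm \<omega> ^ sum \<gamma> UNIV) \<and>
    (\<forall>m x0. mderiv \<gamma> (fourier_rem m g x0) = fourier_rem (m - sum \<gamma> UNIV) (\<lambda>\<omega>. g \<omega> * P \<omega>) x0) \<and>
    (\<forall>m x0. mderiv \<gamma> (fourier_poly m g x0) = fourier_poly (m - sum \<gamma> UNIV) (\<lambda>\<omega>. g \<omega> * P \<omega>) x0)"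
proof -
  let ?Q = "\<lambda>F s. \<exists>P. P \<in> borel_measurable borel \<and> (\<forall>\<omega>. cmod (P \<omega>) \<le> norm \<omega> ^ s) \<and>
    (\<forall>m x0. F (fourier_rem m g x0) = fourier_rem (m - s) (\<lambda>\<omega>. g \<omega> * P \<omega>) x0) \<and>
    (\<forall>m x0. F (fourier_poly m g x0) = fourier_poly (m - s) (\<lambda>\<omega>. g \<omega> * P \<omega>) x0)"
  have step: "?Q (\<lambda>f. partial_deriv i (F f)) (Suc s)" if F: "?Q F s" for F s i
  proof -
    from F obtain P where P [measurable]: "P \<in> borel_measurable borel" and P2: "\<And>\<omega>. cmod (P \<omega>) \<le> norm \<omega> ^ s"
      and P3: "\<And>m x0. F (fourier_rem m g x0) = fourier_rem (m - s) (\<lambda>\<omega>. g \<omega> * P \<omega>) x0"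
      and P4: "\<And>m x0. F (fourier_poly m g x0) = fourier_poly (m - s) (\<lambda>\<omega>. g \<omega> * P \<omega>) x0" by auto
    have mom: "all_moments (\<lambda>\<omega>. g \<omega> * P \<omega>)" by (rule all_moments_mult[OF g P, of 1 s]) (use P2 in auto)
    let ?P' = "\<lambda>\<omega>::real^'n. P \<omega> * (\<i> * of_real (\<omega> \<bullet> axis i 1))"
    show ?thesis
    proof (intro exI[of _ ?P'] conjI allI)
      show "?P' \<in> borel_measurable borel" by measurable
      show "cmod (?P' \<omega>) \<le> norm \<omega> ^ Suc s" for \<omega>
        using mult_mono[OF P2[of \<omega>] norm_phase_le[of \<omega> "axis i 1"]] by (simp add: norm_mult mult.commute)
      show "partial_deriv i (F (fourier_rem m g x0)) = fourier_rem (m - Suc s) (\<lambda>\<omega>. g \<omega> * ?P' \<omega>) x0" for m x0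
        unfolding P3 partial_deriv_fourier_rem[OF mom] by (simp add: mult.assoc)
      show "partial_deriv i (F (fourier_poly m g x0)) = fourier_poly (m - Suc s) (\<lambda>\<omega>. g \<omega> * ?P' \<omega>) x0" for m x0
        unfolding P4 partial_deriv_fourier_poly[OF mom] by (simp add: mult.assoc)
    qed
  qed
  have iter: "?Q (\<lambda>f. (partial_deriv i ^^ a) (F f)) (s + a)" if "?Q F s" for F s i a
  proof (induction a)
    case (Suc a)
    from step[OF Suc, of i] show ?case by (simp only: funpow.simps o_def add_Suc_right)
  qed (use that in simp)
  have fold: "?Q (foldr (\<lambda>i. partial_deriv i ^^ \<gamma> i) l) (sum_list (map \<gamma> l))" for l
  proof (induction l)
    case Nil
    show ?case by (intro exI[of _ "\<lambda>_. 1"]) auto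
  next
    case (Cons i l)
    from iter[OF Cons, of "\<gamma> i" i] show ?case by (simp only: foldr.simps o_def list.map sum_list.Cons add.commute)
  qed
  note eq = sum_list_coord_enum[of \<gamma>]
  show ?thesis
    using fold[of coord_enum] unfolding mderiv_def eq .
qed

lemma fourier_poly_bounded:
  assumes g: "all_moments g" and D: "bounded D"
  obtains M where "\<And>x. x \<in> D \<Longrightarrow> cmod (fourier_poly m g x0 x) \<le> M"
proof -
  obtain R where R: "\<And>x. x \<in> D \<Longrightarrow> norm (x - x0) \<le> R"
    using D bounded_any_center[of D x0] by (auto simp: dist_norm norm_minus_commute)
  let ?I = "\<lambda>k. LINT \<omega>|lborel. cmod (g \<omega>) * norm \<omega> ^ k"
  have I: "0 \<le> ?I k" for k by (intro Bochner_Integration.integral_nonneg) auto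
  have b: "cmod (fourier_rem k g x0 x) \<le> R ^ k / fact k * ?I k" if "x \<in> D" for k x
    by (rule order_trans[OF norm_fourier_rem_le[OF g]])
      (intro mult_right_mono divide_right_mono power_mono R that I; simp)
  have "cmod (fourier_poly m g x0 x) \<le> R ^ 0 / fact 0 * ?I 0 + R ^ m / fact m * ?I m" if "x \<in> D" for x
    unfolding fourier_poly_def using norm_triangle_ineq4 add_mono[OF b[OF that] b[OF that]] by (rule order_trans)
  then show ?thesis using that by blast
qed

text \<open>An absorption argument: the values at a point and at a nearby datum differ by at most
  \<kappa> times the Markov bound, which is at most half the supremum, so the supremum satisfies M
  \<le> N + M / 2.\<close>

lemma norming_set:
  assumes g: "all_moments g" and D: "convex D" "bounded D" and ball: "cball z \<rho> \<subseteq> D" and \<rho>: "0 < \<rho>"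
    and Y: "Y \<subseteq> D" "\<And>x. x \<in> D \<Longrightarrow> \<exists>y\<in>Y. dist x y \<le> \<kappa>" and \<kappa>: "\<kappa> * (2 * (real m)\<^sup>2 / \<rho>) \<le> 1 / 2"
    and N: "\<And>y. y \<in> Y \<Longrightarrow> cmod (fourier_poly m g x0 y) \<le> N" and x: "x \<in> D"
  shows "cmod (fourier_poly m g x0 x) \<le> 2 * N"
proof -
  let ?p = "fourier_poly m g x0" and ?B = "2 * (real m)\<^sup>2 / \<rho>"
  define M where "M = (SUP x\<in>D. cmod (?p x))"
  have z: "z \<in> D" using ball \<rho> by auto
  \<comment> \<open>Absorbing M / 2 requires a finite supremum; this is where boundedness of
    \<open>D\<close> enters.\<close>
  have bdd: "bdd_above ((\<lambda>x. cmod (?p x)) ` D)"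
    using fourier_poly_bounded[OF g D(2), of m x0] by (metis bdd_aboveI2)
  have M: "cmod (?p x) \<le> M" if "x \<in> D" for x
    unfolding M_def using that bdd by (intro cSUP_upper)
  have M0: "0 \<le> M" using M[OF z] norm_ge_zero order_trans by blast
  have "cmod (?p x) \<le> N + M / 2" if x: "x \<in> D" for x
  proof -
    obtain y where y: "y \<in> Y" "dist x y \<le> \<kappa>" using Y(2)[OF x] by blast
    have yD: "y \<in> D" using y Y by auto
    have "norm (?p (y + 1 *\<^sub>R (x - y)) - ?p (y + 0 *\<^sub>R (x - y))) \<le> (dist x y * (?B * M)) * norm (1 - 0 :: real)"
    proof (rule differentiable_bound[of "{0..1::real}"])
      fix t :: real assume t: "t \<in> {0..1}"
      let ?d = "\<lambda>v. fourier_poly (m - 1) (\<lambda>\<omega>. g \<omega> * (\<i> * of_real (\<omega> \<bullet> v))) x0 (y + t *\<^sub>R (x - y))"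
      show "((\<lambda>t. ?p (y + t *\<^sub>R (x - y))) has_derivative (\<lambda>h. h *\<^sub>R ?d (x - y))) (at t within {0..1})"
        using fourier_poly_has_vector_derivative_at[OF g, of m x0 y "x - y" t]
        unfolding has_vector_derivative_def by (rule has_derivative_at_withinI)
      have "(1 - t) *\<^sub>R y + t *\<^sub>R x \<in> D" using convexD_alt[OF D(1) yD x] t by simp
      moreover have "(1 - t) *\<^sub>R y + t *\<^sub>R x = y + t *\<^sub>R (x - y)" by (simp add: algebra_simps)
      ultimately have w: "y + t *\<^sub>R (x - y) \<in> D" by simp
      have "?d (x - y) = of_real (norm (x - y)) * ?d (sgn (x - y))"
      proof -
        have "norm (x - y) *\<^sub>R sgn (x - y) = x - y" by (cases "x = y") (simp_all add: sgn_div_norm)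
        then show ?thesis
          using fourier_poly_direction_linear(1)[OF g, of "m - 1" "norm (x - y)" "sgn (x - y)"] by metis
      qed
      moreover have "cmod (?d (sgn (x - y))) \<le> ?B * M"
        by (rule markov_convex[OF g D(1) ball \<rho> w _ M]) (simp_all add: norm_sgn)
      ultimately have d: "cmod (?d (x - y)) \<le> dist x y * (?B * M)"
        using mult_left_mono[of "cmod (?d (sgn (x - y)))" "?B * M" "norm (x - y)"]
        by (simp only: norm_mult dist_norm norm_of_real abs_norm_cancel) simp
      show "onorm (\<lambda>h. h *\<^sub>R ?d (x - y)) \<le> dist x y * (?B * M)"
      proof (rule onorm_le)
        fix h :: real
        show "norm (h *\<^sub>R ?d (x - y)) \<le> dist x y * (?B * M) * norm h"
          using mult_right_mono[OF d norm_ge_zero[of h]] by (simp only: norm_scaleR mult.commute real_norm_def)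
      qed
    qed auto
    then have "norm (?p x - ?p y) \<le> dist x y * (?B * M)" by simp
    also have "\<dots> \<le> \<kappa> * (?B * M)" using y(2) \<rho> M0 by (intro mult_right_mono) auto
    also have "\<dots> = (\<kappa> * ?B) * M" by simp
    also have "\<dots> \<le> 1 / 2 * M" using \<kappa> M0 by (rule mult_right_mono)
    finally show ?thesis using N[OF y(1)] norm_triangle_sub[of "?p x" "?p y"] by simp
  qed
  then have "M \<le> N + M / 2" unfolding M_def using z by (intro cSUP_least) auto
  then show ?thesis using M[OF x] by simp
qed

section \<open>Density of the data in convex subsets\<close>

lemma fill_distance_attained:
  assumes X: "finite X" "X \<noteq> {}" and h: "ereal h = fill_distance X S" and x: "x \<in> S"
  obtains y where "y \<in> X" "dist x y \<le> h"
proof -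
  have "(INF y\<in>X. ereal (dist x y)) \<in> (\<lambda>y. ereal (dist x y)) ` X"
    using X by (subst Min_Inf[symmetric]) (auto intro!: Min_in)
  then obtain y where y: "y \<in> X" "(INF y\<in>X. ereal (dist x y)) = ereal (dist x y)" by auto
  have "(INF y\<in>X. ereal (dist x y)) \<le> fill_distance X S"
    unfolding fill_distance_def using x by (rule SUP_upper)
  then have "dist x y \<le> h" unfolding h[symmetric] y(2) by simp
  with y show ?thesis using that by blast
qed

text \<open>Moving \<open>x\<close> towards the centre of the ball by the fraction \<open>h / \<rho>\<close> makes room for a ball of radius \<open>h\<close> inside \<open>D\<close>,
  so the fill distance with respect to the larger set \<open>S\<close> already produces a data point in \<open>D\<close>.\<close>

lemma data_dense_in_convex:
  assumes X: "finite X" "X \<noteq> {}" and h: "ereal h = fill_distance X S" "0 < h" "h \<le> \<rho>"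
    and D: "convex D" "D \<subseteq> S" "cball z \<rho> \<subseteq> D" and R: "D \<subseteq> cball z R" and x: "x \<in> D"
  shows "\<exists>y\<in>X \<inter> D. dist x y \<le> h * (R / \<rho> + 1)"
proof -
  have \<rho>: "0 < \<rho>" using h by simp
  define s where "s = h / \<rho>"
  have s: "0 < s" "s \<le> 1" "s * \<rho> = h" using h \<rho> by (auto simp: s_def)
  define x' where "x' = x + s *\<^sub>R (z - x)"
  have zD: "z \<in> D" using D \<rho> by auto
  have "(1 - s) *\<^sub>R x + s *\<^sub>R z \<in> D" using convexD_alt[OF D(1) x zD, of s] s by simp
  then have "x' \<in> S" using D(2) by (auto simp: x'_def algebra_simps)
  then obtain y where y: "y \<in> X" "dist x' y \<le> h" using fill_distance_attained[OF X h(1)] by blast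
  \<comment> \<open>The contraction w -> (1 - s) x + s w maps \<open>z\<close> to \<open>x'\<close>
    and shrinks lengths by s = h / \<rho>. Here \<open>b\<close> is the preimage of
    \<open>y\<close>, so its distance to \<open>z\<close> is at most \<rho>.\<close>
  define b where "b = z + (1 / s) *\<^sub>R (y - x')"
  have "dist z b \<le> \<rho>" 
  proof -
    have "dist z b = dist x' y / s" using s by (simp add: b_def dist_norm norm_minus_commute[of y])
    also have "\<dots> \<le> h / s" using y(2) s by (intro divide_right_mono) auto
    also have "h / s = \<rho>" using s by (simp flip: s(3))
    finally show ?thesis .
  qed
  then have "b \<in> D" using D(3) by auto
  then have "(1 - s) *\<^sub>R x + s *\<^sub>R b \<in> D" using convexD_alt[OF D(1) x, of b s] s by simp
  moreover have "(1 - s) *\<^sub>R x + s *\<^sub>R b = y"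
    using s by (simp add: b_def x'_def algebra_simps)
  ultimately have "y \<in> D" by simp
  moreover have "dist x y \<le> h * (R / \<rho> + 1)"
  proof -
    have "dist x x' = s * dist x z" using s by (simp add: x'_def dist_norm norm_minus_commute)
    also have "\<dots> \<le> s * R" using R x s by (intro mult_left_mono) (auto simp: dist_commute)
    finally have "dist x x' \<le> s * R" .
    with y(2) have "dist x y \<le> s * R + h" using dist_triangle[of x y x'] by linarith
    also have "\<dots> = h * (R / \<rho> + 1)" by (simp add: s_def algebra_simps)
    finally show ?thesis .
  qed
  ultimately show ?thesis using y(1) by auto
qed

section \<open>Native spaces\<close>

text \<open>A single term of the exponential series. It serves for Gaussian moments and, with y = k,
  as the Stirling-type bound k^k e^(-k) \<le> k!.\<close>

lemma power_le_fact_exp: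
  fixes y :: real
  assumes "0 \<le> y"
  shows "y ^ k \<le> fact k * exp y"
proof -
  have s: "(\<lambda>n. y ^ n / fact n) sums exp y"
    using exp_converges[of y] by (simp add: divide_inverse mult.commute)
  have "y ^ k / fact k \<le> exp y"
    using sum_le_suminf[OF sums_summable[OF s], of "{k}"] assms by (simp add: sums_unique[OF s, symmetric])
  then show ?thesis by (simp add: field_simps)
qed

lemma ennreal_power2_le_imp_le:
  assumes le: "x\<^sup>2 \<le> (ennreal r)\<^sup>2" and r: "0 \<le> r"
  shows "x \<le> ennreal r"
proof (cases x)
  case (real s)
  with le r have "s\<^sup>2 \<le> r\<^sup>2" by (simp add: ennreal_power)
  then have "s \<le> r" using r by (rule power2_le_imp_le)
  then show ?thesis unfolding real by (rule ennreal_leI)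
next
  case top
  then have "x\<^sup>2 = \<infinity>" by (simp add: power2_eq_square)
  with le r show ?thesis by (simp add: ennreal_power top_unique)
qed

text \<open>The Gaussian integral that remains in \<open>native_moment\<close> after half of the
  decay has absorbed the power of the frequency.\<close>

definition spectral_mass :: "'a::euclidean_space itself \<Rightarrow> real \<Rightarrow> real" where
  "spectral_mass _ \<delta> = (LINT \<omega>::'a|lborel. exp (- (1 / (8 * \<delta>\<^sup>2) * (norm \<omega>)\<^sup>2)))"

lemma native_norm_sq:
  "(native_norm \<delta> f)\<^sup>2 = (LINT \<omega>|lborel. (cmod (fourier f \<omega>))\<^sup>2 * native_weight \<delta> \<omega>)"
  unfolding native_norm_def by (intro real_sqrt_pow2 Bochner_Integration.integral_nonneg) (simp add: native_weight_def)

lemma native_norm_nonneg: "0 \<le> native_norm \<delta> f"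
  unfolding native_norm_def by (intro real_sqrt_ge_zero Bochner_Integration.integral_nonneg) (simp add: native_weight_def)

text \<open>Cauchy-Schwarz after inserting 1 = exp (e) exp (-e) with e = |\<omega>|^2 / (8
  \<delta>^2). The square of the first factor is the native weight; the second carries the power and
  produces the square root of k!, the growth on which the error estimate rests.\<close>

lemma native_moment:
  fixes f :: "real ^ 'n \<Rightarrow> complex"
  assumes f: "f \<in> native_space \<delta>" and \<delta>: "0 < \<delta>"
  shows "integrable lborel (\<lambda>\<omega>. cmod (fourier f \<omega>) * norm \<omega> ^ k)"
    and "(LINT \<omega>|lborel. cmod (fourier f \<omega>) * norm \<omega> ^ k) \<le> native_norm \<delta> f * sqrt ((8 * \<delta>\<^sup>2) ^ k * fact k * spectral_mass TYPE(real^'n) \<delta>)"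
proof -
  have m [measurable]: "fourier f \<in> borel_measurable borel"
    using f by (simp add: native_space_def is_fourier_def square_integrable_def)
  have int: "integrable lborel (\<lambda>\<omega>. (cmod (fourier f \<omega>))\<^sup>2 * native_weight \<delta> \<omega>)"
    using f by (simp add: native_space_def)
  let ?e = "\<lambda>\<omega>::real^'n. (norm \<omega>)\<^sup>2 / (8 * \<delta>\<^sup>2)"
  let ?a = "\<lambda>\<omega>. cmod (fourier f \<omega>) * exp (?e \<omega>)" and ?b = "\<lambda>\<omega>. norm \<omega> ^ k * exp (- ?e \<omega>)"
  let ?I0 = "spectral_mass TYPE(real^'n) \<delta>"
  let ?K = "(8 * \<delta>\<^sup>2) ^ k * fact k * ?I0"
  have I0: "0 \<le> ?I0" unfolding spectral_mass_def by (intro Bochner_Integration.integral_nonneg) simp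
  have i0: "integrable lborel (\<lambda>\<omega>::real^'n. exp (- (1 / (8 * \<delta>\<^sup>2) * (norm \<omega>)\<^sup>2)))"
    using \<delta> by (intro gaussian_integral) simp
  have A: "(\<integral>\<^sup>+\<omega>. (ennreal (?a \<omega>))\<^sup>2 \<partial>lborel) = ennreal ((native_norm \<delta> f)\<^sup>2)"
  proof -
    have "(\<integral>\<^sup>+\<omega>. (ennreal (?a \<omega>))\<^sup>2 \<partial>lborel) = (\<integral>\<^sup>+\<omega>. ennreal ((cmod (fourier f \<omega>))\<^sup>2 * native_weight \<delta> \<omega>) \<partial>lborel)"
      by (intro nn_integral_cong) (simp add: ennreal_power power_mult_distrib native_weight_def flip: exp_double)
    also have "\<dots> = ennreal ((native_norm \<delta> f)\<^sup>2)"
      unfolding native_norm_sq by (rule nn_integral_eq_integral[OF int]) (simp add: native_weight_def)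
    finally show ?thesis .
  qed
  have B: "(\<integral>\<^sup>+\<omega>. (ennreal (?b \<omega>))\<^sup>2 \<partial>lborel) \<le> ennreal ?K"
  proof -
    have "(\<integral>\<^sup>+\<omega>. (ennreal (?b \<omega>))\<^sup>2 \<partial>lborel) \<le> (\<integral>\<^sup>+\<omega>. ennreal ((8 * \<delta>\<^sup>2) ^ k * fact k * exp (- (1 / (8 * \<delta>\<^sup>2) * (norm \<omega>)\<^sup>2))) \<partial>(lborel :: (real^'n) measure))"
    proof (intro nn_integral_mono)
      fix \<omega> :: "real^'n"
      have "(norm \<omega>)\<^sup>2 = 8 * \<delta>\<^sup>2 * ?e \<omega>" using \<delta> by simp
      then have "(norm \<omega> ^ k)\<^sup>2 = (8 * \<delta>\<^sup>2) ^ k * ?e \<omega> ^ k" by (metis power_commutes power_mult power_mult_distrib mult.commute)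
      also have "\<dots> \<le> (8 * \<delta>\<^sup>2) ^ k * (fact k * exp (?e \<omega>))"
        by (intro mult_left_mono power_le_fact_exp) auto
      finally have "(norm \<omega> ^ k)\<^sup>2 * (exp (- ?e \<omega>))\<^sup>2 \<le> (8 * \<delta>\<^sup>2) ^ k * (fact k * exp (?e \<omega>)) * (exp (- ?e \<omega>))\<^sup>2"
        by (rule mult_right_mono) simp
      also have "\<dots> = (8 * \<delta>\<^sup>2) ^ k * fact k * exp (- (1 / (8 * \<delta>\<^sup>2) * (norm \<omega>)\<^sup>2))"
        by (simp add: power2_eq_square flip: exp_add)
      finally show "(ennreal (?b \<omega>))\<^sup>2 \<le> ennreal ((8 * \<delta>\<^sup>2) ^ k * fact k * exp (- (1 / (8 * \<delta>\<^sup>2) * (norm \<omega>)\<^sup>2)))"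
        by (simp add: ennreal_power power_mult_distrib ennreal_leI)
    qed
    also have "\<dots> = ennreal (LINT \<omega>::real^'n|lborel. (8 * \<delta>\<^sup>2) ^ k * fact k * exp (- (1 / (8 * \<delta>\<^sup>2) * (norm \<omega>)\<^sup>2)))"
      by (intro nn_integral_eq_integral integrable_mult_right i0) auto
    also have "\<dots> = ennreal ?K" unfolding integral_mult_right_zero spectral_mass_def ..
    finally show ?thesis .
  qed
  have eq: "ennreal (cmod (fourier f \<omega>) * norm \<omega> ^ k) = ennreal (?a \<omega>) * ennreal (?b \<omega>)" for \<omega>
    by (simp add: ennreal_mult[symmetric] exp_minus)
  have K0: "0 \<le> ?K" using I0 by simp
  have "(\<integral>\<^sup>+\<omega>. ennreal (cmod (fourier f \<omega>) * norm \<omega> ^ k) \<partial>lborel)\<^sup>2 \<le> (\<integral>\<^sup>+\<omega>. (ennreal (?a \<omega>))\<^sup>2 \<partial>lborel) * (\<integral>\<^sup>+\<omega>. (ennreal (?b \<omega>))\<^sup>2 \<partial>lborel)"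
    unfolding eq by (rule Cauchy_Schwarz_nn_integral) measurable
  also have "\<dots> \<le> ennreal ((native_norm \<delta> f)\<^sup>2) * ennreal ?K"
    unfolding A using B by (intro mult_left_mono) auto
  also have "\<dots> = (ennreal (native_norm \<delta> f * sqrt ?K))\<^sup>2"
    using K0 native_norm_nonneg[of \<delta> f] by (simp add: ennreal_power power_mult_distrib ennreal_mult)
  finally have le: "(\<integral>\<^sup>+\<omega>. ennreal (cmod (fourier f \<omega>) * norm \<omega> ^ k) \<partial>lborel) \<le> ennreal (native_norm \<delta> f * sqrt ?K)"
    by (rule ennreal_power2_le_imp_le) (use K0 native_norm_nonneg[of \<delta> f] in simp)
  show i: "integrable lborel (\<lambda>\<omega>. cmod (fourier f \<omega>) * norm \<omega> ^ k)"
    by (rule integrableI_bounded, measurable)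
      (use le in \<open>simp add: order_le_less_trans[OF _ ennreal_less_top]\<close>)
  have "ennreal (LINT \<omega>|lborel. cmod (fourier f \<omega>) * norm \<omega> ^ k) \<le> ennreal (native_norm \<delta> f * sqrt ?K)"
    using le by (subst nn_integral_eq_integral[OF i, symmetric]) auto
  then show "(LINT \<omega>|lborel. cmod (fourier f \<omega>) * norm \<omega> ^ k) \<le> native_norm \<delta> f * sqrt ?K"
    using K0 native_norm_nonneg[of \<delta> f] by (subst (asm) ennreal_le_iff) auto
qed

lemma native_all_moments:
  assumes "f \<in> native_space \<delta>" "0 < \<delta>"
  shows "all_moments (fourier f)"
  unfolding all_moments_def
  using native_moment(1)[OF assms] assms(1) by (simp add: native_space_def is_fourier_def square_integrable_def)

text \<open>The phase recentres the Fourier integral at \<open>x0\<close>, the base point of the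
  Taylor expansion. The spectra are subtracted rather than the functions, because
  \<open>fourier\<close> is a choice and linear only up to null sets.\<close>

definition diff_spectrum :: "(real ^ 'n \<Rightarrow> complex) \<Rightarrow> (real ^ 'n \<Rightarrow> complex) \<Rightarrow> real ^ 'n \<Rightarrow> real ^ 'n \<Rightarrow> complex" where
  "diff_spectrum f1 f2 x0 \<omega> = (fourier f1 \<omega> - fourier f2 \<omega>) * (of_real (fourier_const TYPE('n)) * cis (x0 \<bullet> \<omega>))"

lemma norm_diff_spectrum:
  fixes f1 f2 :: "real ^ 'n \<Rightarrow> complex"
  shows "cmod (diff_spectrum f1 f2 x0 \<omega>) = fourier_const TYPE('n) * cmod (fourier f1 \<omega> - fourier f2 \<omega>)"
  using fourier_const_pos[where 'n='n] by (simp add: diff_spectrum_def norm_mult)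

lemma diff_spectrum:
  fixes f1 f2 :: "real ^ 'n \<Rightarrow> complex"
  assumes f1: "f1 \<in> native_space \<delta>" and f2: "f2 \<in> native_space \<delta>" and \<delta>: "0 < \<delta>"
  shows "all_moments (diff_spectrum f1 f2 x0)" (is ?thesis1)
    and "f1 x - f2 x = fourier_rem 0 (diff_spectrum f1 f2 x0) x0 x" (is ?thesis2)
    and "(LINT \<omega>|lborel. cmod (diff_spectrum f1 f2 x0 \<omega>) * norm \<omega> ^ k) \<le>
      fourier_const TYPE('n) * (native_norm \<delta> f1 + native_norm \<delta> f2) * sqrt ((8 * \<delta>\<^sup>2) ^ k * fact k * spectral_mass TYPE(real^'n) \<delta>)" (is ?thesis3)
proof -
  let ?c = "fourier_const TYPE('n)"
  have am: "all_moments (fourier f1)" "all_moments (fourier f2)"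
    using native_all_moments f1 f2 \<delta> by auto
  have [measurable]: "fourier f1 \<in> borel_measurable borel" "fourier f2 \<in> borel_measurable borel"
    using am by (auto intro: all_moments_measurable)
  have cm: "(\<lambda>\<omega>. of_real ?c * cis (x0 \<bullet> \<omega>)) \<in> borel_measurable borel" unfolding cis_conv_exp by measurable
  show m: ?thesis1
    unfolding diff_spectrum_def[abs_def]
    by (rule all_moments_mult[OF all_moments_diff[OF am] cm, of "?c" 0])
      (use fourier_const_pos[where 'n='n] in \<open>simp add: norm_mult\<close>)
  have inv: "f x = of_real ?c * (LINT \<omega>|lborel. fourier f \<omega> * cis (x \<bullet> \<omega>))" if f: "f \<in> native_space \<delta>" for f
  proof (rule fourier_inversion)
    show "integrable lborel (fourier f)"
    proof -
      have "integrable lborel (\<lambda>\<omega>. cmod (fourier f \<omega>))" using native_moment(1)[OF f \<delta>, of 0] by simp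
      moreover have "fourier f \<in> borel_measurable lborel"
        using all_moments_measurable[OF native_all_moments[OF f \<delta>]] by simp
      ultimately show ?thesis by (subst (asm) integrable_norm_iff)
    qed
  qed (use f in \<open>auto simp: native_space_def square_integrable_def\<close>)
  have ii: "integrable lborel (\<lambda>\<omega>. fourier f \<omega> * cis (x \<bullet> \<omega>))" if f: "f \<in> native_space \<delta>" for f
    by (rule all_moments_integrable_mult[OF native_all_moments[OF f \<delta>], of _ 1 0])
      (simp_all add: cis_conv_exp)
  have "f1 x - f2 x = of_real ?c * (LINT \<omega>|lborel. fourier f1 \<omega> * cis (x \<bullet> \<omega>) - fourier f2 \<omega> * cis (x \<bullet> \<omega>))"
    unfolding inv[OF f1] inv[OF f2] Bochner_Integration.integral_diff[OF ii[OF f1] ii[OF f2]] by (simp only: right_diff_distrib)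
  also have "\<dots> = fourier_rem 0 (diff_spectrum f1 f2 x0) x0 x"
    unfolding fourier_rem_def integral_mult_right_zero[symmetric]
  proof (intro Bochner_Integration.integral_cong refl)
    fix \<omega> :: "real^'n"
    have "x0 \<bullet> \<omega> + \<omega> \<bullet> (x - x0) = x \<bullet> \<omega>" by (simp add: inner_diff_right inner_commute)
    then have c: "cis (x \<bullet> \<omega>) = cis (x0 \<bullet> \<omega>) * taylor_rem 0 (\<omega> \<bullet> (x - x0))" by (simp add: cis_mult)
    show "of_real ?c * (fourier f1 \<omega> * cis (x \<bullet> \<omega>) - fourier f2 \<omega> * cis (x \<bullet> \<omega>)) = diff_spectrum f1 f2 x0 \<omega> * taylor_rem 0 (\<omega> \<bullet> (x - x0))"
      unfolding diff_spectrum_def c by (simp only: left_diff_distrib right_diff_distrib mult_ac)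
  qed
  finally show ?thesis2 .
  let ?S = "sqrt ((8 * \<delta>\<^sup>2) ^ k * fact k * spectral_mass TYPE(real^'n) \<delta>)"
  note i1 = native_moment(1)[OF f1 \<delta>, of k] and i2 = native_moment(1)[OF f2 \<delta>, of k]
  have "(LINT \<omega>|lborel. cmod (diff_spectrum f1 f2 x0 \<omega>) * norm \<omega> ^ k) \<le>
      (LINT \<omega>|lborel. ?c * (cmod (fourier f1 \<omega>) * norm \<omega> ^ k + cmod (fourier f2 \<omega>) * norm \<omega> ^ k))"
  proof (rule integral_mono)
    show "integrable lborel (\<lambda>\<omega>. cmod (diff_spectrum f1 f2 x0 \<omega>) * norm \<omega> ^ k)"
      using m by (simp add: all_moments_def)
    show "integrable lborel (\<lambda>\<omega>. ?c * (cmod (fourier f1 \<omega>) * norm \<omega> ^ k + cmod (fourier f2 \<omega>) * norm \<omega> ^ k))"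
      by (intro integrable_mult_right Bochner_Integration.integrable_add i1 i2)
    fix \<omega>
    have "cmod (fourier f1 \<omega> - fourier f2 \<omega>) * norm \<omega> ^ k \<le> (cmod (fourier f1 \<omega>) + cmod (fourier f2 \<omega>)) * norm \<omega> ^ k"
      by (intro mult_right_mono norm_triangle_ineq4) auto
    from mult_left_mono[OF this, of ?c]
    show "cmod (diff_spectrum f1 f2 x0 \<omega>) * norm \<omega> ^ k \<le> ?c * (cmod (fourier f1 \<omega>) * norm \<omega> ^ k + cmod (fourier f2 \<omega>) * norm \<omega> ^ k)"
      using fourier_const_pos[where 'n='n] by (simp add: norm_diff_spectrum distrib_right mult.assoc)
  qed
  also have "\<dots> = ?c * ((LINT \<omega>|lborel. cmod (fourier f1 \<omega>) * norm \<omega> ^ k) + (LINT \<omega>|lborel. cmod (fourier f2 \<omega>) * norm \<omega> ^ k))"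
    using Bochner_Integration.integral_add[OF i1 i2] by (simp only: integral_mult_right_zero)
  also have "\<dots> \<le> ?c * (native_norm \<delta> f1 * ?S + native_norm \<delta> f2 * ?S)"
    using fourier_const_pos[where 'n='n] by (intro mult_left_mono add_mono native_moment(2) f1 f2 \<delta>) auto
  also have "\<dots> = ?c * (native_norm \<delta> f1 + native_norm \<delta> f2) * ?S" by (simp add: algebra_simps)
  finally show ?thesis3 .
qed

text \<open>Vanishing on an open set passes to directional derivatives; the induction also carries
  \<open>all_moments\<close>, which each differentiation requires.\<close>

lemma fourier_rem_vanish_derivatives:
  fixes g :: "'a::euclidean_space \<Rightarrow> complex"
  assumes U: "open U" and g: "all_moments g" and vanish: "\<And>x. x \<in> U \<Longrightarrow> fourier_rem 0 g x0 x = 0"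
  shows "all_moments (\<lambda>\<omega>. g \<omega> * (\<i> * of_real (\<omega> \<bullet> v)) ^ j) \<and>
    (\<forall>x\<in>U. fourier_rem 0 (\<lambda>\<omega>. g \<omega> * (\<i> * of_real (\<omega> \<bullet> v)) ^ j) x0 x = 0)"
proof (induction j)
  case 0
  then show ?case using g vanish by simp
next
  case (Suc j)
  let ?g = "\<lambda>\<omega>. g \<omega> * (\<i> * of_real (\<omega> \<bullet> v)) ^ j"
  have am: "all_moments ?g" and z: "\<And>x. x \<in> U \<Longrightarrow> fourier_rem 0 ?g x0 x = 0" using Suc by auto
  have eq: "(\<lambda>\<omega>. g \<omega> * (\<i> * of_real (\<omega> \<bullet> v)) ^ Suc j) = (\<lambda>\<omega>. ?g \<omega> * (\<i> * of_real (\<omega> \<bullet> v)))"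
    by (simp add: fun_eq_iff mult_ac)
  have "fourier_rem 0 (\<lambda>\<omega>. ?g \<omega> * (\<i> * of_real (\<omega> \<bullet> v))) x0 x = 0" if x: "x \<in> U" for x
  proof -
    have "((\<lambda>t. x + t *\<^sub>R v) \<longlongrightarrow> x + 0 *\<^sub>R v) (at 0)" by (intro tendsto_intros)
    then have ev: "eventually (\<lambda>t. x + t *\<^sub>R v \<in> U) (at 0)"
      using topological_tendstoD[OF _ U] x by fastforce
    have d: "((\<lambda>t. fourier_rem 0 ?g x0 (x + t *\<^sub>R v)) has_vector_derivative
        fourier_rem 0 (\<lambda>\<omega>. ?g \<omega> * (\<i> * of_real (\<omega> \<bullet> v))) x0 x) (at 0)"
      using fourier_rem_has_vector_derivative[OF am, of 0 x0 x v] by simp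
    have "((\<lambda>t. (fourier_rem 0 ?g x0 (x + t *\<^sub>R v) - fourier_rem 0 ?g x0 (x + 0 *\<^sub>R v)) /\<^sub>R t) \<longlongrightarrow> 0) (at 0)"
      by (rule Lim_transform_eventually[OF tendsto_const])
        (use ev x in \<open>auto elim!: eventually_mono simp: z\<close>)
    moreover from d have "((\<lambda>t. (fourier_rem 0 ?g x0 (x + t *\<^sub>R v) - fourier_rem 0 ?g x0 (x + 0 *\<^sub>R v)) /\<^sub>R t) \<longlongrightarrow>
        fourier_rem 0 (\<lambda>\<omega>. ?g \<omega> * (\<i> * of_real (\<omega> \<bullet> v))) x0 x) (at 0)"
      unfolding has_vector_derivative_at_0_iff .
    ultimately show ?thesis using LIM_unique by blast
  qed
  with all_moments_phase[OF am] show ?case unfolding eq by blast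
qed

text \<open>At a point of \<open>U\<close> every Taylor coefficient in direction
  \<open>x - x0\<close> vanishes, so the difference equals its remainder of every order. The bound
  a^m / sqrt (m!) tends to 0 for every a, so a single expansion reaches every
  \<open>x\<close>.\<close>

lemma native_unique_continuation:
  fixes f1 f2 :: "real ^ 'n \<Rightarrow> complex"
  assumes f1: "f1 \<in> native_space \<delta>" and f2: "f2 \<in> native_space \<delta>" and \<delta>: "0 < \<delta>"
    and U: "open U" "U \<noteq> {}" and eq: "\<And>x. x \<in> U \<Longrightarrow> f1 x = f2 x"
  shows "f1 = f2"
proof
  fix x
  obtain x0 where x0: "x0 \<in> U" using U by auto
  let ?g = "diff_spectrum f1 f2 x0" and ?v = "x - x0"
  have ds1: "all_moments ?g" by (rule diff_spectrum[OF f1 f2 \<delta>])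
  have ds2: "f1 y - f2 y = fourier_rem 0 ?g x0 y" for y by (rule diff_spectrum[OF f1 f2 \<delta>])
  have van: "fourier_rem 0 ?g x0 y = 0" if "y \<in> U" for y
    using eq[OF that] ds2[of y] by simp
  note der = fourier_rem_vanish_derivatives[OF U(1) ds1 van]
  have coeff: "(LINT \<omega>|lborel. ?g \<omega> * (\<i> * of_real (\<omega> \<bullet> ?v)) ^ j) = 0" for j
    using der[of ?v j] x0 by (auto simp: fourier_rem_def)
  have poly0: "fourier_poly m ?g x0 x = 0" for m
  proof -
    have i: "integrable lborel (\<lambda>\<omega>. ?g \<omega> * (\<i> * of_real (\<omega> \<bullet> ?v)) ^ j)" for j
      using fourier_rem_integrable[OF conjunct1[OF der[of ?v j]], of 0 0] by simp
    have "fourier_poly m ?g x0 x = (LINT \<omega>|lborel. (\<Sum>j<m. (?g \<omega> * (\<i> * of_real (\<omega> \<bullet> ?v)) ^ j) / fact j))"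
      unfolding fourier_poly_eq_integral[OF ds1]
      by (intro Bochner_Integration.integral_cong refl) (simp add: sum_distrib_left)
    also have "\<dots> = (\<Sum>j<m. LINT \<omega>|lborel. (?g \<omega> * (\<i> * of_real (\<omega> \<bullet> ?v)) ^ j) / fact j)"
      by (intro Bochner_Integration.integral_sum integrable_divide i)
    also have "\<dots> = 0" by (simp only: integral_divide_zero coeff) simp
    finally show ?thesis .
  qed
  let ?A = "fourier_const TYPE('n) * (native_norm \<delta> f1 + native_norm \<delta> f2) * sqrt (spectral_mass TYPE(real^'n) \<delta>)"
  have bound: "cmod (f1 x - f2 x) \<le> ?A * ((norm ?v * sqrt (8 * \<delta>\<^sup>2)) ^ m / sqrt (fact m))" for m
  proof -
    have "f1 x - f2 x = fourier_rem m ?g x0 x"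
      using poly0[of m] ds2[of x] by (simp add: fourier_poly_def)
    then have "cmod (f1 x - f2 x) \<le> norm ?v ^ m / fact m * (LINT \<omega>|lborel. cmod (?g \<omega>) * norm \<omega> ^ m)"
      using norm_fourier_rem_le[OF ds1] by simp
    also have "\<dots> \<le> norm ?v ^ m / fact m * (fourier_const TYPE('n) * (native_norm \<delta> f1 + native_norm \<delta> f2) * sqrt ((8 * \<delta>\<^sup>2) ^ m * fact m * spectral_mass TYPE(real^'n) \<delta>))"
      by (intro mult_left_mono diff_spectrum(3)[OF f1 f2 \<delta>]) auto
    also have "\<dots> = ?A * ((norm ?v * sqrt (8 * \<delta>\<^sup>2)) ^ m * (sqrt (fact m) / fact m))"
      by (simp add: real_sqrt_mult real_sqrt_power power_mult_distrib)
    also have "sqrt (fact m) / fact m = 1 / sqrt (fact m :: real)"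
      by (simp add: field_simps)
    finally show ?thesis by simp
  qed
  \<comment> \<open>The squares are the terms of the exponential series at a^2.\<close>
  have "(\<lambda>m. a ^ m / sqrt (fact m)) \<longlonglongrightarrow> 0" if a: "0 \<le> a" for a :: real
  proof -
    have "(\<lambda>m. (a\<^sup>2) ^ m /\<^sub>R fact m) \<longlonglongrightarrow> 0"
      by (rule summable_LIMSEQ_zero[OF summable_exp_generic])
    from tendsto_real_sqrt[OF this]
    have "(\<lambda>m. sqrt ((a\<^sup>2) ^ m /\<^sub>R fact m)) \<longlonglongrightarrow> 0" by simp
    moreover have "sqrt ((a\<^sup>2) ^ m /\<^sub>R fact m) = a ^ m / sqrt (fact m)" for m
      using a by (simp add: real_sqrt_power real_sqrt_mult real_sqrt_inverse divide_inverse)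
    ultimately show ?thesis by simp
  qed
  then have "(\<lambda>m. (norm ?v * sqrt (8 * \<delta>\<^sup>2)) ^ m / sqrt (fact m)) \<longlonglongrightarrow> 0" by simp
  from tendsto_mult_left[OF this, of ?A]
  have lim: "(\<lambda>m. ?A * ((norm ?v * sqrt (8 * \<delta>\<^sup>2)) ^ m / sqrt (fact m))) \<longlonglongrightarrow> 0" by simp
  have "cmod (f1 x - f2 x) \<le> 0"
    by (rule tendsto_lowerbound[OF lim _ sequentially_bot]) (intro always_eventually allI bound)
  then show "f1 x = f2 x" by simp
qed

text \<open>\<open>is_fourier_L1_fourier\<close> shows that the choice in \<open>fourier\<close> has
  a candidate, and \<open>is_fourier_unique\<close> identifies the result almost everywhere; norms
  can then be computed from the explicit transform.\<close>

lemma native_spaceI: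
  fixes f :: "real ^ 'n \<Rightarrow> complex"
  assumes cont: "continuous_on UNIV f" and f1: "integrable lborel f" and f2: "integrable lborel (\<lambda>x. (cmod (f x))\<^sup>2)"
    and w: "integrable lborel (\<lambda>\<omega>. (cmod (L1_fourier f \<omega>))\<^sup>2 * native_weight \<delta> \<omega>)"
  shows "f \<in> native_space \<delta>"
    and "native_norm \<delta> f = sqrt (LINT \<omega>|lborel. (cmod (L1_fourier f \<omega>))\<^sup>2 * native_weight \<delta> \<omega>)"
    and "AE \<omega> in lborel. fourier f \<omega> = L1_fourier f \<omega>"
proof -
  have m [measurable]: "f \<in> borel_measurable borel" using cont by (rule borel_measurable_continuous_onI)
  have wm [measurable]: "native_weight \<delta> \<in> borel_measurable (borel :: (real^'n) measure)" unfolding native_weight_def by measurable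
  have L1: "is_fourier f (L1_fourier f)" by (rule is_fourier_L1_fourier[OF f1 f2])
  then have F: "is_fourier f (fourier f)" unfolding fourier_def by (rule someI[of "is_fourier f"])
  have Fm [measurable]: "fourier f \<in> borel_measurable borel" using F by (simp add: is_fourier_def square_integrable_def)
  show AE: "AE \<omega> in lborel. fourier f \<omega> = L1_fourier f \<omega>" by (rule is_fourier_unique[OF m F L1])
  have AE2: "AE \<omega> in lborel. (cmod (fourier f \<omega>))\<^sup>2 * native_weight \<delta> \<omega> = (cmod (L1_fourier f \<omega>))\<^sup>2 * native_weight \<delta> \<omega>"
    using AE by eventually_elim simp
  have "integrable lborel (\<lambda>\<omega>. (cmod (fourier f \<omega>))\<^sup>2 * native_weight \<delta> \<omega>) \<longleftrightarrow> integrable lborel (\<lambda>\<omega>. (cmod (L1_fourier f \<omega>))\<^sup>2 * native_weight \<delta> \<omega>)"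
    by (rule integrable_cong_AE[OF _ _ AE2]) measurable
  with w show "f \<in> native_space \<delta>"
    using cont f2 F m by (simp add: native_space_def square_integrable_def)
  have "(LINT \<omega>|lborel. (cmod (fourier f \<omega>))\<^sup>2 * native_weight \<delta> \<omega>) = (LINT \<omega>|lborel. (cmod (L1_fourier f \<omega>))\<^sup>2 * native_weight \<delta> \<omega>)"
    by (rule integral_cong_AE[OF _ _ AE2]) measurable
  then show "native_norm \<delta> f = sqrt (LINT \<omega>|lborel. (cmod (L1_fourier f \<omega>))\<^sup>2 * native_weight \<delta> \<omega>)"
    by (simp add: native_norm_def)
qed

lemma zero_in_native_space: "(\<lambda>_::real^'n. 0) \<in> native_space \<delta>"
  and fourier_zero: "AE \<omega> in lborel. fourier (\<lambda>_::real^'n. 0) \<omega> = 0"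
proof -
  have L: "L1_fourier (\<lambda>_::real^'n. 0) = (\<lambda>_. 0)" by (simp add: L1_fourier_def fun_eq_iff)
  show "(\<lambda>_::real^'n. 0) \<in> native_space \<delta>" by (rule native_spaceI) (simp_all add: L)
  show "AE \<omega> in lborel. fourier (\<lambda>_::real^'n. 0) \<omega> = 0" using native_spaceI(3)[of "\<lambda>_::real^'n. 0" \<delta>] by (simp add: L)
qed

text \<open>A native function that vanishes on a set with interior is 0, so the orthogonality
  condition ranges over the zero function alone, and any extension must be \<open>s\<close>.\<close>

lemma native_extension_self:
  fixes s :: "real ^ 'n \<Rightarrow> complex"
  assumes s: "s \<in> native_space \<delta>" and \<delta>: "0 < \<delta>" and D: "interior D \<noteq> {}"
  shows "native_extension \<delta> D s F \<longleftrightarrow> F = s"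
proof
  have int: "x \<in> interior D \<Longrightarrow> x \<in> D" for x using interior_subset by auto
  assume "native_extension \<delta> D s F"
  then have "F \<in> native_space \<delta>" "\<And>x. x \<in> D \<Longrightarrow> F x = s x" by (auto simp: native_extension_def)
  then show "F = s" using native_unique_continuation[OF _ s \<delta> open_interior D] int by blast
next
  have int: "x \<in> interior D \<Longrightarrow> x \<in> D" for x using interior_subset by auto
  assume F: "F = s"
  have "native_inner \<delta> F g = 0" if g: "g \<in> native_space \<delta>" "\<forall>x\<in>D. g x = 0" for g
  proof -
    have "g = (\<lambda>_. 0)"
      using native_unique_continuation[OF g(1) zero_in_native_space \<delta> open_interior D] g(2) int by blast
    then have ae: "AE \<omega> in lborel. fourier g \<omega> = 0" using fourier_zero by simp
    show ?thesis unfolding native_inner_def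
      by (rule integral_eq_zero_AE) (use ae in eventually_elim, simp)
  qed
  then show "native_extension \<delta> D s F" using s F by (auto simp: native_extension_def)
qed

section \<open>Singular values and least squares\<close>

text \<open>The real part of the Hermitian product, that is, the Euclidean inner product of the
  underlying real space. It fits variational arguments in which vectors are scaled by real
  factors.\<close>

definition cdot :: "complex Matrix.vec \<Rightarrow> complex Matrix.vec \<Rightarrow> real" where
  "cdot v w = (\<Sum>i<dim_vec v. Re (Matrix.vec_index v i * cnj (Matrix.vec_index w i)))"

lemma vec_norm2_sq: "(vec_norm2 v)\<^sup>2 = cdot v v"
  by (simp add: vec_norm2_def L2_set_def cdot_def sum_nonneg complex_mult_cnj flip: cmod_power2)

lemma vec_norm2_nonneg: "0 \<le> vec_norm2 v"
  by (simp add: vec_norm2_def)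

lemma cdot_commute: "dim_vec v = dim_vec w \<Longrightarrow> cdot v w = cdot w v"
  unfolding cdot_def by (intro sum.cong) (auto simp: algebra_simps)

lemma cdot_diff_left:
  assumes "u \<in> carrier_vec n" "v \<in> carrier_vec n"
  shows "cdot (u - v) w = cdot u w - cdot v w"
  using assms by (simp add: cdot_def sum_subtractf algebra_simps)

lemma cdot_smult_left: "cdot (of_real t \<cdot>\<^sub>v u) w = t * cdot u w"
  by (simp add: cdot_def sum_distrib_left algebra_simps)

lemma cdot_diff_self:
  assumes "u \<in> carrier_vec n" "v \<in> carrier_vec n"
  shows "cdot (u - of_real t \<cdot>\<^sub>v v) (u - of_real t \<cdot>\<^sub>v v) = cdot u u - 2 * t * cdot u v + t\<^sup>2 * cdot v v"
proof -
  have u: "dim_vec u = n" "dim_vec v = n" using assms by auto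
  let ?w = "u - of_real t \<cdot>\<^sub>v v"
  have w: "dim_vec ?w = n" by (simp add: u)
  have "cdot ?w ?w = cdot u ?w - t * cdot v ?w"
    using assms by (subst cdot_diff_left[of _ n]) (auto simp: cdot_smult_left)
  also have "cdot u ?w = cdot u u - t * cdot v u"
    by (subst cdot_commute, use u w in simp, subst cdot_diff_left[of _ n]) (use assms in \<open>auto simp: cdot_smult_left\<close>)
  also have "cdot v ?w = cdot u v - t * cdot v v"
    by (subst cdot_commute, use u w in simp, subst cdot_diff_left[of _ n]) (use assms in \<open>auto simp: cdot_smult_left\<close>)
  also have "cdot v u = cdot u v" by (simp add: cdot_commute u)
  finally show ?thesis by (simp add: algebra_simps power2_eq_square)
qed

lemma vec_norm2_eq_0D: "vec_norm2 v = 0 \<Longrightarrow> v \<in> carrier_vec n \<Longrightarrow> v = 0\<^sub>v n"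
  by (auto simp: vec_norm2_def L2_set_eq_0_iff intro!: eq_vecI)

lemma cmod_vec_index_le_vec_norm2:
  assumes "i < dim_vec v"
  shows "cmod (Matrix.vec_index v i) \<le> vec_norm2 v"
  unfolding vec_norm2_def using assms by (intro member_le_L2_set) auto

lemma cdot_cauchy_schwarz:
  assumes "dim_vec v = dim_vec w"
  shows "cdot v w \<le> vec_norm2 v * vec_norm2 w"
proof -
  have "cdot v w \<le> (\<Sum>i<dim_vec v. \<bar>cmod (Matrix.vec_index v i)\<bar> * \<bar>cmod (Matrix.vec_index w i)\<bar>)"
    unfolding cdot_def
  proof (intro sum_mono)
    fix i
    show "Re (Matrix.vec_index v i * cnj (Matrix.vec_index w i)) \<le> \<bar>cmod (Matrix.vec_index v i)\<bar> * \<bar>cmod (Matrix.vec_index w i)\<bar>"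
      using complex_Re_le_cmod[of "Matrix.vec_index v i * cnj (Matrix.vec_index w i)"] by (simp add: norm_mult)
  qed
  also have "\<dots> \<le> vec_norm2 v * vec_norm2 w"
    unfolding vec_norm2_def assms by (rule L2_set_mult_ineq)
  finally show ?thesis .
qed

text \<open>Minimality along the real line through \<open>v\<close> yields the normal equation
  \<open>cdot v v = cdot y v\<close>; the two bounds are then Cauchy-Schwarz and Pythagoras.\<close>

lemma least_squares_contraction:
  assumes v: "v \<in> carrier_vec n" and y: "y \<in> carrier_vec n"
    and min: "\<And>t::real. vec_norm2 (v - y) \<le> vec_norm2 (of_real t \<cdot>\<^sub>v v - y)"
  shows "vec_norm2 v \<le> vec_norm2 y" and "vec_norm2 (y - v) \<le> vec_norm2 y"
proof -
  have sub: "vec_norm2 (of_real t \<cdot>\<^sub>v v - y) = vec_norm2 (y - of_real t \<cdot>\<^sub>v v)" for t :: real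
    using v y by (auto simp: vec_norm2_def norm_minus_commute intro!: L2_set_cong)
  have sub1: "vec_norm2 (v - y) = vec_norm2 (y - v)"
    using v y by (auto simp: vec_norm2_def norm_minus_commute intro!: L2_set_cong)
  have sq: "(vec_norm2 (y - of_real t \<cdot>\<^sub>v v))\<^sup>2 = cdot y y - 2 * t * cdot y v + t\<^sup>2 * cdot v v" for t
    unfolding vec_norm2_sq by (rule cdot_diff_self[OF y v])
  have one: "of_real 1 \<cdot>\<^sub>v v = v" by auto
  have sq1: "(vec_norm2 (y - v))\<^sup>2 = cdot y y - 2 * cdot y v + cdot v v"
    using sq[of 1] one by simp
  have ineq: "cdot v v - 2 * cdot y v \<le> t\<^sup>2 * cdot v v - 2 * t * cdot y v" for t
    using power_mono[OF min[of t] vec_norm2_nonneg, of 2] by (simp add: sub sub1 sq sq1)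
  have eq: "cdot v v = cdot y v"
  \<comment> \<open>If the quadratic term vanishes, the factors t = 0 and t = 2 force the mixed term
    to be 0. Otherwise the test factor is the minimizer of the parabola in t.\<close>
  proof (cases "cdot v v = 0")
    case True
    then have "- 2 * cdot y v \<le> -2 * t * cdot y v" for t using ineq[of t] by simp
    from this[of 0] this[of 2] True show ?thesis by simp
  next
    case False
    then have pos: "cdot v v > 0" using vec_norm2_sq[of v] zero_le_power2[of "vec_norm2 v"] by linarith
    have "cdot v v - 2 * cdot y v \<le> - (cdot y v)\<^sup>2 / cdot v v"
      using ineq[of "cdot y v / cdot v v"] pos by (simp add: power2_eq_square field_simps)
    then have "(cdot v v - cdot y v)\<^sup>2 \<le> 0" using pos by (simp add: field_simps power2_eq_square)
    then show ?thesis by simp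
  qed
  have "(vec_norm2 v)\<^sup>2 \<le> vec_norm2 y * vec_norm2 v"
    unfolding vec_norm2_sq eq using v y by (intro cdot_cauchy_schwarz) auto
  then show "vec_norm2 v \<le> vec_norm2 y"
    using vec_norm2_nonneg[of v] vec_norm2_nonneg[of y] by (cases "vec_norm2 v = 0") (auto simp: power2_eq_square)
  have "(vec_norm2 (y - v))\<^sup>2 \<le> (vec_norm2 y)\<^sup>2"
    unfolding sq1 using eq zero_le_power2[of "vec_norm2 v"] by (simp add: vec_norm2_sq)
  then show "vec_norm2 (y - v) \<le> vec_norm2 y"
    by (rule power2_le_imp_le[OF _ vec_norm2_nonneg])
qed

section \<open>Adjoints and the smallest singular value\<close>

lemma mat_adjoint_carrier:
  fixes A :: "complex mat"
  assumes "A \<in> carrier_mat m n"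
  shows "mat_adjoint A \<in> carrier_mat n m"
  using assms by (auto simp: mat_adjoint_def)

lemma index_mat_adjoint:
  fixes A :: "complex mat"
  assumes "A \<in> carrier_mat m n" "i < n" "j < m"
  shows "mat_adjoint A $$ (i, j) = cnj (A $$ (j, i))"
  using assms by (simp add: mat_adjoint_def mat_of_rows_index)

lemma cdot_mat_adjoint:
  fixes A :: "complex mat"
  assumes A: "A \<in> carrier_mat m n" and v: "v \<in> carrier_vec n" and w: "w \<in> carrier_vec m"
  shows "cdot (A *\<^sub>v v) w = cdot v (mat_adjoint A *\<^sub>v w)"
proof -
  have A': "mat_adjoint A \<in> carrier_mat n m" by (rule mat_adjoint_carrier[OF A])
  let ?v = "Matrix.vec_index v" and ?w = "Matrix.vec_index w"
  have "cdot (A *\<^sub>v v) w = (\<Sum>i<m. Re ((\<Sum>j<n. A $$ (i, j) * ?v j) * cnj (?w i)))"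
    using A v w by (simp add: cdot_def scalar_prod_def atLeast0LessThan)
  also have "\<dots> = Re (\<Sum>i<m. \<Sum>j<n. A $$ (i, j) * ?v j * cnj (?w i))"
    by (simp add: sum_distrib_right Re_sum)
  also have "\<dots> = Re (\<Sum>j<n. \<Sum>i<m. A $$ (i, j) * ?v j * cnj (?w i))"
    by (subst sum.swap) simp
  also have "\<dots> = (\<Sum>j<n. Re (?v j * cnj (\<Sum>i<m. mat_adjoint A $$ (j, i) * ?w i)))"
    using index_mat_adjoint[OF A] by (simp add: sum_distrib_left Re_sum mult_ac)
  also have "\<dots> = cdot v (mat_adjoint A *\<^sub>v w)"
    using A' v w by (simp add: cdot_def scalar_prod_def atLeast0LessThan)
  finally show ?thesis .
qed

text \<open>A crude bound by row sums, since the existence of some \<open>K\<close> is the point;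
  the summand 1 makes it positive, so that it can be divided by.\<close>

lemma mat_norm_bound:
  fixes A :: "complex mat"
  assumes A: "A \<in> carrier_mat m n"
  obtains K where "K > 0" "\<And>x. x \<in> carrier_vec n \<Longrightarrow> cdot (A *\<^sub>v x) (A *\<^sub>v x) \<le> K * cdot x x"
proof
  let ?r = "\<lambda>i. \<Sum>j<n. cmod (A $$ (i, j))"
  let ?K = "1 + (\<Sum>i<m. (?r i)\<^sup>2)"
  show "?K > 0" by (intro add_pos_nonneg sum_nonneg) auto
  fix x :: "complex Matrix.vec" assume x: "x \<in> carrier_vec n"
  have comp: "cmod (Matrix.vec_index (A *\<^sub>v x) i) \<le> ?r i * vec_norm2 x" if i: "i < m" for i
  proof -
    have "cmod (Matrix.vec_index (A *\<^sub>v x) i) = cmod (\<Sum>j<n. A $$ (i, j) * Matrix.vec_index x j)"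
      using A x i by (simp add: scalar_prod_def atLeast0LessThan)
    also have "\<dots> \<le> (\<Sum>j<n. cmod (A $$ (i, j)) * vec_norm2 x)"
      by (rule sum_norm_le)
        (use x in \<open>auto simp: norm_mult intro!: mult_left_mono cmod_vec_index_le_vec_norm2\<close>)
    finally show ?thesis by (simp add: sum_distrib_right)
  qed
  have "cdot (A *\<^sub>v x) (A *\<^sub>v x) = (\<Sum>i<m. (cmod (Matrix.vec_index (A *\<^sub>v x) i))\<^sup>2)"
    using A by (simp add: vec_norm2_sq[symmetric] vec_norm2_def L2_set_def sum_nonneg)
  also have "\<dots> \<le> (\<Sum>i<m. (?r i * vec_norm2 x)\<^sup>2)"
    by (intro sum_mono power_mono comp) auto
  also have "\<dots> \<le> ?K * (vec_norm2 x)\<^sup>2"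
    by (simp add: power_mult_distrib sum_distrib_right[symmetric] distrib_right)
  finally show "cdot (A *\<^sub>v x) (A *\<^sub>v x) \<le> ?K * cdot x x" by (simp add: vec_norm2_sq)
qed

lemma cdot_self_nonneg: "0 \<le> cdot v v"
  by (simp flip: vec_norm2_sq)

text \<open>The infimum \<open>m\<close> of the Rayleigh quotient of \<open>R\<^sup>* R\<close> is an eigenvalue: \<open>M = R\<^sup>* R - m I\<close> is positive semidefinite,
  so \<open>|M v|\<^sup>2\<close> is bounded by a multiple of \<open>\<langle>M v, v\<rangle>\<close>, and if \<open>M\<close> were invertible, then \<open>\<langle>M v, v\<rangle>\<close> would be at least a
  positive multiple of \<open>|v|\<^sup>2\<close>. No compactness argument is needed.\<close>

lemma eigenvalue_inf_quadratic_form: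
  fixes R :: "complex mat"
  assumes R: "R \<in> carrier_mat n n" and n: "0 < n"
  obtains m where "0 \<le> m" "eigenvalue (mat_adjoint R * R) (of_real m)"
    "\<And>v. v \<in> carrier_vec n \<Longrightarrow> m * cdot v v \<le> cdot (R *\<^sub>v v) (R *\<^sub>v v)"
proof -
  let ?S = "{v. v \<in> carrier_vec n \<and> cdot v v = 1}"
  let ?q = "\<lambda>v. cdot (R *\<^sub>v v) (R *\<^sub>v v)"
  define m where "m = Inf (?q ` ?S)"
  have ne: "?S \<noteq> {}"
  proof -
    have "cdot (unit_vec n 0) (unit_vec n 0) = (\<Sum>i<n. if i = 0 then 1 else 0)"
      unfolding cdot_def by (intro sum.cong) (auto simp: unit_vec_def)
    then have "unit_vec n 0 \<in> ?S" using n by simp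
    then show ?thesis by blast
  qed
  have bdd: "bdd_below (?q ` ?S)"
    by (rule bdd_belowI[of _ 0]) (auto simp: cdot_self_nonneg)
  have m0: "0 \<le> m" unfolding m_def using ne by (intro cInf_greatest) (auto simp: cdot_self_nonneg)
  have scale: "\<exists>w\<in>?S. ?q v = cdot v v * ?q w" if v: "v \<in> carrier_vec n" "cdot v v \<noteq> 0" for v
  proof
    have pos: "vec_norm2 v > 0" using v vec_norm2_sq[of v] vec_norm2_nonneg[of v] by (auto simp: less_le)
    let ?t = "1 / vec_norm2 v"
    let ?w = "of_real ?t \<cdot>\<^sub>v v"
    have s: "cdot (of_real t \<cdot>\<^sub>v u) (of_real t \<cdot>\<^sub>v u) = t\<^sup>2 * cdot u u" for t u
      by (simp add: cdot_def sum_distrib_left algebra_simps power2_eq_square)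
    have "cdot ?w ?w = 1" unfolding s by (simp add: vec_norm2_sq[symmetric] power_divide pos[THEN less_imp_neq[symmetric]])
    then show "?w \<in> ?S" using v by auto
    have "R *\<^sub>v ?w = of_real ?t \<cdot>\<^sub>v (R *\<^sub>v v)" using R v by (simp add: mult_mat_vec)
    then have "?q ?w = ?t\<^sup>2 * ?q v" by (simp only: s)
    then show "?q v = cdot v v * ?q ?w" using v(2) by (simp add: power_divide vec_norm2_sq)
  qed
  have zero: "v = 0\<^sub>v n" if "v \<in> carrier_vec n" "cdot v v = 0" for v
    using that vec_norm2_eq_0D[of v n] vec_norm2_sq[of v] by simp
  have lower: "m * cdot v v \<le> ?q v" if v: "v \<in> carrier_vec n" for v
  proof (cases "cdot v v = 0")
    case False
    from scale[OF v this] obtain w where w: "w \<in> ?S" "?q v = cdot v v * ?q w" by blast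
    have "m \<le> ?q w" unfolding m_def using w bdd by (intro cInf_lower) auto
    from mult_left_mono[OF this cdot_self_nonneg[of v]] show ?thesis
      unfolding w(2) by (simp add: mult.commute)
  qed (simp add: cdot_self_nonneg)
  define M where "M = char_matrix (mat_adjoint R * R) (of_real m)"
  have RR: "mat_adjoint R * R \<in> carrier_mat n n" using mat_adjoint_carrier[OF R] R by auto
  have M: "M \<in> carrier_mat n n" unfolding M_def using RR by auto
  have Mv: "M *\<^sub>v v = mat_adjoint R *\<^sub>v (R *\<^sub>v v) - of_real m \<cdot>\<^sub>v v" if v: "v \<in> carrier_vec n" for v
  proof -
    have R': "mat_adjoint R \<in> carrier_mat n n" by (rule mat_adjoint_carrier[OF R])
    have "(- of_real m \<cdot>\<^sub>m 1\<^sub>m n) *\<^sub>v v = - of_real m \<cdot>\<^sub>v v"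
    proof (rule eq_vecI)
      fix i assume "i < dim_vec (- of_real m \<cdot>\<^sub>v v)"
      then have i: "i < n" using v by auto
      then have "Matrix.vec_index ((- of_real m \<cdot>\<^sub>m 1\<^sub>m n) *\<^sub>v v) i = scalar_prod (- of_real m \<cdot>\<^sub>v unit_vec n i) v"
        using v by simp
      also have "\<dots> = - of_real m * Matrix.vec_index v i"
        using v i by (subst smult_scalar_prod_distrib[of _ n]) auto
      finally show "Matrix.vec_index ((- of_real m \<cdot>\<^sub>m 1\<^sub>m n) *\<^sub>v v) i = Matrix.vec_index (- of_real m \<cdot>\<^sub>v v) i"
        using v i by auto
    qed (use v in auto)
    moreover have "(mat_adjoint R * R) *\<^sub>v v = mat_adjoint R *\<^sub>v (R *\<^sub>v v)"
      using R' R v by (rule assoc_mult_mat_vec)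
    moreover have "M *\<^sub>v v = (mat_adjoint R * R) *\<^sub>v v + (- of_real m \<cdot>\<^sub>m 1\<^sub>m n) *\<^sub>v v"
    proof -
      have "dim_row (mat_adjoint R * R) = n" using R' by auto
      then show ?thesis unfolding M_def char_matrix_def
        using add_mult_distrib_mat_vec[OF RR _ v, of "- of_real m \<cdot>\<^sub>m 1\<^sub>m n"] by simp
    qed
    ultimately show ?thesis using v R' by (auto intro!: eq_vecI)
  qed
  have form: "cdot v (M *\<^sub>v w) = cdot (R *\<^sub>v v) (R *\<^sub>v w) - m * cdot v w"
    if v: "v \<in> carrier_vec n" and w: "w \<in> carrier_vec n" for v w
  proof -
    have "mat_adjoint R \<in> carrier_mat n n" by (rule mat_adjoint_carrier[OF R])
    then have dr: "dim_row (mat_adjoint R) = n" by auto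
    have dims: "mat_adjoint R *\<^sub>v (R *\<^sub>v w) \<in> carrier_vec n" "R *\<^sub>v w \<in> carrier_vec n"
      using mat_adjoint_carrier[OF R] R w by auto
    have "cdot v (M *\<^sub>v w) = cdot (M *\<^sub>v w) v"
      using M v w by (intro cdot_commute) auto
    also have "\<dots> = cdot (mat_adjoint R *\<^sub>v (R *\<^sub>v w)) v - m * cdot w v"
      unfolding Mv[OF w] using dims w by (subst cdot_diff_left[of _ n]) (auto simp: cdot_smult_left)
    also have "cdot (mat_adjoint R *\<^sub>v (R *\<^sub>v w)) v = cdot v (mat_adjoint R *\<^sub>v (R *\<^sub>v w))"
      using dims v dr by (intro cdot_commute) auto
    also have "\<dots> = cdot (R *\<^sub>v v) (R *\<^sub>v w)"
      using cdot_mat_adjoint[OF R v dims(2)] by simp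
    also have "cdot w v = cdot v w" using v w by (intro cdot_commute) auto
    finally show ?thesis .
  qed
  obtain K where K: "K > 0" "\<And>x. x \<in> carrier_vec n \<Longrightarrow> ?q x \<le> K * cdot x x"
    using mat_norm_bound[OF R] by blast
  \<comment> \<open>Nonnegativity of the form is tested at v - (1/K) M v. The linear term
    contributes -(2/K) |M v|^2 and the quadratic term at most (1/K) |M v|^2, which leaves |M v|^2
    \<le> K times the form at \<open>v\<close>.\<close>
  have key: "cdot (M *\<^sub>v v) (M *\<^sub>v v) \<le> K * (?q v - m * cdot v v)" if v: "v \<in> carrier_vec n" for v
  proof -
    let ?w = "M *\<^sub>v v" and ?t = "1 / K"
    have w: "?w \<in> carrier_vec n" using M v by auto
    have u: "v - of_real ?t \<cdot>\<^sub>v ?w \<in> carrier_vec n" using v w by auto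
    have Ru: "R *\<^sub>v (v - of_real ?t \<cdot>\<^sub>v ?w) = R *\<^sub>v v - of_real ?t \<cdot>\<^sub>v (R *\<^sub>v ?w)"
      using R v w by (subst mult_minus_distrib_mat_vec[of _ n n]) (auto simp: mult_mat_vec)
    have Rc: "R *\<^sub>v v \<in> carrier_vec n" "R *\<^sub>v ?w \<in> carrier_vec n" using R v w by auto
    have "0 \<le> ?q (v - of_real ?t \<cdot>\<^sub>v ?w) - m * cdot (v - of_real ?t \<cdot>\<^sub>v ?w) (v - of_real ?t \<cdot>\<^sub>v ?w)"
      using lower[OF u] by simp
    also have "\<dots> = (?q v - m * cdot v v) - 2 * ?t * (cdot (R *\<^sub>v v) (R *\<^sub>v ?w) - m * cdot v ?w)
        + ?t\<^sup>2 * (?q ?w - m * cdot ?w ?w)"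
      unfolding Ru cdot_diff_self[OF v w] cdot_diff_self[OF Rc] by (simp add: algebra_simps)
    also have "cdot (R *\<^sub>v v) (R *\<^sub>v ?w) - m * cdot v ?w = cdot ?w ?w"
    proof -
      have "cdot v (M *\<^sub>v ?w) = cdot (R *\<^sub>v ?w) (R *\<^sub>v v) - m * cdot ?w v"
        unfolding form[OF v w]
        using cdot_commute[of v ?w] cdot_commute[of "R *\<^sub>v v" "R *\<^sub>v ?w"] M R v by simp
      also have "\<dots> = cdot ?w ?w" using form[OF w v] by simp
      finally show ?thesis unfolding form[OF v w] .
    qed
    also have "?q ?w - m * cdot ?w ?w \<le> K * cdot ?w ?w"
      using K(2)[OF w] mult_nonneg_nonneg[OF m0 cdot_self_nonneg[of ?w]] by linarith
    finally have "0 \<le> (?q v - m * cdot v v) - 2 * ?t * cdot ?w ?w + ?t\<^sup>2 * (K * cdot ?w ?w)"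
      by (simp add: mult_left_mono)
    then show ?thesis using K(1) by (simp add: field_simps power2_eq_square)
  qed
  have "eigenvalue (mat_adjoint R * R) (of_real m)"
  proof (rule ccontr)
    assume "\<not> ?thesis"
    then have "det M \<noteq> 0" unfolding M_def eigenvalue_det[OF RR] .
    from det_non_zero_imp_unit[OF M this, of "()"] obtain N where N: "N \<in> carrier_mat n n" "N * M = 1\<^sub>m n"
      by (auto simp: Units_def ring_mat_def)
    obtain L where L: "L > 0" "\<And>x. x \<in> carrier_vec n \<Longrightarrow> cdot (N *\<^sub>v x) (N *\<^sub>v x) \<le> L * cdot x x"
      using mat_norm_bound[OF N(1)] by blast
    \<comment> \<open>For unit vectors 1 \<le> L |M v|^2 \<le> L K (q - m), where q is the Rayleigh
      quotient at \<open>v\<close>. This is a uniform gap above the infimum, which is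
      absurd.\<close>
    have "m + 1 / (L * K) \<le> m"
    proof -
      have "m + 1 / (L * K) \<le> ?q v" if v: "v \<in> ?S" for v
      proof -
        have vc: "v \<in> carrier_vec n" and v1: "cdot v v = 1" using v by auto
        have "N *\<^sub>v (M *\<^sub>v v) = v"
          using N M vc assoc_mult_mat_vec[of N n n M n v] by simp
        then have "1 \<le> L * cdot (M *\<^sub>v v) (M *\<^sub>v v)"
          using L(2)[of "M *\<^sub>v v"] M vc v1 by simp
        also have "\<dots> \<le> L * (K * (?q v - m))"
          using key[OF vc] L(1) v1 by (intro mult_left_mono) auto
        finally show ?thesis using K(1) L(1) by (simp add: field_simps)
      qed
      then show ?thesis unfolding m_def using ne by (intro cInf_greatest) auto
    qed
    then show False using K(1) L(1) by (simp add: field_simps)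
  qed
  with m0 lower that show ?thesis by blast
qed

text \<open>\<open>Min\<close> is meaningful because the eigenvalues are roots of the characteristic
  polynomial, hence finitely many, and because sqrt m for the Rayleigh infimum \<open>m\<close> is a
  singular value. A singular value 0 would give a nonzero vector in the kernel of
  \<open>R\<close>.\<close>

lemma min_singular_value:
  fixes R :: "complex mat"
  assumes R: "R \<in> carrier_mat n n" and n: "0 < n" and inv: "invertible_mat R"
  shows "0 < Min (singular_values R)"
    and "v \<in> carrier_vec n \<Longrightarrow> Min (singular_values R) * vec_norm2 v \<le> vec_norm2 (R *\<^sub>v v)"
proof -
  let ?A = "mat_adjoint R * R"
  have RR: "?A \<in> carrier_mat n n" using mat_adjoint_carrier[OF R] R by auto
  have "finite {k. eigenvalue ?A k}"
    unfolding eigenvalue_root_char_poly[OF RR]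
    by (rule poly_roots_finite) (use degree_monic_char_poly[OF RR] n in auto)
  then have "finite ((\<lambda>k. sqrt (Re k)) ` {k. eigenvalue ?A k})" by (rule finite_imageI)
  moreover have "singular_values R \<subseteq> (\<lambda>k. sqrt (Re k)) ` {k. eigenvalue ?A k}"
    by (force simp: singular_values_def simp flip: of_real_power)
  ultimately have fin: "finite (singular_values R)" by (rule rev_finite_subset)
  obtain m where m: "0 \<le> m" "eigenvalue ?A (of_real m)"
    "\<And>v. v \<in> carrier_vec n \<Longrightarrow> m * cdot v v \<le> cdot (R *\<^sub>v v) (R *\<^sub>v v)"
    using eigenvalue_inf_quadratic_form[OF R n] by metis
  have in_sv: "sqrt m \<in> singular_values R" using m by (simp add: singular_values_def flip: of_real_power)
  have le: "Min (singular_values R) \<le> sqrt m" using fin in_sv by simp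
  have pos: "0 < \<sigma>" if \<sigma>: "\<sigma> \<in> singular_values R" for \<sigma>
  proof (rule ccontr)
    assume "\<not> 0 < \<sigma>"
    with \<sigma> have "eigenvalue ?A 0" by (auto simp: singular_values_def)
    then obtain v where v: "v \<in> carrier_vec n" "v \<noteq> 0\<^sub>v n" "?A *\<^sub>v v = 0 \<cdot>\<^sub>v v"
      using RR by (auto simp: eigenvalue_def eigenvector_def)
    have "?A *\<^sub>v v = mat_adjoint R *\<^sub>v (R *\<^sub>v v)"
      using mat_adjoint_carrier[OF R] R v(1) by (rule assoc_mult_mat_vec)
    moreover have "0 \<cdot>\<^sub>v v = 0\<^sub>v n" using v(1) by auto
    ultimately have "mat_adjoint R *\<^sub>v (R *\<^sub>v v) = 0\<^sub>v n" using v(3) by simp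
    moreover have "cdot (R *\<^sub>v v) (R *\<^sub>v v) = cdot v (mat_adjoint R *\<^sub>v (R *\<^sub>v v))"
      using R v by (intro cdot_mat_adjoint) auto
    ultimately have "cdot (R *\<^sub>v v) (R *\<^sub>v v) = 0" using v by (simp add: cdot_def)
    then have "R *\<^sub>v v = 0\<^sub>v n"
      using R v(1) vec_norm2_eq_0D[of "R *\<^sub>v v" n] vec_norm2_sq[of "R *\<^sub>v v"] by auto
    \<comment> \<open>The definition of an inverse leaves its dimensions open; they are recovered
      from the two identity matrices.\<close>
    moreover obtain B where B: "inverts_mat B R" "inverts_mat R B" using inv unfolding invertible_mat_def by auto
    have BR: "B * R = 1\<^sub>m (dim_row B)" using B(1) unfolding inverts_mat_def .
    have "dim_col (B * R) = dim_row B" unfolding BR by simp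
    then have rB: "dim_row B = n" using R by simp
    have "R * B = 1\<^sub>m (dim_row R)" using B(2) unfolding inverts_mat_def .
    then have "dim_col (R * B) = n" using R by simp
    then have B': "B \<in> carrier_mat n n" using rB by auto
    have "B *\<^sub>v (R *\<^sub>v v) = v" using BR B' rB R v(1) assoc_mult_mat_vec[of B n n R n v] by simp
    ultimately have "v = 0\<^sub>v n" using B' by (auto intro!: eq_vecI)
    with v show False by simp
  qed
  then show posM: "0 < Min (singular_values R)" using fin in_sv by (subst Min_gr_iff) auto
  assume v: "v \<in> carrier_vec n"
  have "(Min (singular_values R) * vec_norm2 v)\<^sup>2 \<le> m * (vec_norm2 v)\<^sup>2"
    unfolding power_mult_distrib using le posM m(1) power_mono[OF le, of 2] by (intro mult_right_mono) auto
  also have "\<dots> \<le> (vec_norm2 (R *\<^sub>v v))\<^sup>2" using m(3)[OF v] by (simp add: vec_norm2_sq)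
  finally show "Min (singular_values R) * vec_norm2 v \<le> vec_norm2 (R *\<^sub>v v)"
    by (rule power2_le_imp_le[OF _ vec_norm2_nonneg])
qed

text \<open>Orthonormal columns of \<open>Q\<close> make the fitted vector as long as
  \<open>R *\<^sub>v \<alpha>\<close>, and a least squares fit is no longer than the data. The
  smallest singular value of \<open>R\<close> thus converts the data norm into a bound on the
  coefficients.\<close>

lemma least_squares_bounds:
  assumes LS: "least_squares_solution A y \<alpha>" and QR: "QR_decomposition A Q R"
    and y: "dim_vec y = dim_row A" and n: "0 < dim_col A"
  shows "0 < Min (singular_values R)"
    and "Min (singular_values R) * vec_norm2 \<alpha> \<le> vec_norm2 y"
    and "vec_norm2 (y - A *\<^sub>v \<alpha>) \<le> vec_norm2 y"
proof -
  define m k where "m = dim_row A" and "k = dim_col A"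
  have A: "A \<in> carrier_mat m k" by (auto simp: m_def k_def)
  have Q: "Q \<in> carrier_mat m k" and R: "R \<in> carrier_mat k k" and AQR: "A = Q * R"
    and QQ: "mat_adjoint Q * Q = 1\<^sub>m k" and inv: "invertible_mat R"
    using QR unfolding QR_decomposition_def m_def k_def by blast+
  have k: "0 < k" using n by (simp add: k_def)
  have \<alpha>: "\<alpha> \<in> carrier_vec k" using LS unfolding least_squares_solution_def k_def by blast
  have yc: "y \<in> carrier_vec m" using y unfolding m_def by (rule carrier_vecI)
  have A\<alpha>: "A *\<^sub>v \<alpha> \<in> carrier_vec m" using A \<alpha> by auto
  have min: "vec_norm2 (A *\<^sub>v \<alpha> - y) \<le> vec_norm2 (of_real t \<cdot>\<^sub>v (A *\<^sub>v \<alpha>) - y)" for t :: real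
  proof -
    have "of_real t \<cdot>\<^sub>v (A *\<^sub>v \<alpha>) = A *\<^sub>v (of_real t \<cdot>\<^sub>v \<alpha>)" using A \<alpha> by (simp add: mult_mat_vec)
    then show ?thesis using LS \<alpha> by (auto simp: least_squares_solution_def k_def)
  qed
  note contr = least_squares_contraction[OF A\<alpha> yc min]
  show "vec_norm2 (y - A *\<^sub>v \<alpha>) \<le> vec_norm2 y" by (rule contr)
  show "0 < Min (singular_values R)" by (rule min_singular_value(1)[OF R k inv])
  have "Min (singular_values R) * vec_norm2 \<alpha> \<le> vec_norm2 (R *\<^sub>v \<alpha>)"
    by (rule min_singular_value(2)[OF R k inv \<alpha>])
  also have "vec_norm2 (R *\<^sub>v \<alpha>) = vec_norm2 (A *\<^sub>v \<alpha>)"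
  proof -
    have R\<alpha>: "R *\<^sub>v \<alpha> \<in> carrier_vec k" using R \<alpha> by auto
    have eq: "A *\<^sub>v \<alpha> = Q *\<^sub>v (R *\<^sub>v \<alpha>)" unfolding AQR using Q R \<alpha> by (rule assoc_mult_mat_vec)
    have "cdot (A *\<^sub>v \<alpha>) (A *\<^sub>v \<alpha>) = cdot (R *\<^sub>v \<alpha>) (mat_adjoint Q *\<^sub>v (Q *\<^sub>v (R *\<^sub>v \<alpha>)))"
      unfolding eq using Q R\<alpha> by (intro cdot_mat_adjoint) auto
    also have "mat_adjoint Q *\<^sub>v (Q *\<^sub>v (R *\<^sub>v \<alpha>)) = R *\<^sub>v \<alpha>"
      using assoc_mult_mat_vec[OF mat_adjoint_carrier[OF Q] Q R\<alpha>] QQ R\<alpha> by simp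
    finally show ?thesis
      by (metis vec_norm2_sq vec_norm2_nonneg power2_eq_iff_nonneg)
  qed
  also have "\<dots> \<le> vec_norm2 y" by (rule contr)
  finally show "Min (singular_values R) * vec_norm2 \<alpha> \<le> vec_norm2 y" .
qed

section \<open>Residuals along a branch\<close>

lemma vec_norm2_sample_sq: "(vec_norm2 (sample f xs))\<^sup>2 = (\<Sum>x\<leftarrow>xs. (cmod (f x))\<^sup>2)"
proof -
  have "(vec_norm2 (sample f xs))\<^sup>2 = (\<Sum>i<length xs. (cmod (f (xs ! i)))\<^sup>2)"
    by (simp add: vec_norm2_def L2_set_def sum_nonneg sample_def vec_of_list_index)
  also have "\<dots> = (\<Sum>x\<leftarrow>xs. (cmod (f x))\<^sup>2)"
    by (simp add: sum_list_sum_nth atLeast0LessThan)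
  finally show ?thesis .
qed

lemma vec_norm2_sample_filter_le: "vec_norm2 (sample f (filter P xs)) \<le> vec_norm2 (sample f xs)"
proof (rule power2_le_imp_le[OF _ vec_norm2_nonneg])
  show "(vec_norm2 (sample f (filter P xs)))\<^sup>2 \<le> (vec_norm2 (sample f xs))\<^sup>2"
    unfolding vec_norm2_sample_sq by (induction xs) (auto intro: add_increasing)
qed

lemma sample_residual:
  assumes "coeffs n \<in> carrier_vec (length (centers n))"
  shows "sample (\<lambda>x. r x - node_approx n x) (node_data X n)
    = sample r (node_data X n) - node_matrix X n *\<^sub>v coeffs n"
proof (rule eq_vecI)
  let ?xs = "node_data X n"
  have dims: "dim_row (node_matrix X n) = length ?xs" "dim_col (node_matrix X n) = length (centers n)"
    by (simp_all add: node_matrix_def gauss_matrix_def)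
  fix i assume "i < dim_vec (sample r ?xs - node_matrix X n *\<^sub>v coeffs n)"
  then have i: "i < length ?xs" by (simp add: dims)
  have "Matrix.vec_index (node_matrix X n *\<^sub>v coeffs n) i = node_approx n (?xs ! i)"
    using assms i by (simp add: dims scalar_prod_def node_approx_def atLeast0LessThan)
      (simp add: node_matrix_def gauss_matrix_def mult.commute)
  then show "Matrix.vec_index (sample (\<lambda>x. r x - node_approx n x) ?xs) i
      = Matrix.vec_index (sample r ?xs - node_matrix X n *\<^sub>v coeffs n) i"
    using i by (simp add: sample_def vec_of_list_index dims)
qed (simp add: sample_def node_matrix_def gauss_matrix_def)

lemma srt_node_bounds:
  assumes "srt_node_ok X r n"
  shows "0 < node_tau n"
    and "vec_norm2 (coeffs n) \<le> inverse (node_tau n) * vec_norm2 (sample r (node_data X n))"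
    and "vec_norm2 (sample (\<lambda>x. r x - node_approx n x) (node_data X n)) \<le> vec_norm2 (sample r (node_data X n))"
    and "coeffs n \<in> carrier_vec (length (centers n))"
proof -
  let ?A = "node_matrix X n" and ?y = "sample r (node_data X n)"
  have dims: "dim_row ?A = length (node_data X n)" "dim_col ?A = length (centers n)"
    by (simp_all add: node_matrix_def gauss_matrix_def)
  have LS: "least_squares_solution ?A ?y (coeffs n)" and QR: "QR_decomposition ?A (Q_factor n) (R_factor n)"
    using assms by (simp_all add: srt_node_ok_def)
  have "dim_vec ?y = dim_row ?A" by (simp add: dims sample_def)
  moreover have "0 < dim_col ?A" using assms by (simp add: dims srt_node_ok_def)
  note b = least_squares_bounds[OF LS QR calculation this]
  show pos: "0 < node_tau n" unfolding node_tau_def by (rule b(1))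
  show "vec_norm2 (coeffs n) \<le> inverse (node_tau n) * vec_norm2 ?y"
    using b(2) pos by (simp add: node_tau_def field_simps)
  show c: "coeffs n \<in> carrier_vec (length (centers n))"
    using LS unfolding least_squares_solution_def dims by blast
  show "vec_norm2 (sample (\<lambda>x. r x - node_approx n x) (node_data X n)) \<le> vec_norm2 ?y"
    unfolding sample_residual[OF c] by (rule b(3))
qed

lemma node_data_mono: "region c \<subseteq> region n \<Longrightarrow> node_data X c = filter (\<lambda>x. x \<in> region c) (node_data X n)"
  by (auto simp: node_data_def intro!: filter_cong)

text \<open>The residual is generalized in the induction because the subtrees are fitted to a new
  one. The existential \<open>r'\<close> stands for the residual that the node itself has fitted;
  its norm is traced back to the data at the root.\<close>

lemma srt_path:
  assumes "srt_fit X r T" "p \<in> branches T"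
  shows "p \<noteq> [] \<and> region (last p) \<subseteq> region (root_node T) \<and> shape (root_node T) \<le> shape (last p) \<and>
    (\<forall>n\<in>set p. shape n \<le> shape (last p) \<and>
      (\<exists>r'. srt_node_ok X r' n \<and>
        vec_norm2 (sample r' (node_data X n)) \<le> vec_norm2 (sample r (node_data X (root_node T)))))"
  using assms
proof (induction T arbitrary: r p)
  case (Leaf n)
  then show ?case by auto
next
  case (Branch n t1 t2)
  let ?r = "\<lambda>x. r x - node_approx n x"
  have ok: "srt_node_ok X r n" using Branch.prems by simp
  \<comment> \<open>Least squares does not increase the residual norm, and the data of a child are a
    sublist of those of its parent.\<close>
  have step: "vec_norm2 (sample ?r (node_data X c)) \<le> vec_norm2 (sample r (node_data X n))"
    if "region c \<subseteq> region n" for c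
    unfolding node_data_mono[OF that]
    using vec_norm2_sample_filter_le srt_node_bounds(3)[OF ok] by (rule order_trans)
  have sub: "region (root_node t1) \<subseteq> region n" "region (root_node t2) \<subseteq> region n"
    using Branch.prems by (auto simp: hyperplane_cut_def)
  obtain p' where p: "p = n # p'" and p': "p' \<in> branches t1 \<or> p' \<in> branches t2"
    using Branch.prems(2) by auto
  from p' have "\<exists>t. p' \<in> branches t \<and> region (root_node t) \<subseteq> region n \<and> shape n < shape (root_node t) \<and>
      p' \<noteq> [] \<and> region (last p') \<subseteq> region (root_node t) \<and> shape (root_node t) \<le> shape (last p') \<and>
    (\<forall>n\<in>set p'. shape n \<le> shape (last p') \<and>
      (\<exists>r'. srt_node_ok X r' n \<and>
        vec_norm2 (sample r' (node_data X n)) \<le> vec_norm2 (sample ?r (node_data X (root_node t)))))"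
  proof
    assume a: "p' \<in> branches t1"
    then show ?thesis using Branch.IH(1)[OF _ a, of ?r] Branch.prems(1) sub(1)
      by (intro exI[of _ t1]) (simp add: srt_child_ok_def)
  next
    assume a: "p' \<in> branches t2"
    then show ?thesis using Branch.IH(2)[OF _ a, of ?r] Branch.prems(1) sub(2)
      by (intro exI[of _ t2]) (simp add: srt_child_ok_def)
  qed
  then obtain t where t: "region (root_node t) \<subseteq> region n" "shape n < shape (root_node t)"
      "p' \<noteq> []" "region (last p') \<subseteq> region (root_node t)" "shape (root_node t) \<le> shape (last p')"
    "\<And>n. n \<in> set p' \<Longrightarrow> shape n \<le> shape (last p') \<and>
      (\<exists>r'. srt_node_ok X r' n \<and>
        vec_norm2 (sample r' (node_data X n)) \<le> vec_norm2 (sample ?r (node_data X (root_node t))))"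
    by blast
  have "\<exists>r'. srt_node_ok X r' m \<and> vec_norm2 (sample r' (node_data X m)) \<le> vec_norm2 (sample r (node_data X n))"
    if "m \<in> set p'" for m
    using t(6)[OF that] step[OF t(1)] order_trans by blast
  with t ok show ?case by (auto simp: p)
qed

text \<open>The region at the root is the whole domain, so its data are all of \<open>X\<close>;
  this turns the norms along the path into the norm of the full sample. The minimum
  \<open>srt_tau\<close> then gives one bound for all levels.\<close>

lemma srt_path_bounds:
  assumes srt: "is_srt S X f T" and p: "p \<in> branches T"
  shows "p \<noteq> []" "region (last p) \<subseteq> S" "\<exists>r. srt_node_ok X r (last p)" "0 < srt_tau p"
    and "n \<in> set p \<Longrightarrow> 0 < shape n"
    and "n \<in> set p \<Longrightarrow> shape n \<le> shape (last p)"
    and "n \<in> set p \<Longrightarrow> j < length (centers n) \<Longrightarrow>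
      cmod (Matrix.vec_index (coeffs n) j) \<le> inverse (srt_tau p) * vec_norm2 (sample f X)"
proof -
  have fit: "srt_fit X f T" and reg: "region (root_node T) = S" and X: "set X \<subseteq> S"
    using srt by (auto simp: is_srt_def)
  note path = srt_path[OF fit p, unfolded reg]
  have nd: "node_data X (root_node T) = X"
    using X by (auto simp: node_data_def reg intro!: filter_True)
  show ne: "p \<noteq> []" and "region (last p) \<subseteq> S" using path by auto
  show "\<exists>r. srt_node_ok X r (last p)" using path last_in_set[OF ne] by blast
  have node: "\<exists>r'. srt_node_ok X r' n \<and> vec_norm2 (sample r' (node_data X n)) \<le> vec_norm2 (sample f X)"
    if "n \<in> set p" for n
    using path that unfolding nd by blast
  show "n \<in> set p \<Longrightarrow> 0 < shape n" using node by (auto simp: srt_node_ok_def)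
  show "n \<in> set p \<Longrightarrow> shape n \<le> shape (last p)" using path by blast
  have taupos: "0 < node_tau n" if "n \<in> set p" for n
    using node[OF that] srt_node_bounds(1) by blast
  show tau: "0 < srt_tau p"
    unfolding srt_tau_def using ne taupos by (subst Min_gr_iff) auto
  assume n: "n \<in> set p" and j: "j < length (centers n)"
  obtain r' where r': "srt_node_ok X r' n" "vec_norm2 (sample r' (node_data X n)) \<le> vec_norm2 (sample f X)"
    using node[OF n] by blast
  note b = srt_node_bounds[OF r'(1)]
  have "cmod (Matrix.vec_index (coeffs n) j) \<le> vec_norm2 (coeffs n)"
    using b(4) j by (intro cmod_vec_index_le_vec_norm2) auto
  also have "\<dots> \<le> inverse (node_tau n) * vec_norm2 (sample r' (node_data X n))" by (rule b(2))
  also have "\<dots> \<le> inverse (srt_tau p) * vec_norm2 (sample f X)"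
  proof (intro mult_mono r'(2) vec_norm2_nonneg)
    have "srt_tau p \<le> node_tau n" unfolding srt_tau_def using n by simp
    then show "inverse (node_tau n) \<le> inverse (srt_tau p)" using tau by (rule le_imp_inverse_le)
  qed (use tau in simp)
  finally show "cmod (Matrix.vec_index (coeffs n) j) \<le> inverse (srt_tau p) * vec_norm2 (sample f X)" .
qed

section \<open>Predictions lie in the native space\<close>

text \<open>The amplitude \<open>B\<close> of a Gaussian majorant in frequency behaves well under
  sums and multiples, so linear combinations of Gaussians are estimated pointwise and the native
  norm is evaluated only once, at the end.\<close>

definition gauss_spectrum :: "real \<Rightarrow> real \<Rightarrow> (real ^ 'n \<Rightarrow> complex) \<Rightarrow> bool" where
  "gauss_spectrum L B f \<longleftrightarrow> continuous_on UNIV f \<and> integrable lborel f \<and> integrable lborel (\<lambda>x. (cmod (f x))\<^sup>2) \<and>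
    (\<forall>\<omega>. cmod (L1_fourier f \<omega>) \<le> B * exp (- ((norm \<omega>)\<^sup>2 / (4 * L\<^sup>2))))"

lemma L1_fourier_zero [simp]: "L1_fourier (\<lambda>_. 0) = (\<lambda>_. 0)"
  by (simp add: L1_fourier_def fun_eq_iff)

lemma L1_fourier_add:
  assumes "integrable lborel f" "integrable lborel g"
  shows "L1_fourier (\<lambda>x. f x + g x) \<omega> = L1_fourier f \<omega> + L1_fourier g \<omega>"
  unfolding L1_fourier_def
  using Bochner_Integration.integral_add[OF integrable_phase[OF assms(1)] integrable_phase[OF assms(2)], of \<omega> \<omega>]
  by (simp add: distrib_left)

lemma L1_fourier_cmult: "L1_fourier (\<lambda>x. a * f x) \<omega> = a * L1_fourier f \<omega>"
  unfolding L1_fourier_def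
  by (subst mult.left_commute[of _ a]) (simp add: mult.left_commute)

lemma gauss_spectrum_zero: "gauss_spectrum L 0 (\<lambda>_. 0)"
  by (simp add: gauss_spectrum_def)

lemma gauss_spectrum_add:
  fixes f g :: "real ^ 'n \<Rightarrow> complex"
  assumes f: "gauss_spectrum L B f" and g: "gauss_spectrum L C g"
  shows "gauss_spectrum L (B + C) (\<lambda>x. f x + g x)"
  unfolding gauss_spectrum_def
proof (intro conjI allI)
  have fi: "integrable lborel f" and gi: "integrable lborel g"
    and f2: "integrable lborel (\<lambda>x. (cmod (f x))\<^sup>2)" and g2: "integrable lborel (\<lambda>x. (cmod (g x))\<^sup>2)"
    using f g by (auto simp: gauss_spectrum_def)
  then have [measurable]: "f \<in> borel_measurable borel" "g \<in> borel_measurable borel" by auto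
  show "continuous_on UNIV (\<lambda>x. f x + g x)" using f g by (auto simp: gauss_spectrum_def intro: continuous_intros)
  show "integrable lborel (\<lambda>x. f x + g x)" using fi gi by simp
  show "integrable lborel (\<lambda>x. (cmod (f x + g x))\<^sup>2)"
  proof (rule Bochner_Integration.integrable_bound)
    show "integrable lborel (\<lambda>x. 2 * (cmod (f x))\<^sup>2 + 2 * (cmod (g x))\<^sup>2)"
      using f2 g2 by simp
    show "AE x in lborel. norm ((cmod (f x + g x))\<^sup>2) \<le> norm (2 * (cmod (f x))\<^sup>2 + 2 * (cmod (g x))\<^sup>2)"
    proof (rule AE_I2)
      fix x
      have "(cmod (f x + g x))\<^sup>2 \<le> (cmod (f x) + cmod (g x))\<^sup>2" by (intro power_mono norm_triangle_ineq) auto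
      also have "\<dots> \<le> 2 * (cmod (f x))\<^sup>2 + 2 * (cmod (g x))\<^sup>2"
        using sum_squares_bound[of "cmod (f x)" "cmod (g x)"] by (simp add: power2_sum)
      finally show "norm ((cmod (f x + g x))\<^sup>2) \<le> norm (2 * (cmod (f x))\<^sup>2 + 2 * (cmod (g x))\<^sup>2)" by simp
    qed
  qed measurable
  fix \<omega> :: "real^'n"
  let ?e = "exp (- ((norm \<omega>)\<^sup>2 / (4 * L\<^sup>2)))"
  have "cmod (L1_fourier (\<lambda>x. f x + g x) \<omega>) \<le> cmod (L1_fourier f \<omega>) + cmod (L1_fourier g \<omega>)"
    unfolding L1_fourier_add[OF fi gi] by (rule norm_triangle_ineq)
  also have "\<dots> \<le> B * ?e + C * ?e" using f g by (intro add_mono) (auto simp: gauss_spectrum_def)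
  finally show "cmod (L1_fourier (\<lambda>x. f x + g x) \<omega>) \<le> (B + C) * ?e" by (simp add: distrib_right)
qed

lemma gauss_spectrum_cmult:
  assumes f: "gauss_spectrum L B f"
  shows "gauss_spectrum L (cmod a * B) (\<lambda>x. a * f x)"
  using f unfolding gauss_spectrum_def
  by (auto intro!: continuous_intros mult_left_mono simp: norm_mult power_mult_distrib L1_fourier_cmult mult.assoc)

lemma gauss_spectrum_mono:
  assumes "gauss_spectrum L B f" "B \<le> C"
  shows "gauss_spectrum L C f"
proof -
  have "B * exp (- ((norm \<omega>)\<^sup>2 / (4 * L\<^sup>2))) \<le> C * exp (- ((norm \<omega>)\<^sup>2 / (4 * L\<^sup>2)))" for \<omega> :: "real^'n"
    using assms(2) by (rule mult_right_mono) simp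
  with assms(1) show ?thesis unfolding gauss_spectrum_def by (meson order_trans)
qed

lemma gauss_spectrum_sum:
  assumes "\<And>i. i \<in> A \<Longrightarrow> gauss_spectrum L (B i) (f i)"
  shows "gauss_spectrum L (sum B A) (\<lambda>x. \<Sum>i\<in>A. f i x)"
  using assms
  by (induction A rule: infinite_finite_induct) (auto intro: gauss_spectrum_zero gauss_spectrum_add)

lemma gauss_spectrum_sum_list:
  assumes "\<And>i. i \<in> set l \<Longrightarrow> gauss_spectrum L (B i) (f i)"
  shows "gauss_spectrum L (sum_list (map B l)) (\<lambda>x. \<Sum>i\<leftarrow>l. f i x)"
  using assms
  by (induction l) (auto intro: gauss_spectrum_zero gauss_spectrum_add)

text \<open>The value at frequency 0 of the transform of a Gaussian with shape parameter
  \<open>d\<close>.\<close>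

definition gauss_amplitude :: "'n::finite itself \<Rightarrow> real \<Rightarrow> real" where
  "gauss_amplitude _ d = fourier_const TYPE('n) * (pi / d\<^sup>2) powr (real CARD('n) / 2)"

text \<open>The centre contributes a mere phase, and a smaller shape parameter means faster decay in
  frequency, so the Gaussian of the larger parameter \<open>L\<close> is a majorant.\<close>

lemma gauss_spectrum_gauss:
  fixes c :: "real ^ 'n"
  assumes d: "0 < d" "d \<le> L"
  shows "gauss_spectrum L (gauss_amplitude TYPE('n) d) (\<lambda>x. of_real (gauss d (x - c)))"
  unfolding gauss_spectrum_def
proof (intro conjI allI)
  let ?g = "\<lambda>x::real^'n. complex_of_real (exp (- (d\<^sup>2 * (norm x)\<^sup>2)))"
  have eq: "(\<lambda>x. complex_of_real (gauss d (x - c))) = (\<lambda>x. ?g (- c + x))" by (simp add: gauss_def)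
  have gm: "?g \<in> borel_measurable borel" by measurable
  have d2: "0 < d\<^sup>2" using d by simp
  show "continuous_on UNIV (\<lambda>x. complex_of_real (gauss d (x - c)))"
    unfolding gauss_def by (intro continuous_intros)
  show "integrable lborel (\<lambda>x. complex_of_real (gauss d (x - c)))"
    unfolding eq lborel_translate(1)[OF gm] by (intro integrable_of_real gaussian_integral d2)
  have eq2: "(\<lambda>x. (cmod (complex_of_real (gauss d (x - c))))\<^sup>2) = (\<lambda>x. exp (- ((2 * d\<^sup>2) * (norm (- c + x))\<^sup>2)))"
    by (simp add: gauss_def fun_eq_iff flip: exp_double)
  have gm2: "(\<lambda>x::real^'n. exp (- ((2 * d\<^sup>2) * (norm x)\<^sup>2))) \<in> borel_measurable borel" by measurable
  show "integrable lborel (\<lambda>x. (cmod (complex_of_real (gauss d (x - c))))\<^sup>2)"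
    unfolding eq2 lborel_translate(1)[OF gm2] using d2 by (intro gaussian_integral) simp
  fix \<omega> :: "real^'n"
  let ?e = "exp (- ((norm \<omega>)\<^sup>2 / (4 * d\<^sup>2)))"
  have pm: "(\<lambda>y. cis (- (y \<bullet> \<omega>)) * (cis (- (c \<bullet> \<omega>)) * ?g y)) \<in> borel_measurable borel" unfolding cis_conv_exp by measurable
  have "(LINT y|lborel. cis (- (y \<bullet> \<omega>)) * of_real (gauss d (y - c))) =
      (LINT y|lborel. (\<lambda>y. cis (- (y \<bullet> \<omega>)) * (cis (- (c \<bullet> \<omega>)) * ?g y)) (- c + y))"
  proof (intro Bochner_Integration.integral_cong refl)
    fix y
    have "- (y \<bullet> \<omega>) = - ((- c + y) \<bullet> \<omega>) + - (c \<bullet> \<omega>)" by (simp add: inner_diff_left)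
    then have "cis (- (y \<bullet> \<omega>)) = cis (- ((- c + y) \<bullet> \<omega>)) * cis (- (c \<bullet> \<omega>))" by (simp only: cis_mult)
    then show "cis (- (y \<bullet> \<omega>)) * of_real (gauss d (y - c)) = cis (- ((- c + y) \<bullet> \<omega>)) * (cis (- (c \<bullet> \<omega>)) * ?g (- c + y))"
      by (simp add: gauss_def)
  qed
  also have "\<dots> = (LINT y|lborel. cis (- (y \<bullet> \<omega>)) * (cis (- (c \<bullet> \<omega>)) * ?g y))"
    by (rule lborel_translate(2)[OF pm])
  also have "\<dots> = (LINT y|lborel. cis (- (c \<bullet> \<omega>)) * (cis (- \<omega> \<bullet> y) * ?g y))"
    by (intro Bochner_Integration.integral_cong refl) (simp add: inner_commute mult.left_commute)
  also have "\<dots> = cis (- (c \<bullet> \<omega>)) * of_real ((pi / d\<^sup>2) powr (DIM(real^'n) / 2) * exp (- ((norm (- \<omega>))\<^sup>2 / (4 * d\<^sup>2))))"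
    unfolding integral_mult_right_zero gaussian_fourier(2)[OF d2] ..
  finally have "cmod (L1_fourier (\<lambda>x. of_real (gauss d (x - c))) \<omega>) = gauss_amplitude TYPE('n) d * ?e"
    using fourier_const_pos[where 'n='n] by (simp add: L1_fourier_def norm_mult gauss_amplitude_def)
  also have "\<dots> \<le> gauss_amplitude TYPE('n) d * exp (- ((norm \<omega>)\<^sup>2 / (4 * L\<^sup>2)))"
  proof (rule mult_left_mono)
    have "(norm \<omega>)\<^sup>2 / (4 * L\<^sup>2) \<le> (norm \<omega>)\<^sup>2 / (4 * d\<^sup>2)" using d by (intro divide_left_mono mult_left_mono power_mono) auto
    then show "?e \<le> exp (- ((norm \<omega>)\<^sup>2 / (4 * L\<^sup>2)))" by simp
  qed (use fourier_const_pos[where 'n='n] in \<open>simp add: gauss_amplitude_def\<close>)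
  finally show "cmod (L1_fourier (\<lambda>x. of_real (gauss d (x - c))) \<omega>) \<le> gauss_amplitude TYPE('n) d * exp (- ((norm \<omega>)\<^sup>2 / (4 * L\<^sup>2)))" .
qed

text \<open>The squared majorant decays like exp (-|\<omega>|^2 / (2 L^2)), while for L \<le>
  \<delta> the weight grows at most like exp (|\<omega>|^2 / (4 L^2)). A Gaussian that is
  independent of \<delta> remains.\<close>

lemma gauss_spectrum_native:
  fixes f :: "real ^ 'n \<Rightarrow> complex"
  assumes f: "gauss_spectrum L B f" and L: "0 < L" "L \<le> \<delta>"
  shows "f \<in> native_space \<delta>"
    and "native_norm \<delta> f \<le> B * sqrt (LINT \<omega>::real^'n|lborel. exp (- (1 / (4 * L\<^sup>2) * (norm \<omega>)\<^sup>2)))"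
proof -
  have cont: "continuous_on UNIV f" and f1: "integrable lborel f" and f2: "integrable lborel (\<lambda>x. (cmod (f x))\<^sup>2)"
    and b: "\<And>\<omega>. cmod (L1_fourier f \<omega>) \<le> B * exp (- ((norm \<omega>)\<^sup>2 / (4 * L\<^sup>2)))"
    using f by (auto simp: gauss_spectrum_def)
  have [measurable]: "f \<in> borel_measurable borel" using f1 by auto
  have [measurable]: "native_weight \<delta> \<in> borel_measurable (borel :: (real^'n) measure)" unfolding native_weight_def by measurable
  have B: "0 \<le> B" using order_trans[OF norm_ge_zero b[of 0]] by simp
  let ?G = "\<lambda>\<omega>::real^'n. exp (- (1 / (4 * L\<^sup>2) * (norm \<omega>)\<^sup>2))"
  have G: "integrable lborel ?G" using L by (intro gaussian_integral) simp
  have le: "(cmod (L1_fourier f \<omega>))\<^sup>2 * native_weight \<delta> \<omega> \<le> B\<^sup>2 * ?G \<omega>" for \<omega>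
  proof -
    have "(cmod (L1_fourier f \<omega>))\<^sup>2 \<le> B\<^sup>2 * (exp (- ((norm \<omega>)\<^sup>2 / (4 * L\<^sup>2))))\<^sup>2"
      using power_mono[OF b[of \<omega>] norm_ge_zero, of 2] by (simp add: power_mult_distrib)
    moreover have "native_weight \<delta> \<omega> \<le> exp ((norm \<omega>)\<^sup>2 / (4 * L\<^sup>2))"
      unfolding native_weight_def exp_le_cancel_iff using L by (intro divide_left_mono mult_left_mono power_mono) auto
    ultimately have "(cmod (L1_fourier f \<omega>))\<^sup>2 * native_weight \<delta> \<omega> \<le> B\<^sup>2 * (exp (- ((norm \<omega>)\<^sup>2 / (4 * L\<^sup>2))))\<^sup>2 * exp ((norm \<omega>)\<^sup>2 / (4 * L\<^sup>2))"
      by (intro mult_mono) (auto simp: native_weight_def)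
    also have "\<dots> = B\<^sup>2 * ?G \<omega>"
      by (simp add: power2_eq_square mult.assoc flip: exp_add)
    finally show ?thesis .
  qed
  have w0: "0 \<le> (cmod (L1_fourier f \<omega>))\<^sup>2 * native_weight \<delta> \<omega>" for \<omega> by (simp add: native_weight_def)
  have int: "integrable lborel (\<lambda>\<omega>. (cmod (L1_fourier f \<omega>))\<^sup>2 * native_weight \<delta> \<omega>)"
  proof (rule Bochner_Integration.integrable_bound[OF integrable_mult_right[OF G, of "B\<^sup>2"]])
    show "AE \<omega> in lborel. norm ((cmod (L1_fourier f \<omega>))\<^sup>2 * native_weight \<delta> \<omega>) \<le> norm (B\<^sup>2 * ?G \<omega>)"
      by (intro AE_I2) (use le w0 in \<open>simp only: real_norm_def abs_of_nonneg\<close>, simp)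
  qed measurable
  note ns = native_spaceI[OF cont f1 f2 int]
  show "f \<in> native_space \<delta>" by (rule ns)
  have "(LINT \<omega>|lborel. (cmod (L1_fourier f \<omega>))\<^sup>2 * native_weight \<delta> \<omega>) \<le> (LINT \<omega>|lborel. B\<^sup>2 * ?G \<omega>)"
    by (intro integral_mono int integrable_mult_right G le)
  then have "(LINT \<omega>|lborel. (cmod (L1_fourier f \<omega>))\<^sup>2 * native_weight \<delta> \<omega>) \<le> B\<^sup>2 * (LINT \<omega>|lborel. ?G \<omega>)"
    by (simp only: integral_mult_right_zero)
  then have "native_norm \<delta> f \<le> sqrt (B\<^sup>2 * (LINT \<omega>|lborel. ?G \<omega>))" unfolding ns(2) by (rule real_sqrt_le_mono)
  then show "native_norm \<delta> f \<le> B * sqrt (LINT \<omega>|lborel. ?G \<omega>)" using B by (simp add: real_sqrt_mult)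
qed

text \<open>The last shape parameter of a branch is the largest one, so its Gaussian dominates the Fourier transforms of
  all Gaussians on the branch. For this reason the constant does not depend on \<open>\<delta>\<close>.\<close>

definition srt_constant :: "'n::finite itself \<Rightarrow> real list \<Rightarrow> nat list \<Rightarrow> real" where
  "srt_constant t ds ks = (\<Sum>(d, k)\<leftarrow>zip ds ks. real k * gauss_amplitude t d) *
    sqrt (LINT \<omega>::real^'n|lborel. exp (- (1 / (4 * (last ds)\<^sup>2) * (norm \<omega>)\<^sup>2)))"

lemma srt_prediction_native:
  fixes f :: "real ^ 'n \<Rightarrow> complex"
  assumes srt: "is_srt S X f T" and p: "p \<in> branches T" and \<delta>: "shape (last p) \<le> \<delta>"
  shows "srt_prediction p \<in> native_space \<delta>"
    and "native_norm \<delta> (srt_prediction p) \<le>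
      srt_constant TYPE('n) (map shape p) (map (\<lambda>n. length (centers n)) p) * inverse (srt_tau p) * vec_norm2 (sample f X)"
proof -
  note b = srt_path_bounds[OF srt p]
  let ?L = "shape (last p)" and ?t = "inverse (srt_tau p) * vec_norm2 (sample f X)"
  let ?A = "gauss_amplitude TYPE('n)"
  have A: "0 \<le> ?A d" for d using fourier_const_pos[where 'n='n] by (simp add: gauss_amplitude_def)
  have L: "0 < ?L" using b(1) b(5) by simp
  \<comment> \<open>Every coefficient has modulus at most \<open>?t\<close>, so a node contributes
    one amplitude times \<open>?t\<close> for each of its centers.\<close>
  have node: "gauss_spectrum ?L (real (length (centers n)) * ?A (shape n) * ?t) (node_approx n)" if n: "n \<in> set p" for n
  proof -
    have "gauss_spectrum ?L (\<Sum>j<length (centers n). ?t * ?A (shape n))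
      (\<lambda>x. \<Sum>j<length (centers n). Matrix.vec_index (coeffs n) j * of_real (gauss (shape n) (x - centers n ! j)))"
    proof (rule gauss_spectrum_sum)
      fix j assume j: "j \<in> {..<length (centers n)}"
      show "gauss_spectrum ?L (?t * ?A (shape n)) (\<lambda>x. Matrix.vec_index (coeffs n) j * of_real (gauss (shape n) (x - centers n ! j)))"
        by (rule gauss_spectrum_mono[OF gauss_spectrum_cmult[OF gauss_spectrum_gauss[OF b(5)[OF n] b(6)[OF n]]]])
          (use b(7)[OF n] j A in \<open>intro mult_right_mono, auto\<close>)
    qed
    then show ?thesis by (simp add: node_approx_def[abs_def] mult_ac)
  qed
  have s: "gauss_spectrum ?L (\<Sum>n\<leftarrow>p. real (length (centers n)) * ?A (shape n) * ?t) (srt_prediction p)"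
    unfolding srt_prediction_def[abs_def] by (rule gauss_spectrum_sum_list[OF node])
  show "srt_prediction p \<in> native_space \<delta>" by (rule gauss_spectrum_native(1)[OF s L \<delta>])
  have "native_norm \<delta> (srt_prediction p) \<le> (\<Sum>n\<leftarrow>p. real (length (centers n)) * ?A (shape n) * ?t) *
      sqrt (LINT \<omega>::real^'n|lborel. exp (- (1 / (4 * ?L\<^sup>2) * (norm \<omega>)\<^sup>2)))"
    by (rule gauss_spectrum_native(2)[OF s L \<delta>])
  also have "(\<Sum>n\<leftarrow>p. real (length (centers n)) * ?A (shape n) * ?t) = (\<Sum>n\<leftarrow>p. real (length (centers n)) * ?A (shape n)) * ?t"
    by (simp add: sum_list_mult_const)
  also have "(\<Sum>n\<leftarrow>p. real (length (centers n)) * ?A (shape n)) =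
      (\<Sum>(d, k)\<leftarrow>zip (map shape p) (map (\<lambda>n. length (centers n)) p). real k * ?A d)"
    by (simp add: zip_map_map zip_same_conv_map o_def)
  finally show "native_norm \<delta> (srt_prediction p) \<le>
      srt_constant TYPE('n) (map shape p) (map (\<lambda>n. length (centers n)) p) * inverse (srt_tau p) * vec_norm2 (sample f X)"
    using b(1) by (simp add: srt_constant_def last_map mult_ac)
qed

section \<open>Sampling inequality\<close>

lemma partial_deriv_cong_open:
  assumes U: "open U" and eq: "\<And>x. x \<in> U \<Longrightarrow> f x = g x" and x: "x \<in> U"
  shows "partial_deriv i f x = partial_deriv i g x"
  unfolding partial_deriv_def
proof (rule vector_derivative_cong_eq)
  have "((\<lambda>t. x + t *\<^sub>R axis i 1) \<longlongrightarrow> x + 0 *\<^sub>R axis i 1) (nhds (0::real))"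
    by (intro tendsto_intros) (simp add: filterlim_ident)
  then have "eventually (\<lambda>t::real. x + t *\<^sub>R axis i 1 \<in> U) (nhds 0)"
    using topological_tendstoD[OF _ U] x by fastforce
  then show "\<forall>\<^sub>F t in nhds 0. t \<in> UNIV \<longrightarrow> f (x + t *\<^sub>R axis i 1) = g (x + t *\<^sub>R axis i 1)"
    by eventually_elim (use eq in simp)
qed auto

text \<open>The residual agrees with a difference of native functions on the open domain only, so
  its derivatives must not see values outside.\<close>

lemma mderiv_cong_open:
  fixes f g :: "real ^ 'n \<Rightarrow> complex"
  assumes U: "open U" and eq: "\<And>x. x \<in> U \<Longrightarrow> f x = g x" and x: "x \<in> U"
  shows "mderiv \<gamma> f x = mderiv \<gamma> g x"
proof -
  have iter: "\<forall>x\<in>U. (partial_deriv i ^^ a) f x = (partial_deriv i ^^ a) g x" if "\<forall>x\<in>U. f x = g x"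
    for i a and f g :: "real ^ 'n \<Rightarrow> complex"
    using that by (induction a) (auto intro: partial_deriv_cong_open[OF U])
  have "\<forall>x\<in>U. foldr (\<lambda>i. partial_deriv i ^^ \<gamma> i) l f x = foldr (\<lambda>i. partial_deriv i ^^ \<gamma> i) l g x" for l
    using eq iter by (induction l) auto
  then show ?thesis using x by (simp add: mderiv_def)
qed

text \<open>One constant for all exponents: the summand 1 covers q = \<infinity>, and the power of
  the volume covers finite q.\<close>

lemma Lq_norm_le:
  fixes f :: "real ^ 'n \<Rightarrow> complex"
  assumes q: "1 \<le> q" and meas: "f \<in> borel_measurable (lebesgue_on D)" and D: "D \<in> lmeasurable"
    and M: "0 \<le> M" "\<And>x. x \<in> D \<Longrightarrow> cmod (f x) \<le> M"
  shows "Lq_norm q D f \<le> ereal ((1 + measure lebesgue D powr (1 / real_of_ereal q)) * M)"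
proof -
  let ?\<mu> = "measure lebesgue D" and ?M = "lebesgue_on D"
  have V: "M \<le> (1 + ?\<mu> powr (1 / real_of_ereal q)) * M"
    using M(1) by (simp add: distrib_right)
  have sp: "space ?M = D" by simp
  show ?thesis
  proof (cases "q = \<infinity>")
    case True
    have "esssup ?M (\<lambda>x. ereal (cmod (f x))) \<le> ereal M"
      using meas M(2) by (intro esssup_I borel_measurable_ereal borel_measurable_norm) auto
    also have "\<dots> \<le> ereal ((1 + ?\<mu> powr (1 / real_of_ereal q)) * M)" using V by simp
    finally show ?thesis using meas True by (simp add: Lq_norm_def)
  next
    case False
    then obtain r where r: "q = ereal r" "1 \<le> r" using q by (cases q) auto
    let ?I = "\<integral>\<^sup>+ x. ennreal (cmod (f x) powr r) \<partial>?M"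
    have fin: "emeasure ?M D = ennreal ?\<mu>"
    proof -
      have "emeasure ?M D = emeasure lebesgue D"
        using fmeasurableD[OF D] by (intro emeasure_restrict_space) simp_all
      then show ?thesis using emeasure_eq_measure2[OF D] by (simp only:)
    qed
    have "?I \<le> (\<integral>\<^sup>+ x. ennreal (M powr r) \<partial>?M)"
      using M(2) r by (intro nn_integral_mono ennreal_leI powr_mono2) auto
    also have "\<dots> = ennreal (M powr r * ?\<mu>)"
      by (simp add: fin ennreal_mult)
    finally have I: "?I \<le> ennreal (M powr r * ?\<mu>)" .
    then have "?I \<noteq> \<infinity>" by (metis ennreal_less_top infinity_ennreal_def leD)
    moreover have "enn2real ?I \<le> M powr r * ?\<mu>" using I by (intro enn2real_leI) auto
    then have "enn2real ?I powr (1 / r) \<le> (M powr r * ?\<mu>) powr (1 / r)"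
      using r by (intro powr_mono2) auto
    moreover have "(M powr r * ?\<mu>) powr (1 / r) = M * ?\<mu> powr (1 / r)"
      using M(1) r by (simp add: powr_mult powr_powr)
    moreover have "M * ?\<mu> powr (1 / r) \<le> (1 + ?\<mu> powr (1 / real_of_ereal q)) * M"
      using M(1) r by (simp add: algebra_simps)
    ultimately show ?thesis using meas r by (simp add: Lq_norm_def Let_def)
  qed
qed

text \<open>The logarithm of the left side is -(m/2) ln m + O(m), that of the right side is -(m/4)
  ln m + O(m). The gap in the leading coefficient swallows \<open>c1\<close>, \<open>K\<close>,
  \<open>A\<close> and \<open>g\<close>. The shape of the right side is dictated by
  \<open>degree_choice\<close>.\<close>

lemma superexponential_decay:
  fixes c1 K A :: real and g :: nat
  assumes c1: "0 < c1" and K: "0 < K" and A: "0 < A"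
  obtains m0 :: nat where "\<And>m. m \<ge> m0 \<Longrightarrow>
    c1 * real m ^ (2 * g) * K ^ m / sqrt (fact m) \<le> exp (- (real m + 1) * (ln A + 2 * ln (real m + 1)) / 8)"
proof -
  have "eventually (\<lambda>m::nat. ln c1 + 2 * real g * ln (real m) + m * ln K - (m / 2) * ln (real m) + m / 2 \<le> - (real m + 1) * (ln A + 2 * ln (real m + 1)) / 8) at_top"
    using assms by real_asymp
  then obtain m0 :: nat where m0: "\<forall>m\<ge>m0.
      ln c1 + 2 * real g * ln (real m) + m * ln K - (m / 2) * ln (real m) + m / 2 \<le> - (real m + 1) * (ln A + 2 * ln (real m + 1)) / 8"
    unfolding eventually_sequentially by (elim exE)
  show ?thesis
  proof
    fix m assume m: "m \<ge> max m0 1"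
    have mm: "0 < real m" using m by simp
    \<comment> \<open>The elementary form of Stirling's bound, m! \<ge> (m/e)^m, is precise enough,
      since errors of order m in the exponent are harmless.\<close>
    have "exp (real m * ln (real m) - real m) \<le> fact m"
    proof -
      have "real m ^ m \<le> fact m * exp (real m)" by (rule power_le_fact_exp) simp
      then have "real m ^ m * exp (- real m) \<le> fact m" by (simp add: exp_minus field_simps)
      moreover have "exp (real m * ln (real m) - real m) = real m ^ m * exp (- real m)"
        using mm by (simp add: exp_diff exp_minus exp_of_nat_mult divide_inverse)
      ultimately show ?thesis by simp
    qed
    then have "sqrt (exp (real m * ln (real m) - real m)) \<le> sqrt (fact m)" by (rule real_sqrt_le_mono)
    moreover have "sqrt (exp (real m * ln (real m) - real m)) = exp ((m / 2) * ln (real m) - m / 2)"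
      by (rule real_sqrt_unique) (simp_all add: algebra_simps flip: exp_double)
    ultimately have s: "exp ((m / 2) * ln (real m) - m / 2) \<le> sqrt (fact m)" by simp
    have "c1 * real m ^ (2 * g) * K ^ m / sqrt (fact m) \<le> c1 * real m ^ (2 * g) * K ^ m / exp ((m / 2) * ln (real m) - m / 2)"
      using s c1 K by (intro divide_left_mono) auto
    also have "\<dots> = exp (ln c1 + 2 * real g * ln (real m) + m * ln K - (m / 2) * ln (real m) + m / 2)"
    proof -
      have "real m ^ (2 * g) = exp (2 * real g * ln (real m))"
        using mm exp_of_nat_mult[of "2 * g" "ln (real m)"] by simp
      moreover have "K ^ m = exp (m * ln K)" using K exp_of_nat_mult[of m "ln K"] by simp
      moreover have "c1 = exp (ln c1)" using c1 by simp
      ultimately show ?thesis by (simp only: exp_add exp_diff) (simp add: field_simps)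
    qed
    also have "\<dots> \<le> exp (- (real m + 1) * (ln A + 2 * ln (real m + 1)) / 8)"
      using m0 m by auto
    finally show "c1 * real m ^ (2 * g) * K ^ m / sqrt (fact m) \<le> exp (- (real m + 1) * (ln A + 2 * ln (real m + 1)) / 8)" .
  qed
qed

text \<open>\<open>m\<close> is the largest degree with m^2 A h \<le> 1. Maximality bounds 1/h by A
  (m + 1)^2, and taking the logarithm and the square root of this bound expresses ln (1/h) / sqrt h
  through m.\<close>

lemma degree_choice:
  assumes A: "0 < A" and h: "0 < h" "h \<le> 1"
  obtains m :: nat where "(real m)\<^sup>2 * (A * h) \<le> 1" "1 < (real m + 1)\<^sup>2 * (A * h)"
    "exp (- (real m + 1) * (ln A + 2 * ln (real m + 1)) / 8) \<le> exp (1 / (8 * sqrt A) * ln h / sqrt h)"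
proof
  define t where "t = sqrt (A * h)"
  have t: "0 < t" "t\<^sup>2 = A * h" using A h by (auto simp: t_def)
  define m where "m = nat \<lfloor>1 / t\<rfloor>"
  have m: "real m \<le> 1 / t" "1 / t < real m + 1" using t by (auto simp: m_def)
  have "real m * t \<le> 1" using m(1) t by (simp add: field_simps)
  then have "(real m * t)\<^sup>2 \<le> 1\<^sup>2" using t by (intro power_mono) auto
  then show "(real m)\<^sup>2 * (A * h) \<le> 1" by (simp add: power_mult_distrib t)
  have "1 < (real m + 1) * t" using m(2) t by (simp add: field_simps)
  then have "1\<^sup>2 < ((real m + 1) * t)\<^sup>2" by (intro power_strict_mono) auto
  then show gt: "1 < (real m + 1)\<^sup>2 * (A * h)" by (simp add: power_mult_distrib t)
  have inv: "1 / h \<le> A * (real m + 1)\<^sup>2" using gt h by (simp add: field_simps)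
  have "ln (1 / h) \<le> ln (A * (real m + 1)\<^sup>2)" using inv h A by (subst ln_le_cancel_iff) auto
  also have "\<dots> = ln A + 2 * ln (real m + 1)" using A by (simp add: ln_mult ln_realpow)
  finally have l: "ln (1 / h) \<le> ln A + 2 * ln (real m + 1)" .
  have "sqrt (1 / h) \<le> sqrt (A * (real m + 1)\<^sup>2)" using inv by (rule real_sqrt_le_mono)
  also have "\<dots> = sqrt A * (real m + 1)" by (simp add: real_sqrt_mult)
  finally have s: "sqrt (1 / h) \<le> sqrt A * (real m + 1)" .
  \<comment> \<open>Multiplying the two estimates requires ln (1/h) \<ge> 0, which is where h \<le>
    1 enters.\<close>
  have "ln (1 / h) * sqrt (1 / h) \<le> (ln A + 2 * ln (real m + 1)) * (sqrt A * (real m + 1))"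
    using h A l by (intro mult_mono l s) (auto intro: order_trans[of 0 "ln (1 / h)"])
  then have "1 / (8 * sqrt A) * (ln (1 / h) * sqrt (1 / h)) \<le> 1 / (8 * sqrt A) * ((ln A + 2 * ln (real m + 1)) * (sqrt A * (real m + 1)))"
    using A by (intro mult_left_mono) auto
  also have "\<dots> = (real m + 1) * (ln A + 2 * ln (real m + 1)) / 8" using A by simp
  finally have "- ((real m + 1) * (ln A + 2 * ln (real m + 1)) / 8) \<le> - (1 / (8 * sqrt A) * (ln (1 / h) * sqrt (1 / h)))" by simp
  moreover have "- (1 / (8 * sqrt A) * (ln (1 / h) * sqrt (1 / h))) = 1 / (8 * sqrt A) * ln h / sqrt h"
    using h by (simp add: ln_div real_sqrt_divide)
  moreover have "- (real m + 1) * (ln A + 2 * ln (real m + 1)) / 8 = - ((real m + 1) * (ln A + 2 * ln (real m + 1)) / 8)"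
    by (simp only: mult_minus_left minus_divide_left)
  ultimately show "exp (- (real m + 1) * (ln A + 2 * ln (real m + 1)) / 8) \<le> exp (1 / (8 * sqrt A) * ln h / sqrt h)"
    by (simp only: exp_le_cancel_iff)
qed

text \<open>Bounds the loss m! / (m - g)! incurred when \<open>g\<close> derivatives lower the order
  of a Taylor remainder.\<close>

lemma fact_le_power_mult_fact: "g \<le> m \<Longrightarrow> fact m \<le> real m ^ g * fact (m - g)"
proof (induction g)
  case (Suc g)
  then have "fact m \<le> real m ^ g * fact (m - g)" by simp
  also have "m - g = Suc (m - Suc g)" using Suc.prems by simp
  also have "real m ^ g * fact (Suc (m - Suc g)) \<le> real m ^ g * (real m * fact (m - Suc g))"
    using Suc.prems by (intro mult_left_mono) (auto simp: fact_Suc intro!: mult_right_mono)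
  finally show ?case by (simp add: mult_ac)
qed simp

text \<open>The data bound the Taylor polynomial up to the remainder \<open>E\<close>;
  \<open>norming_set\<close> extends this to \<open>D\<close> at the cost of a factor 2, and
  \<open>markov_iterated\<close> differentiates the result. The remainder is differentiated through
  its spectrum.\<close>

lemma sampling_inequality_degree:
  fixes D :: "(real ^ 'n) set"
  assumes D: "convex D" "bounded D" and ball: "cball z \<rho> \<subseteq> D" and \<rho>: "0 < \<rho>"
    and R: "1 \<le> R" "D \<subseteq> cball z R"
    and F: "F \<in> native_space \<delta>" and s: "s \<in> native_space \<delta>" and \<delta>: "0 < \<delta>"
    and Y: "Y \<subseteq> D" "\<And>x. x \<in> D \<Longrightarrow> \<exists>y\<in>Y. dist x y \<le> \<kappa>" and \<kappa>: "\<kappa> * (2 * (real m)\<^sup>2 / \<rho>) \<le> 1 / 2"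
    and N: "\<And>y. y \<in> Y \<Longrightarrow> cmod (F y - s y) \<le> N"
    and m: "sum \<gamma> UNIV \<le> m" "1 \<le> m" and x: "x \<in> D"
  shows "cmod (mderiv \<gamma> (\<lambda>x. F x - s x) x) \<le>
    fourier_const TYPE('n) * sqrt (spectral_mass TYPE(real^'n) \<delta>) * (1 + 2 * (2 / \<rho>) ^ sum \<gamma> UNIV) *
      real m ^ (2 * sum \<gamma> UNIV) * (R * sqrt (8 * \<delta>\<^sup>2)) ^ m / sqrt (fact m) * (native_norm \<delta> F + native_norm \<delta> s)
    + 2 * (2 * (real m)\<^sup>2 / \<rho>) ^ sum \<gamma> UNIV * N"
proof -
  let ?G = "sum \<gamma> (UNIV :: 'n set)"
  let ?g = "diff_spectrum F s z" and ?W = "native_norm \<delta> F + native_norm \<delta> s" and ?c = "fourier_const TYPE('n)"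
  let ?I0 = "spectral_mass TYPE(real^'n) \<delta>" and ?B = "2 * (real m)\<^sup>2 / \<rho>"
  define Q where "Q = ?c * ?W * sqrt ((8 * \<delta>\<^sup>2) ^ m * fact m * ?I0)"
  define E where "E = R ^ m / fact m * Q"
  have I0: "0 \<le> ?I0" unfolding spectral_mass_def by (intro Bochner_Integration.integral_nonneg) simp
  have W: "0 \<le> ?W" by (simp add: native_norm_nonneg)
  have Q0: "0 \<le> Q" using W I0 fourier_const_pos[where 'n='n] by (simp add: Q_def)
  have am: "all_moments ?g" by (rule diff_spectrum[OF F s \<delta>])
  have u: "(\<lambda>x. F x - s x) = fourier_rem 0 ?g z" using diff_spectrum(2)[OF F s \<delta>] by (simp add: fun_eq_iff)
  have mom: "(LINT \<omega>|lborel. cmod (?g \<omega>) * norm \<omega> ^ m) \<le> Q"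
    unfolding Q_def by (rule diff_spectrum(3)[OF F s \<delta>])
  have Rn: "norm (x - z) \<le> R" if "x \<in> D" for x using R(2) that by (auto simp: dist_norm norm_minus_commute)
  have rem: "cmod (fourier_rem m ?g z x) \<le> E" if "x \<in> D" for x
    unfolding E_def using Q0 R(1) Rn[OF that]
    by (intro order_trans[OF norm_fourier_rem_le[OF am]] mult_mono divide_right_mono power_mono mom)
      (auto intro!: Bochner_Integration.integral_nonneg)
  have "cmod (fourier_poly m ?g z y) \<le> N + E" if y: "y \<in> Y" for y
  proof -
    have yD: "y \<in> D" using y Y by auto
    have "fourier_poly m ?g z y = (F y - s y) - fourier_rem m ?g z y"
      using u by (simp add: fourier_poly_def fun_eq_iff)
    then show ?thesis using norm_triangle_ineq4[of "F y - s y" "fourier_rem m ?g z y"] N[OF y] rem[OF yD] by simp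
  qed
  note poly = norming_set[OF am D ball \<rho> Y \<kappa> this]
  have dpoly: "cmod (mderiv \<gamma> (fourier_poly m ?g z) x) \<le> ?B ^ ?G * (2 * (N + E))"
    by (rule markov_iterated[OF am D(1) ball \<rho> poly x])
  obtain P where P: "P \<in> borel_measurable borel \<and> (\<forall>\<omega>. cmod (P \<omega>) \<le> norm \<omega> ^ ?G) \<and>
      (\<forall>m x0. mderiv \<gamma> (fourier_rem m ?g x0) = fourier_rem (m - ?G) (\<lambda>\<omega>. ?g \<omega> * P \<omega>) x0) \<and>
      (\<forall>m x0. mderiv \<gamma> (fourier_poly m ?g x0) = fourier_poly (m - ?G) (\<lambda>\<omega>. ?g \<omega> * P \<omega>) x0)"
    using mderiv_fourier_rem[OF am, of \<gamma>] by (elim exE)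
  have P1 [measurable]: "P \<in> borel_measurable borel" and P2: "\<And>\<omega>. cmod (P \<omega>) \<le> norm \<omega> ^ ?G"
    using P by auto
  have P3: "mderiv \<gamma> (fourier_rem m ?g x0) = fourier_rem (m - ?G) (\<lambda>\<omega>. ?g \<omega> * P \<omega>) x0" for m x0
    using P by blast
  have P4: "mderiv \<gamma> (fourier_poly m ?g x0) = fourier_poly (m - ?G) (\<lambda>\<omega>. ?g \<omega> * P \<omega>) x0" for m x0
    using P by blast
  have amP: "all_moments (\<lambda>\<omega>. ?g \<omega> * P \<omega>)" by (rule all_moments_mult[OF am P1, of 1 ?G]) (use P2 in auto)
  \<comment> \<open>Differentiation lowers the order of the remainder by |\<gamma>| but multiplies
    the spectrum by as many frequency factors, so the moment of order \<open>m\<close>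
    reappears.\<close>
  have momP: "(LINT \<omega>|lborel. cmod (?g \<omega> * P \<omega>) * norm \<omega> ^ (m - ?G)) \<le> Q"
  proof -
    have "(LINT \<omega>|lborel. cmod (?g \<omega> * P \<omega>) * norm \<omega> ^ (m - ?G)) \<le> (LINT \<omega>|lborel. cmod (?g \<omega>) * norm \<omega> ^ m)"
    proof (rule integral_mono)
      fix \<omega>
      have "cmod (P \<omega>) * norm \<omega> ^ (m - ?G) \<le> norm \<omega> ^ ?G * norm \<omega> ^ (m - ?G)"
        by (intro mult_right_mono P2) auto
      also have "\<dots> = norm \<omega> ^ m" using m(1) by (simp flip: power_add)
      finally show "cmod (?g \<omega> * P \<omega>) * norm \<omega> ^ (m - ?G) \<le> cmod (?g \<omega>) * norm \<omega> ^ m"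
        by (simp add: norm_mult mult.assoc mult_left_mono)
    qed (use am amP in \<open>auto simp: all_moments_def\<close>)
    with mom show ?thesis by simp
  qed
  have drem: "cmod (mderiv \<gamma> (fourier_rem m ?g z) x) \<le> real m ^ ?G * E"
  proof -
    have "cmod (mderiv \<gamma> (fourier_rem m ?g z) x) \<le> R ^ (m - ?G) / fact (m - ?G) * Q"
      unfolding P3 using Q0 R(1) Rn[OF x]
      by (intro order_trans[OF norm_fourier_rem_le[OF amP]] mult_mono divide_right_mono power_mono momP)
        (auto intro!: Bochner_Integration.integral_nonneg)
    also have "\<dots> \<le> real m ^ ?G * (R ^ m / fact m) * Q"
    proof (rule mult_right_mono[OF _ Q0])
      have "R ^ (m - ?G) / fact (m - ?G) \<le> R ^ m / fact (m - ?G)"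
        using R(1) by (intro divide_right_mono power_increasing) auto
      also have "\<dots> \<le> real m ^ ?G * (R ^ m / fact m)"
      proof -
        have "R ^ m * fact m \<le> R ^ m * (real m ^ ?G * fact (m - ?G))"
          using R(1) by (intro mult_left_mono fact_le_power_mult_fact m) auto
        then show ?thesis by (simp add: field_simps)
      qed
      finally show "R ^ (m - ?G) / fact (m - ?G) \<le> real m ^ ?G * (R ^ m / fact m)" .
    qed
    finally show ?thesis by (simp add: E_def mult.assoc)
  qed
  have E0: "0 \<le> E" using Q0 R(1) by (simp add: E_def)
  have "mderiv \<gamma> (\<lambda>x. F x - s x) x = mderiv \<gamma> (fourier_poly m ?g z) x + mderiv \<gamma> (fourier_rem m ?g z) x"
    unfolding u P3 P4 by (simp add: fourier_poly_def)
  then have "cmod (mderiv \<gamma> (\<lambda>x. F x - s x) x) \<le> ?B ^ ?G * (2 * (N + E)) + real m ^ ?G * E"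
    using norm_triangle_ineq[of "mderiv \<gamma> (fourier_poly m ?g z) x" "mderiv \<gamma> (fourier_rem m ?g z) x"] dpoly drem by simp
  also have "\<dots> = (2 * ?B ^ ?G + real m ^ ?G) * E + 2 * ?B ^ ?G * N" by (simp add: algebra_simps)
  \<comment> \<open>Both contributions are merged under the higher power m^(2 |\<gamma>|), which
    uses m \<ge> 1.\<close>
  also have "(2 * ?B ^ ?G + real m ^ ?G) * E \<le> ((1 + 2 * (2 / \<rho>) ^ ?G) * real m ^ (2 * ?G)) * E"
  proof (rule mult_right_mono[OF _ E0])
    have "real m ^ ?G \<le> real m ^ (2 * ?G)" using m(2) by (intro power_increasing) auto
    moreover have "?B ^ ?G = (2 / \<rho>) ^ ?G * real m ^ (2 * ?G)"
      by (simp add: power_mult power_divide power_mult_distrib)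
    ultimately show "2 * ?B ^ ?G + real m ^ ?G \<le> (1 + 2 * (2 / \<rho>) ^ ?G) * real m ^ (2 * ?G)"
      by (simp add: distrib_right)
  qed
  also have "((1 + 2 * (2 / \<rho>) ^ ?G) * real m ^ (2 * ?G)) * E = ?c * sqrt ?I0 * (1 + 2 * (2 / \<rho>) ^ ?G) *
      real m ^ (2 * ?G) * (R * sqrt (8 * \<delta>\<^sup>2)) ^ m / sqrt (fact m) * ?W"
  proof -
    have "sqrt ((8 * \<delta>\<^sup>2) ^ m * fact m * ?I0) = sqrt (8 * \<delta>\<^sup>2) ^ m * sqrt (fact m) * sqrt ?I0"
      by (simp only: real_sqrt_mult real_sqrt_power)
    then have "E = R ^ m * (?c * ?W * (sqrt (8 * \<delta>\<^sup>2) ^ m * sqrt ?I0)) * (sqrt (fact m) / fact m)"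
      unfolding E_def Q_def by (simp only: divide_inverse mult_ac)
    also have "sqrt (fact m) / fact m = inverse (sqrt (fact m :: real))" by (simp add: field_simps)
    finally show ?thesis by (simp only: power_mult_distrib divide_inverse mult_ac)
  qed
  finally show ?thesis by simp
qed

text \<open>\<open>V\<close> is a placeholder for the factor that later converts suprema into L_q
  norms. Carrying it along lets \<open>h0\<close> and \<open>C'\<close> absorb it, so that the
  exponent depends on \<open>R\<close> and \<open>\<rho>\<close> alone.\<close>

lemma sampling_inequality:
  fixes D :: "(real ^ 'n) set"
  assumes D: "convex D" "bounded D" and ball: "cball z \<rho> \<subseteq> D" and \<rho>: "0 < \<rho>"
    and R: "1 \<le> R" "D \<subseteq> cball z R" and \<delta>: "0 < \<delta>" and V: "0 < V"
  shows "\<exists>h0>0. \<exists>C'>0. \<forall>F\<in>native_space \<delta>. \<forall>s\<in>native_space \<delta>. \<forall>h Y N.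
    0 < h \<longrightarrow> h \<le> h0 \<longrightarrow> Y \<subseteq> D \<longrightarrow> (\<forall>x\<in>D. \<exists>y\<in>Y. dist x y \<le> h * (R / \<rho> + 1)) \<longrightarrow>
    (\<forall>y\<in>Y. cmod (F y - s y) \<le> N) \<longrightarrow>
    (\<forall>x\<in>D. V * cmod (mderiv \<gamma> (\<lambda>x. F x - s x) x) \<le>
      exp (1 / (8 * sqrt (4 * (R / \<rho> + 1) / \<rho>)) * ln h / sqrt h) * (native_norm \<delta> F + native_norm \<delta> s)
      + C' * h powr (- real (sum \<gamma> UNIV)) * N)"
proof -
  let ?G = "sum \<gamma> (UNIV :: 'n set)"
  \<comment> \<open>Chosen so that, for data of density \<kappa> = h (R / \<rho> + 1), the condition
    \<kappa> (2 m^2 / \<rho>) \<le> 1/2 of \<open>norming_set\<close> reads m^2 A h \<le> 1.\<close>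
  define A where "A = 4 * (R / \<rho> + 1) / \<rho>"
  have A: "0 < A" using R(1) \<rho> by (simp add: A_def add_pos_pos)
  define c0 where "c0 = fourier_const TYPE('n) * sqrt (spectral_mass TYPE(real^'n) \<delta>) * (1 + 2 * (2 / \<rho>) ^ ?G)"
  have I0: "0 \<le> spectral_mass TYPE(real^'n) \<delta>" unfolding spectral_mass_def by (intro Bochner_Integration.integral_nonneg) simp
  have c0: "0 \<le> c0" using I0 \<rho> fourier_const_pos[where 'n='n] by (simp add: c0_def)
  define K where "K = R * sqrt (8 * \<delta>\<^sup>2)"
  have K: "0 < K" using R(1) \<delta> by (simp add: K_def)
  \<comment> \<open>The right side depends on \<open>A\<close> and \<open>m\<close> only, so q,
    \<gamma> and \<delta> influence merely the threshold \<open>m0\<close>. Adding 1 keeps the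
    factor positive even if \<open>c0\<close> is 0.\<close>
  obtain m0 :: nat where m0: "\<And>m. m \<ge> m0 \<Longrightarrow>
    (V * c0 + 1) * real m ^ (2 * ?G) * K ^ m / sqrt (fact m) \<le> exp (- (real m + 1) * (ln A + 2 * ln (real m + 1)) / 8)"
  proof -
    have "0 < V * c0 + 1" using V c0 by (simp add: add_nonneg_pos)
    from superexponential_decay[OF this K A, of ?G] that show ?thesis by blast
  qed
  define m1 where "m1 = max m0 (max ?G 1)"
  \<comment> \<open>Below this threshold the chosen degree is at least \<open>m1\<close>; otherwise
    (m + 1)^2 A h would not exceed 1.\<close>
  define h0 where "h0 = min 1 (1 / ((real m1 + 1)\<^sup>2 * A))"
  \<comment> \<open>The Markov factor (2 m^2 / \<rho>)^|\<gamma>| after inserting m^2 \<le> 1 / (A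
    h), with the factor 2 of the norming set.\<close>
  define C' where "C' = V * (2 * (2 / (\<rho> * A)) ^ ?G)"
  have h0: "0 < h0" using A by (simp add: h0_def)
  have C': "0 < C'" using A \<rho> V by (simp add: C'_def)
  show ?thesis
  proof (rule exI[of _ h0], rule conjI[OF h0], rule exI[of _ C'], rule conjI[OF C'], intro ballI allI impI)
    fix F s :: "real^'n \<Rightarrow> complex" and h Y N x
    assume F: "F \<in> native_space \<delta>" and s: "s \<in> native_space \<delta>" and h: "0 < h" "h \<le> h0" and Y: "Y \<subseteq> D"
      and "\<forall>x\<in>D. \<exists>y\<in>Y. dist x y \<le> h * (R / \<rho> + 1)" "\<forall>y\<in>Y. cmod (F y - s y) \<le> N"
      and x: "x \<in> D"
    then have dense: "\<And>x. x \<in> D \<Longrightarrow> \<exists>y\<in>Y. dist x y \<le> h * (R / \<rho> + 1)" and N: "\<And>y. y \<in> Y \<Longrightarrow> cmod (F y - s y) \<le> N"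
      by auto
    have "h \<le> 1" using h by (simp add: h0_def)
    then obtain m where m: "(real m)\<^sup>2 * (A * h) \<le> 1" "1 < (real m + 1)\<^sup>2 * (A * h)"
      "exp (- (real m + 1) * (ln A + 2 * ln (real m + 1)) / 8) \<le> exp (1 / (8 * sqrt A) * ln h / sqrt h)"
      using degree_choice[OF A h(1)] by metis
    have m1: "m1 \<le> m"
    proof (rule ccontr)
      assume "\<not> m1 \<le> m"
      then have "(real m + 1)\<^sup>2 \<le> (real m1 + 1)\<^sup>2" by (intro power_mono) auto
      then have "(real m + 1)\<^sup>2 * (A * h) \<le> (real m1 + 1)\<^sup>2 * (A * h)" using A h by (intro mult_right_mono) auto
      also have "\<dots> \<le> (real m1 + 1)\<^sup>2 * (A * (1 / ((real m1 + 1)\<^sup>2 * A)))"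
        using h A by (intro mult_left_mono) (auto simp: h0_def)
      also have "\<dots> = 1" using A by (simp add: add_nonneg_eq_0_iff)
      finally show False using m(2) by simp
    qed
    have N0: "0 \<le> N" using dense[OF x] N norm_ge_zero order_trans by blast
    have \<kappa>: "h * (R / \<rho> + 1) * (2 * (real m)\<^sup>2 / \<rho>) \<le> 1 / 2"
    proof -
      have "h * (R / \<rho> + 1) * (2 * (real m)\<^sup>2 / \<rho>) = (real m)\<^sup>2 * (A * h) / 2"
        using \<rho> by (simp add: A_def field_simps)
      with m(1) show ?thesis by simp
    qed
    have G: "?G \<le> m" "1 \<le> m" using m1 by (auto simp: m1_def)
    note main = sampling_inequality_degree[OF D ball \<rho> R F s \<delta> Y dense \<kappa> N G x, folded K_def c0_def]
    let ?W = "native_norm \<delta> F + native_norm \<delta> s"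
    let ?X = "real m ^ (2 * ?G) * K ^ m / sqrt (fact m)"
    have W: "0 \<le> ?W" by (simp add: native_norm_nonneg)
    have X: "0 \<le> ?X" using K by simp
    have "V * cmod (mderiv \<gamma> (\<lambda>x. F x - s x) x) \<le> V * (c0 * real m ^ (2 * ?G) * K ^ m / sqrt (fact m) * ?W + 2 * (2 * (real m)\<^sup>2 / \<rho>) ^ ?G * N)"
      using main V by (intro mult_left_mono) auto
    also have "\<dots> = (V * c0) * ?X * ?W + V * (2 * (2 * (real m)\<^sup>2 / \<rho>) ^ ?G) * N"
      by (simp add: algebra_simps)
    also have "\<dots> \<le> exp (1 / (8 * sqrt A) * ln h / sqrt h) * ?W + C' * h powr (- real ?G) * N"
    proof (intro add_mono mult_right_mono W N0)
      have "(V * c0) * ?X \<le> (V * c0 + 1) * ?X" using X by (intro mult_right_mono) auto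
      also have "\<dots> \<le> exp (- (real m + 1) * (ln A + 2 * ln (real m + 1)) / 8)"
        using m0[of m] m1 by (simp add: m1_def mult.assoc)
      finally show "(V * c0) * ?X \<le> exp (1 / (8 * sqrt A) * ln h / sqrt h)" using m(3) by linarith
      have "2 * (real m)\<^sup>2 / \<rho> \<le> 2 / (\<rho> * A) * (1 / h)"
        using m(1) A h \<rho> by (simp add: field_simps)
      then have "(2 * (real m)\<^sup>2 / \<rho>) ^ ?G \<le> (2 / (\<rho> * A) * (1 / h)) ^ ?G"
        using \<rho> by (intro power_mono) auto
      also have "\<dots> = (2 / (\<rho> * A)) ^ ?G * h powr (- real ?G)"
      proof -
        have "(1 / h) ^ n = h powr (- real n)" for n
          using h by (simp add: powr_minus powr_realpow divide_inverse power_inverse)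
        then show ?thesis by (simp only: power_mult_distrib)
      qed
      finally show "V * (2 * (2 * (real m)\<^sup>2 / \<rho>) ^ ?G) \<le> C' * h powr (- real ?G)"
        using V by (simp add: C'_def mult.assoc mult_left_mono)
    qed
    finally show "V * cmod (mderiv \<gamma> (\<lambda>x. F x - s x) x) \<le>
        exp (1 / (8 * sqrt (4 * (R / \<rho> + 1) / \<rho>)) * ln h / sqrt h) * ?W + C' * h powr (- real ?G) * N"
      unfolding A_def .
  qed
qed

section \<open>From the sampling inequality to residuals of trees\<close>

lemma fourier_rem_measurable:
  fixes g :: "real ^ 'n \<Rightarrow> complex"
  assumes [measurable]: "g \<in> borel_measurable borel"
  shows "fourier_rem m g x0 \<in> borel_measurable borel"
  unfolding fourier_rem_def by measurable

text \<open>A real fill distance means that finitely many balls cover the set; it is positive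
  because a nonempty open set is infinite.\<close>

lemma fill_distance_finite:
  assumes X: "finite X" "X \<noteq> {}" and S: "open S" "S \<noteq> {}" and h: "ereal h = fill_distance X S"
  shows "0 < h" "bounded S"
proof -
  show "0 < h"
  proof (rule ccontr)
    assume "\<not> 0 < h"
    have "x \<in> X" if x: "x \<in> S" for x
    proof -
      obtain y where "y \<in> X" "dist x y \<le> h" using fill_distance_attained[OF X h x] .
      with \<open>\<not> 0 < h\<close> show ?thesis by (metis dist_le_zero_iff linorder_not_less order_trans)
    qed
    then have "S \<subseteq> X" by blast
    then have "finite S" using X by (auto intro: finite_subset)
    then show False using S finite_imp_not_open by blast
  qed
  have "S \<subseteq> (\<Union>y\<in>X. cball y h)"
  proof
    fix x assume x: "x \<in> S"
    obtain y where "y \<in> X" "dist x y \<le> h" using fill_distance_attained[OF X h x] .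
    then show "x \<in> (\<Union>y\<in>X. cball y h)" by (auto simp: dist_commute)
  qed
  moreover have "bounded (\<Union>y\<in>X. cball y h)" using X by auto
  ultimately show "bounded S" by (rule bounded_subset[rotated])
qed

lemma srt_native_norm:
  fixes f :: "real ^ 'n \<Rightarrow> complex"
  assumes srt: "is_srt S X f T" and p: "p \<in> branches T" and \<delta>: "shape (last p) < \<delta>"
  shows "srt_prediction p \<in> native_space_on \<delta> (region (last p))"
    and "native_norm_on \<delta> (region (last p)) (srt_prediction p) = native_norm \<delta> (srt_prediction p)"
proof -
  obtain r where r: "srt_node_ok X r (last p)" using srt_path_bounds(3)[OF srt p] by blast
  then have \<delta>0: "0 < \<delta>" and int: "interior (region (last p)) \<noteq> {}" using \<delta> by (auto simp: srt_node_ok_def)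
  have s: "srt_prediction p \<in> native_space \<delta>"
    using srt_prediction_native(1)[OF srt p] \<delta> by simp
  note ext = native_extension_self[OF s \<delta>0 int]
  show "srt_prediction p \<in> native_space_on \<delta> (region (last p))"
    using ext unfolding native_space_on_def by blast
  show "native_norm_on \<delta> (region (last p)) (srt_prediction p) = native_norm \<delta> (srt_prediction p)"
    by (simp add: native_norm_on_def ext)
qed

text \<open>\<open>Lq_norm\<close> is infinite for nonmeasurable functions, so the pointwise bound
  must be accompanied by measurability of the derivative, which holds because the derivative is
  again a Fourier integral.\<close>

lemma srt_residual_Lq_bound:
  fixes D S :: "(real ^ 'n) set"
  assumes D: "convex D" "bounded D" "D \<subseteq> S" and S: "open S" and q: "1 \<le> q"
    and F: "F \<in> native_space \<delta>" and s: "s \<in> native_space \<delta>" and \<delta>: "0 < \<delta>"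
    and r: "\<And>x. x \<in> S \<Longrightarrow> r x = F x - s x"
    and B: "0 \<le> B" "\<And>x. x \<in> D \<Longrightarrow> (1 + measure lebesgue D powr (1 / real_of_ereal q)) * cmod (mderiv \<gamma> (\<lambda>x. F x - s x) x) \<le> B"
  shows "Lq_norm q D (mderiv \<gamma> r) \<le> ereal B"
proof -
  let ?V = "1 + measure lebesgue D powr (1 / real_of_ereal q)"
  have V: "0 < ?V" by (simp add: add_pos_nonneg)
  have eq: "mderiv \<gamma> r x = mderiv \<gamma> (\<lambda>x. F x - s x) x" if "x \<in> D" for x
    by (rule mderiv_cong_open[OF S r]) (use that D(3) in auto)
  have DL: "D \<in> lmeasurable" using D by (intro measurable_convex)
  let ?g = "diff_spectrum F s 0"
  have am: "all_moments ?g" by (rule diff_spectrum[OF F s \<delta>])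
  have u: "(\<lambda>x. F x - s x) = fourier_rem 0 ?g 0" using diff_spectrum(2)[OF F s \<delta>] by (simp add: fun_eq_iff)
  obtain P where P: "P \<in> borel_measurable borel \<and> (\<forall>\<omega>. cmod (P \<omega>) \<le> norm \<omega> ^ sum \<gamma> UNIV) \<and>
      (\<forall>m x0. mderiv \<gamma> (fourier_rem m ?g x0) = fourier_rem (m - sum \<gamma> UNIV) (\<lambda>\<omega>. ?g \<omega> * P \<omega>) x0) \<and>
      (\<forall>m x0. mderiv \<gamma> (fourier_poly m ?g x0) = fourier_poly (m - sum \<gamma> UNIV) (\<lambda>\<omega>. ?g \<omega> * P \<omega>) x0)"
    using mderiv_fourier_rem[OF am, of \<gamma>] by (elim exE)
  have [measurable]: "P \<in> borel_measurable borel" "?g \<in> borel_measurable borel"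
    using P all_moments_measurable[OF am] by auto
  \<comment> \<open>By truncated subtraction the order stays 0, so the derivative is a full Fourier
    integral.\<close>
  have du: "mderiv \<gamma> (\<lambda>x. F x - s x) = fourier_rem (0 - sum \<gamma> UNIV) (\<lambda>\<omega>. ?g \<omega> * P \<omega>) 0"
    unfolding u using P by blast
  have "mderiv \<gamma> (\<lambda>x. F x - s x) \<in> borel_measurable lborel"
    unfolding du by (simp add: fourier_rem_measurable)
  then have "mderiv \<gamma> (\<lambda>x. F x - s x) \<in> borel_measurable (lebesgue_on D)"
    by (intro measurable_restrict_space1 measurable_completion)
  then have meas: "mderiv \<gamma> r \<in> borel_measurable (lebesgue_on D)"
    by (subst measurable_cong[where g="mderiv \<gamma> (\<lambda>x. F x - s x)"]) (simp_all add: eq)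
  have "Lq_norm q D (mderiv \<gamma> r) \<le> ereal (?V * (B / ?V))"
  proof (rule Lq_norm_le[OF q meas DL])
    show "0 \<le> B / ?V" using B(1) V by simp
    show "cmod (mderiv \<gamma> r x) \<le> B / ?V" if "x \<in> D" for x
      unfolding eq[OF that] pos_le_divide_eq[OF V] using B(2)[OF that] by (simp only: mult.commute)
  qed
  then show ?thesis using V by simp
qed

text \<open>Isolates the estimate whose constants must be fixed before the domain, the data and the
  tree. The variable \<open>c\<close> stands for any constant for which the norm bound on the
  prediction holds.\<close>

definition srt_sampling_bound ::
  "(real ^ 'n) set \<Rightarrow> ereal \<Rightarrow> ('n::finite \<Rightarrow> nat) \<Rightarrow> real \<Rightarrow> real \<Rightarrow> real \<Rightarrow> real \<Rightarrow> bool" where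
  "srt_sampling_bound D q \<gamma> \<delta> C h0 C' \<longleftrightarrow>
    (\<forall>\<Omega> X f T p h c. is_srt \<Omega> X f T \<longrightarrow> p \<in> branches T \<longrightarrow> region (last p) = D \<longrightarrow>
      shape (last p) < \<delta> \<longrightarrow> f \<in> native_space_on \<delta> \<Omega> \<longrightarrow>
      ereal h = fill_distance (set X) \<Omega> \<longrightarrow> h \<le> h0 \<longrightarrow>
      native_norm_on \<delta> D (srt_prediction p) \<le> c * inverse (srt_tau p) * vec_norm2 (sample f X) \<longrightarrow>
      Lq_norm q D (mderiv \<gamma> (srt_residual f p))
        \<le> ereal (exp (C * ln h / sqrt h)
                    * (native_norm_on \<delta> \<Omega> f + c * inverse (srt_tau p) * vec_norm2 (sample f X))
                  + C' * h powr (- real (sum \<gamma> UNIV))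
                    * Max ((\<lambda>x. cmod (srt_residual f p x)) ` set (node_data X (last p)))))"

lemma srt_sampling_bound_regular:
  fixes D :: "(real ^ 'n) set"
  assumes D: "convex D" "bounded D" and ball: "cball z \<rho> \<subseteq> D" and \<rho>: "0 < \<rho>"
    and R: "1 \<le> R" "D \<subseteq> cball z R" and \<delta>: "0 < \<delta>" and q: "1 \<le> q"
  shows "\<exists>h0>0. \<exists>C'>0. srt_sampling_bound D q \<gamma> \<delta> (1 / (8 * sqrt (4 * (R / \<rho> + 1) / \<rho>))) h0 C'"
proof -
  let ?C = "1 / (8 * sqrt (4 * (R / \<rho> + 1) / \<rho>))"
  let ?V = "1 + measure lebesgue D powr (1 / real_of_ereal q)"
  have V: "0 < ?V" by (simp add: add_pos_nonneg)
  obtain h1 C' where h1: "0 < h1" and C': "0 < C'"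
    and bound: "\<forall>F\<in>native_space \<delta>. \<forall>s\<in>native_space \<delta>. \<forall>h Y N.
      0 < h \<longrightarrow> h \<le> h1 \<longrightarrow> Y \<subseteq> D \<longrightarrow> (\<forall>x\<in>D. \<exists>y\<in>Y. dist x y \<le> h * (R / \<rho> + 1)) \<longrightarrow>
      (\<forall>y\<in>Y. cmod (F y - s y) \<le> N) \<longrightarrow>
      (\<forall>x\<in>D. ?V * cmod (mderiv \<gamma> (\<lambda>x. F x - s x) x) \<le>
        exp (?C * ln h / sqrt h) * (native_norm \<delta> F + native_norm \<delta> s) + C' * h powr (- real (sum \<gamma> UNIV)) * N)"
    using sampling_inequality[OF D ball \<rho> R \<delta> V, of \<gamma>] by (elim exE conjE)
  \<comment> \<open>Besides the threshold of the sampling inequality, \<open>h\<close> must not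
    exceed \<rho>, so that \<open>data_dense_in_convex\<close> finds data inside
    \<open>D\<close>.\<close>
  have "srt_sampling_bound D q \<gamma> \<delta> ?C (min h1 \<rho>) C'"
    unfolding srt_sampling_bound_def
  proof (intro allI impI)
    fix \<Omega> X f T p h c
    assume srt: "is_srt \<Omega> X f T" and p: "p \<in> branches T" and Dp: "region (last p) = D"
      and shape: "shape (last p) < \<delta>" and f: "f \<in> native_space_on \<delta> \<Omega>"
      and h: "ereal h = fill_distance (set X) \<Omega>" "h \<le> min h1 \<rho>"
      and c: "native_norm_on \<delta> D (srt_prediction p) \<le> c * inverse (srt_tau p) * vec_norm2 (sample f X)"
    let ?s = "srt_prediction p" and ?Y = "set (node_data X (last p))"
    let ?N = "Max ((\<lambda>x. cmod (srt_residual f p x)) ` ?Y)"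
    obtain r where r: "srt_node_ok X r (last p)" using srt_path_bounds(3)[OF srt p] by blast
    then have Yne: "?Y \<noteq> {}" by (auto simp: srt_node_ok_def)
    then have Xne: "set X \<noteq> {}" by (auto simp: node_data_def)
    have \<Omega>: "open \<Omega>" "\<Omega> \<noteq> {}" using srt by (auto simp: is_srt_def)
    have D\<Omega>: "D \<subseteq> \<Omega>" using srt_path_bounds(2)[OF srt p] Dp by simp
    have Y: "?Y = set X \<inter> D" by (auto simp: node_data_def Dp)
    have h0: "0 < h" by (rule fill_distance_finite(1)[OF finite_set Xne \<Omega> h(1)])
    \<comment> \<open>The very extension that defines \<open>native_norm_on\<close>, so its norm is
      the one in the bound.\<close>
    define F where "F = (SOME F. native_extension \<delta> \<Omega> f F)"
    have "native_extension \<delta> \<Omega> f F"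
      using f unfolding F_def native_space_on_def by (elim CollectE exE) (rule someI[of "native_extension \<delta> \<Omega> f"])
    then have F: "F \<in> native_space \<delta>" "\<And>x. x \<in> \<Omega> \<Longrightarrow> f x = F x" by (auto simp: native_extension_def)
    have nF: "native_norm_on \<delta> \<Omega> f = native_norm \<delta> F" by (simp add: native_norm_on_def F_def)
    have s: "?s \<in> native_space \<delta>" by (rule srt_prediction_native(1)[OF srt p less_imp_le[OF shape]])
    have ns: "native_norm \<delta> ?s \<le> c * inverse (srt_tau p) * vec_norm2 (sample f X)"
      using c unfolding srt_native_norm(2)[OF srt p shape, unfolded Dp] .
    have res: "srt_residual f p x = F x - ?s x" if "x \<in> \<Omega>" for x
      using F(2)[OF that] by (simp add: srt_residual_def)
    have N: "\<forall>y\<in>?Y. cmod (F y - ?s y) \<le> ?N"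
    proof
      fix y assume y: "y \<in> ?Y"
      then have "y \<in> \<Omega>" using Y D\<Omega> by auto
      then have "cmod (F y - ?s y) = cmod (srt_residual f p y)" by (simp add: res)
      also have "\<dots> \<le> ?N" using y by (intro Max_ge) auto
      finally show "cmod (F y - ?s y) \<le> ?N" .
    qed
    have dense: "\<forall>x\<in>D. \<exists>y\<in>?Y. dist x y \<le> h * (R / \<rho> + 1)"
    proof
      fix x assume "x \<in> D"
      from data_dense_in_convex[OF finite_set Xne h(1) h0 _ D(1) D\<Omega> ball R(2) this] h(2)
      show "\<exists>y\<in>?Y. dist x y \<le> h * (R / \<rho> + 1)" unfolding Y by simp
    qed
    let ?B = "exp (?C * ln h / sqrt h) * (native_norm_on \<delta> \<Omega> f + c * inverse (srt_tau p) * vec_norm2 (sample f X))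
        + C' * h powr (- real (sum \<gamma> UNIV)) * ?N"
    have "h \<le> h1" "?Y \<subseteq> D" using h(2) Y by auto
    note bd = bound[rule_format, OF F(1) s h0 this dense[rule_format] N[rule_format]]
    have B: "?V * cmod (mderiv \<gamma> (\<lambda>x. F x - ?s x) x) \<le> ?B" if "x \<in> D" for x
    proof -
      have "exp (?C * ln h / sqrt h) * (native_norm \<delta> F + native_norm \<delta> ?s) \<le>
          exp (?C * ln h / sqrt h) * (native_norm_on \<delta> \<Omega> f + c * inverse (srt_tau p) * vec_norm2 (sample f X))"
        unfolding nF using ns by (intro mult_left_mono add_left_mono) auto
      then show ?thesis using bd[OF _ _ that] by linarith
    qed
    have zD: "z \<in> D" using ball \<rho> by auto
    have B0: "0 \<le> ?B" by (rule order_trans[OF _ B[OF zD]]) (use V in simp)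
    show "Lq_norm q D (mderiv \<gamma> (srt_residual f p)) \<le> ereal ?B"
      by (rule srt_residual_Lq_bound[OF D D\<Omega> \<Omega>(1) q F(1) s \<delta> res B0 B])
  qed
  moreover have "0 < min h1 \<rho>" using h1 \<rho> by simp
  ultimately show ?thesis using C' by blast
qed

text \<open>\<open>C\<close> has to be provided for every set \<open>D\<close>. A set that is
  nonconvex, unbounded or without interior is never a leaf region of a tree with real fill distance,
  so the bound is vacuous there.\<close>

lemma srt_sampling_bound_exists:
  fixes D :: "(real ^ 'n) set"
  obtains C where "0 < C" "\<And>q \<gamma> \<delta>. 1 \<le> q \<Longrightarrow> 0 < \<delta> \<Longrightarrow> \<exists>h0>0. \<exists>C'>0. srt_sampling_bound D q \<gamma> \<delta> C h0 C'"
proof (cases "convex D \<and> bounded D \<and> interior D \<noteq> {}")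
  case False
  have "False" if srt: "is_srt \<Omega> X f T" and p: "p \<in> branches T" and D: "region (last p) = D"
    and h: "ereal h = fill_distance (set X) \<Omega>" for \<Omega> X f T p h
  proof -
    obtain r where r: "srt_node_ok X r (last p)" using srt_path_bounds(3)[OF srt p] by blast
    then have Xne: "set X \<noteq> {}" by (auto simp: srt_node_ok_def node_data_def)
    have "open \<Omega>" "\<Omega> \<noteq> {}" using srt by (auto simp: is_srt_def)
    from fill_distance_finite(2)[OF finite_set Xne this h] have "bounded \<Omega>" .
    then have "bounded D" using srt_path_bounds(2)[OF srt p] D bounded_subset by blast
    with False r D show False by (auto simp: srt_node_ok_def)
  qed
  then have vacuous: "srt_sampling_bound D q \<gamma> \<delta> 1 1 1" for q \<gamma> \<delta>
    unfolding srt_sampling_bound_def by blast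
  show ?thesis
  proof (rule that[of 1])
    show "\<exists>h0>0. \<exists>C'>0. srt_sampling_bound D q \<gamma> \<delta> 1 h0 C'" for q \<gamma> \<delta>
      by (intro exI[of _ "1::real"] conjI vacuous) simp_all
  qed simp
next
  case True
  then obtain z \<rho>0 where \<rho>0: "0 < \<rho>0" "ball z \<rho>0 \<subseteq> D"
    by (meson all_not_in_conv mem_interior)
  \<comment> \<open>Halving the radius places a closed ball inside \<open>D\<close>. Below,
    \<open>R\<close> is raised to at least 1 so that its powers increase with the exponent.\<close>
  define \<rho> where "\<rho> = \<rho>0 / 2"
  have \<rho>: "0 < \<rho>" and ball: "cball z \<rho> \<subseteq> D"
    using \<rho>0 by (auto simp: \<rho>_def subset_eq)
  obtain R0 where R0: "\<And>x. x \<in> D \<Longrightarrow> dist z x \<le> R0"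
    using True bounded_any_center[of D z] by blast
  define R where "R = max 1 R0"
  have R: "1 \<le> R" "D \<subseteq> cball z R" using R0 by (auto simp: R_def le_max_iff_disj)
  have "0 < 1 / (8 * sqrt (4 * (R / \<rho> + 1) / \<rho>))" using R(1) \<rho> by (simp add: add_pos_pos)
  moreover have "\<exists>h0>0. \<exists>C'>0. srt_sampling_bound D q \<gamma> \<delta> (1 / (8 * sqrt (4 * (R / \<rho> + 1) / \<rho>))) h0 C'"
    if "1 \<le> q" "0 < \<delta>" for q \<gamma> \<delta>
    using srt_sampling_bound_regular[OF _ _ ball \<rho> R that(2,1)] True by blast
  ultimately show ?thesis by (rule that)
qed

text \<open>The order of the quantifiers encodes the admissible dependencies of the constants:
  \<open>CN\<close> precedes the leaf region and the data, \<open>C\<close> follows the region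
  alone, and \<open>h0\<close> and \<open>C'\<close> precede every tree.\<close>

theorem theorem5p4:
  shows "\<exists>CN :: real list \<Rightarrow> nat list \<Rightarrow> real.
    \<forall>D :: (real ^ 'n::finite) set.
    \<exists>C>0.
    \<forall>(q :: ereal) (\<gamma> :: 'n \<Rightarrow> nat) (\<delta> :: real). 1 \<le> q \<longrightarrow> 0 < \<delta> \<longrightarrow>
    (\<exists>h0>0. \<exists>C'>0.
      \<forall>\<Omega> X f T p.
        is_srt \<Omega> X f T \<longrightarrow>
        p \<in> branches T \<longrightarrow>
        region (last p) = D \<longrightarrow>
        shape (last p) < \<delta> \<longrightarrow>
        f \<in> native_space_on \<delta> \<Omega> \<longrightarrow>
          srt_prediction p \<in> native_space_on \<delta> D \<and>
          native_norm_on \<delta> D (srt_prediction p)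
            \<le> CN (map shape p) (map (\<lambda>n. length (centers n)) p)
                * inverse (srt_tau p) * vec_norm2 (sample f X) \<and>
          (\<forall>h c. ereal h = fill_distance (set X) \<Omega> \<longrightarrow> h \<le> h0 \<longrightarrow>
               native_norm_on \<delta> D (srt_prediction p)
                 \<le> c * inverse (srt_tau p) * vec_norm2 (sample f X) \<longrightarrow>
               Lq_norm q D (mderiv \<gamma> (srt_residual f p))
                 \<le> ereal (exp (C * ln h / sqrt h)
                             * (native_norm_on \<delta> \<Omega> f
                                + c * inverse (srt_tau p) * vec_norm2 (sample f X))
                           + C' * h powr (- real (sum \<gamma> UNIV))
                             * Max ((\<lambda>x. cmod (srt_residual f p x)) ` set (node_data X (last p))))))"
proof (rule exI[of _ "srt_constant TYPE('n)"], rule allI, goal_cases)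
  case (1 D)
  obtain C where C: "0 < C"
    and ex: "\<And>q \<gamma> \<delta>. 1 \<le> q \<Longrightarrow> 0 < \<delta> \<Longrightarrow> \<exists>h0>0. \<exists>C'>0. srt_sampling_bound D q \<gamma> \<delta> C h0 C'"
    using srt_sampling_bound_exists by blast
  show ?case
  proof (rule exI[of _ C], intro conjI allI impI C, goal_cases)
    case (1 q \<gamma> \<delta>)
    from ex[OF 1, of \<gamma>] obtain h0 C' where h0: "0 < h0" and C': "0 < C'"
      and bound: "srt_sampling_bound D q \<gamma> \<delta> C h0 C'"
      by blast
    show ?case
    proof (rule exI[of _ h0], rule conjI[OF h0], rule exI[of _ C'], rule conjI[OF C'],
        intro allI impI conjI, goal_cases)
      case (1 \<Omega> X f T p)
      then show ?case using srt_native_norm(1) by blast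
    next
      case (2 \<Omega> X f T p)
      then have "native_norm_on \<delta> D (srt_prediction p) = native_norm \<delta> (srt_prediction p)"
        using srt_native_norm(2) by blast
      with srt_prediction_native(2)[OF 2(1,2) less_imp_le[OF 2(4)]] show ?case by simp
    next
      case (3 \<Omega> X f T p h c)
      then show ?case using bound unfolding srt_sampling_bound_def by blast
    qed
  qed
qed

end
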